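(* Let $\mathcal{H}$ be an infinite-dimensional separable complex Hilbert space. Let $n \in \mathbb{N}$ and let $$-\infty < \rho_-^{(1)} < \rho_+^{(1)} < \rho_-^{(2)} < \rho_+^{(2)} < \cdots < \rho_-^{(n)} < \rho_+^{(n)} < +\infty$$ be real numbers. Let $F \subseteq \mathcal{Q}\left(\bigcup_{j=1}^n \left[\rho_-^{(j)}, \rho_+^{(j)}\right]\right)$ be a compact subset of $\mathbb{C}$ which is symmetric with respect to the real line (i.e. $\lambda \in F \Leftrightarrow \overline{\lambda} \in F$) and such that $$F \cap \left(\rho_-^{(j)}, \rho_+^{(j)}\right) \neq \emptyset, \quad j = 1, \dots, n.$$ Then there exist a bounded self-adjoint operator $T = T^* \in \mathcal{B}(\mathcal{H})$ and a sequence $(\mathcal{L}_l)_{l \in \mathbb{N}} \in \mathfrak{P}(\mathcal{H})$ such that $$\mathrm{Spec}(T) = \bigcup_{j=1}^n \left[\rho_-^{(j)}, \rho_+^{(j)}\right]$$ and $$d_H\left(\mathrm{Spec}_2(T, \mathcal{L}_l), F\right) \to 0 \quad \text{as } l \to +\infty.$$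
   Context: $\mathcal{B}(\mathcal{H})$ is the space of bounded linear operators on $\mathcal{H}$, and $\mathrm{Spec}(T)$ is the spectrum of $T$. $\mathfrak{P}(\mathcal{H})$ is the set of all increasing sequences $\mathcal{L}_1 \subset \mathcal{L}_2 \subset \cdots \subset \mathcal{L}_l \subset \mathcal{L}_{l+1} \subset \cdots$ of finite-dimensional linear subspaces of $\mathcal{H}$ such that the corresponding orthogonal projections $P_l : \mathcal{H} \to \mathcal{L}_l$ converge strongly to the identity operator $I$. For $T = T^* \in \mathcal{B}(\mathcal{H})$ and a finite-dimensional subspace $\mathcal{L} \subset \mathcal{H}$ with orthogonal projection $P : \mathcal{H} \to \mathcal{L}$, the second order relative spectrum is $$\mathrm{Spec}_2(T, \mathcal{L}) := \{\lambda \in \mathbb{C} : P(T - \lambda I)^2|_{\mathcal{L}} : \mathcal{L} \to \mathcal{L} \text{ is not invertible}\}.$$ The Hausdorff distance between two sets $F, G \subset \mathbb{C}$ is $$d_H(F, G) := \max\left\{\sup_{x \in F} \inf_{y \in G} |x - y|, \ \sup_{y \in G} \inf_{x \in F} |x - y|\right\}.$$ For real $c_1 < c_2$, $B[c_1, c_2]$ and $B(c_1, c_2)$ denote respectively the closed and the open disk in $\mathbb{C}$ having the segment $[c_1, c_2]$ as a diameter. For a compact set $\Sigma \subset \mathbb{R}$ with $m := \min \Sigma$, $M := \max \Sigma$ and $[m, M] \setminus \Sigma = \bigcup_j (m_j, M_j)$, where the open intervals $(m_j, M_j)$ are pairwise disjoint, define $$\mathcal{Q}(\Sigma) := B[m,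 M] \setminus \bigcup_j B(m_j, M_j).$$ *)

theory Defs
  imports "HOL-Analysis.Analysis"
begin

section \<open>Complex Hilbert spaces\<close>

text \<open>The inner product is linear in its first argument. The real scaling, norm, metric and
  topology are those of the real normed space underlying the complex one.\<close>

class complex_inner = real_normed_vector +
  fixes scaleC :: "complex \<Rightarrow> 'a \<Rightarrow> 'a"  (infixr "*\<^sub>C" 75)
    and cinner :: "'a \<Rightarrow> 'a \<Rightarrow> complex"
  assumes scaleC_add_right: "c *\<^sub>C (x + y) = c *\<^sub>C x + c *\<^sub>C y"
    and scaleC_add_left: "(c + d) *\<^sub>C x = c *\<^sub>C x + d *\<^sub>C x"
    and scaleC_scaleC: "c *\<^sub>C (d *\<^sub>C x) = (c * d) *\<^sub>C x"
    and scaleR_scaleC: "r *\<^sub>R x = complex_of_real r *\<^sub>C x"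
    and cinner_add_left: "cinner (x + y) z = cinner x z + cinner y z"
    and cinner_scaleC_left: "cinner (c *\<^sub>C x) y = c * cinner x y"
    and cinner_commute: "cinner x y = cnj (cinner y x)"
    and cinner_ge_zero: "0 \<le> Re (cinner x x)"
    and norm_eq_sqrt_cinner: "norm x = sqrt (Re (cinner x x))"

class complex_hilbert = complex_inner + complete_space

global_interpretation complex_vector: vector_space "scaleC :: complex \<Rightarrow> 'a \<Rightarrow> 'a::complex_inner"
  defines csubspace = complex_vector.subspace
    and cspan = complex_vector.span
proof
  show "1 *\<^sub>C x = x" for x :: 'a
    using scaleR_scaleC[of 1 x] by simp
qed (rule scaleC_add_right scaleC_add_left scaleC_scaleC)+

definition cfinite_dim :: "'a::complex_inner set \<Rightarrow> bool" where
  "cfinite_dim L \<longleftrightarrow> (\<exists>B. finite B \<and> cspan B = L)"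


section \<open>Bounded operators\<close>

definition bounded_clinear :: "('a::complex_inner \<Rightarrow> 'a) \<Rightarrow> bool" where
  "bounded_clinear T \<longleftrightarrow> bounded_linear T \<and> (\<forall>c x. T (c *\<^sub>C x) = c *\<^sub>C T x)"

definition cadjoint :: "('a::complex_inner \<Rightarrow> 'a) \<Rightarrow> ('a \<Rightarrow> 'a)" where
  "cadjoint T = (SOME S. \<forall>x y. cinner (T x) y = cinner x (S y))"

lemma cinner_eq_zero: "cinner x x = 0 \<Longrightarrow> x = (0::'a::complex_inner)"
  using norm_eq_sqrt_cinner[of x] by simp

lemma cinner_diff_right:
  "cinner x (y - z) = cinner x y - cinner x (z::'a::complex_inner)"
proof -
  have "cinner (y - z) x + cinner z x = cinner y x"
    using cinner_add_left[of "y - z" z x] by simp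
  then have "cinner (y - z) x = cinner y x - cinner z x"
    by (simp add: algebra_simps)
  then show ?thesis
    by (metis cinner_commute complex_cnj_diff)
qed

lemma cadjoint_eqI:
  fixes T S :: "'a::complex_inner \<Rightarrow> 'a"
  assumes "\<And>x y. cinner (T x) y = cinner x (S y)"
  shows "cadjoint T = S"
proof -
  have adj: "\<forall>x y. cinner (T x) y = cinner x (cadjoint T y)"
    unfolding cadjoint_def by (rule someI[of _ S]) (use assms in blast)
  have "cadjoint T y = S y" for y
  proof -
    have "cinner (cadjoint T y - S y) (cadjoint T y - S y) = 0"
      using adj assms by (simp add: cinner_diff_right)
    from cinner_eq_zero[OF this] show ?thesis
      by simp
  qed
  then show ?thesis
    by blast
qed

definition spectrum :: "('a::complex_inner \<Rightarrow> 'a) \<Rightarrow> complex set" where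
  "spectrum T = {\<mu>. \<not> (\<exists>S. bounded_clinear S \<and>
     (\<forall>x. S (T x - \<mu> *\<^sub>C x) = x) \<and> (\<forall>x. T (S x) - \<mu> *\<^sub>C S x = x))}"


section \<open>Projections and second order relative spectra\<close>

text \<open>Orthogonal projection onto \<open>L\<close>; meant for finite-dimensional (more generally, complete)
  subspaces \<open>L\<close>.\<close>

definition cproj :: "'a::complex_inner set \<Rightarrow> 'a \<Rightarrow> 'a" where
  "cproj L x = (THE y. y \<in> L \<and> (\<forall>z\<in>L. cinner (x - y) z = 0))"

definition proj_sequences :: "(nat \<Rightarrow> 'a::complex_inner set) set"  ("\<PP>") where
  "\<PP> = {L. (\<forall>l. csubspace (L l) \<and> cfinite_dim (L l)) \<and> (\<forall>l. L l \<subseteq> L (Suc l)) \<and>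
     (\<forall>x. (\<lambda>l. cproj (L l) x) \<longlonglongrightarrow> x)}"

text \<open>Linear maps from \<open>L\<close> to itself are invertible iff they are bijections of \<open>L\<close>.\<close>

definition spectrum2 :: "('a::complex_inner \<Rightarrow> 'a) \<Rightarrow> 'a set \<Rightarrow> complex set" where
  "spectrum2 T L = {\<mu>. \<not> bij_betw (\<lambda>x. cproj L (((\<lambda>y. T y - \<mu> *\<^sub>C y) ^^ 2) x)) L L}"


section \<open>Hausdorff distance and the region \<open>\<Q>(\<Sigma>)\<close>\<close>

text \<open>The value lies in \<open>[0, \<infinity>]\<close>, so that the suprema and infima make sense for empty and for
  unbounded sets as well.\<close>

definition hausdorff_distance :: "complex set \<Rightarrow> complex set \<Rightarrow> ennreal" where
  "hausdorff_distance F G =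
     max (SUP x\<in>F. INF y\<in>G. ennreal (norm (x - y))) (SUP y\<in>G. INF x\<in>F. ennreal (norm (x - y)))"

definition closed_disk :: "real \<Rightarrow> real \<Rightarrow> complex set" where
  "closed_disk c1 c2 = cball (complex_of_real ((c1 + c2) / 2)) ((c2 - c1) / 2)"

definition open_disk :: "real \<Rightarrow> real \<Rightarrow> complex set" where
  "open_disk c1 c2 = ball (complex_of_real ((c1 + c2) / 2)) ((c2 - c1) / 2)"

text \<open>For nonempty compact \<open>\<Sigma>\<close>, \<open>Inf \<Sigma>\<close> and \<open>Sup \<Sigma>\<close> are its minimum and maximum, and the pairwise
  disjoint open intervals with union \<open>[Inf \<Sigma>, Sup \<Sigma>] - \<Sigma>\<close> are the connected components of that
  set; see the lemma below.\<close>

definition disk_region :: "real set \<Rightarrow> complex set"  ("\<Q>") where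
  "\<Q> \<Sigma> = closed_disk (Inf \<Sigma>) (Sup \<Sigma>) -
     (\<Union>(a, b) \<in> {(a, b). a < b \<and> {a<..<b} \<in> components ({Inf \<Sigma>..Sup \<Sigma>} - \<Sigma>)}. open_disk a b)"

lemma disk_region_eq:
  fixes a b :: "'i \<Rightarrow> real"
  assumes lt: "\<And>j. j \<in> J \<Longrightarrow> a j < b j"
    and disj: "disjoint_family_on (\<lambda>j. {a j<..<b j}) J"
    and un: "{Inf \<Sigma>..Sup \<Sigma>} - \<Sigma> = (\<Union>j\<in>J. {a j<..<b j})"
  shows "\<Q> \<Sigma> = closed_disk (Inf \<Sigma>) (Sup \<Sigma>) - (\<Union>j\<in>J. open_disk (a j) (b j))"
proof -
  have comps: "components ({Inf \<Sigma>..Sup \<Sigma>} - \<Sigma>) = (\<lambda>j. {a j<..<b j}) ` J"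
  proof (rule components_open_unique)
    show "pairwise disjnt ((\<lambda>j. {a j<..<b j}) ` J)"
      using disj by (force simp: pairwise_def disjnt_def disjoint_family_on_def)
    show "\<Union> ((\<lambda>j. {a j<..<b j}) ` J) = {Inf \<Sigma>..Sup \<Sigma>} - \<Sigma>"
      using un by simp
    show "open X \<and> connected X \<and> X \<noteq> {}" if "X \<in> (\<lambda>j. {a j<..<b j}) ` J" for X
      using that lt by (force simp: greaterThanLessThan_empty_iff)
  qed
  have inj: "c = a j \<and> d = b j" if "c < d" "{c<..<d} = {a j<..<b j}" "a j < b j" for c d j
    using closure_greaterThanLessThan[OF that(1)] closure_greaterThanLessThan[OF that(3)] that
    by (metis Icc_eq_Icc less_imp_le)
  have "{(c, d). c < d \<and> {c<..<d} \<in> (\<lambda>j. {a j<..<b j}) ` J} = (\<lambda>j. (a j, b j)) ` J"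
    (is "?A = ?B")
  proof
    show "?A \<subseteq> ?B"
    proof clarify
      fix c d j assume "c < d" "{c<..<d} = {a j<..<b j}" "j \<in> J"
      with inj lt have "(c, d) = (a j, b j)"
        by simp
      with \<open>j \<in> J\<close> show "(c, d) \<in> ?B"
        by blast
    qed
    show "?B \<subseteq> ?A"
      using lt by blast
  qed
  then show ?thesis
    unfolding disk_region_def comps by simp
qed

end

theory Submission
  imports Defs "Jordan_Normal_Form.Char_Poly"
begin

text \<open>Split an orthonormal basis into \<open>n\<close> infinite families (colours), one for each interval
  \<open>[a\<^sub>j, b\<^sub>j]\<close>, and let \<open>E m\<close> be spanned by the first \<open>m\<close> vectors of each. The operator \<open>T\<close> is the limit of
  finite-rank self-adjoint colour-preserving operators \<open>T\<^sub>l\<close> on \<open>E (m\<^sub>l)\<close> whose form on colour \<open>j\<close> lies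
  strictly between \<open>a\<^sub>j\<close> and \<open>b\<^sub>j\<close>; the corrections decrease so fast that the second order spectra,
  being eigenvalues of companion matrices, do not change much in the limit.

  The spaces must exhaust the Hilbert space, so each \<open>L\<^sub>l\<^sub>+\<^sub>1\<close> has to contain \<open>E (m\<^sub>l)\<close>. The key step
  enlarges \<open>E (m\<^sub>l)\<close> to some \<open>E M\<close> and changes \<open>T\<^sub>l\<close> slightly such that the second order spectrum relative to
  \<open>E M\<close> clusters at points \<open>f\<^sub>j\<close> of \<open>F\<close> in the open intervals. This is possible because large nilpotent matrices
  can be nearly self-adjoint: after repeated doubling of the space, the compression of \<open>T\<close> is the real part
  of an operator whose only eigenvalues are near the \<open>f\<^sub>j\<close>, and a coupling to fresh basis vectors
  gives \<open>T\<^sup>2\<close> the compression that factors the quadratic pencil.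

  The remaining points \<open>z\<close> of a finite net of \<open>F\<close> come from single vectors: \<open>z\<close> lies in \<open>\<Q> \<Sigma>\<close> iff some
  probability measure on \<open>\<Sigma>\<close> has mean \<open>Re z\<close> and variance \<open>(Im z)\<^sup>2\<close>. Four atoms suffice, and a
  vector with this spectral measure has second order spectrum \<open>{z, cnj z}\<close>.\<close>

section \<open>Continuity of eigenvalues\<close>

text \<open>The obstacle is that old vectors must stay. If \<open>T\<close> maps \<open>E m\<close>
  into itself, its second order spectrum relative to \<open>E m\<close> is its set of eigenvalues
  there: real points that may be far from \<open>F\<close>. So \<open>E m\<close> has to be embedded
  in a larger space on which \<open>T\<close> still nearly agrees with the old operator, but whose
  quadratic pencil has no eigenvalues away from the \<open>f j\<close>. This is where
  \<open>F\<close> has to meet every open interval.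

  The trade-off behind it: after \<open>d\<close> doublings the self-adjoint part of the nilpotent
  operator restricts on \<open>E m\<close> to d/2 times a prescribed operator, while its skew part
  has norm of order sqrt d. Scaling by 2/d recovers the prescribed operator and makes the skew part
  as small as desired.

  Each absorption widens the numerical range a little. Hence the operators keep a margin
  \<open>r0 / Suc l\<close> inside the intervals, and a stage may spend the difference of two
  consecutive margins. The atoms are moved into the shrunken intervals, at a cost tending to
  0.\<close>

definition eigen_fun :: "nat \<Rightarrow> (nat \<Rightarrow> nat \<Rightarrow> complex) \<Rightarrow> complex \<Rightarrow> bool" where
  "eigen_fun N C \<mu> \<longleftrightarrow> (\<exists>x. (\<exists>i<N. x i \<noteq> 0) \<and> (\<forall>i<N. (\<Sum>j<N. C i j * x j) = \<mu> * x i))"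

lemma eigen_fun_iff_eigenvalue:
  "eigen_fun N C \<mu> \<longleftrightarrow> eigenvalue (Matrix.mat N N (\<lambda>(i, j). C i j)) \<mu>"
proof
  assume "eigen_fun N C \<mu>"
  then obtain x where x: "\<exists>i<N. x i \<noteq> 0" "\<forall>i<N. (\<Sum>j<N. C i j * x j) = \<mu> * x i"
    unfolding eigen_fun_def by blast
  have "eigenvector (Matrix.mat N N (\<lambda>(i, j). C i j)) (Matrix.vec N x) \<mu>"
    unfolding eigenvector_def
    using x by (auto simp: Matrix.vec_eq_iff scalar_prod_def lessThan_atLeast0)
  then show "eigenvalue (Matrix.mat N N (\<lambda>(i, j). C i j)) \<mu>"
    unfolding eigenvalue_def by blast
next
  assume "eigenvalue (Matrix.mat N N (\<lambda>(i, j). C i j)) \<mu>"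
  then obtain v where v: "v \<in> carrier_vec N" "v \<noteq> 0\<^sub>v N"
    "Matrix.mat N N (\<lambda>(i, j). C i j) *\<^sub>v v = \<mu> \<cdot>\<^sub>v v"
    unfolding eigenvalue_def eigenvector_def by auto
  have "(\<Sum>j<N. C i j * vec_index v j) = \<mu> * vec_index v i" if "i < N" for i
    using arg_cong[OF v(3), of "\<lambda>w. vec_index w i"] v(1) that
    by (auto simp: scalar_prod_def lessThan_atLeast0)
  moreover have "\<exists>i<N. vec_index v i \<noteq> 0"
    using v(1,2) by (auto simp: Matrix.vec_eq_iff)
  ultimately show "eigen_fun N C \<mu>"
    unfolding eigen_fun_def by blast
qed

text \<open>The determinant of \<mu> - C, expanded by Leibniz so that joint continuity in
  \<open>C\<close> and \<mu> only concerns finite sums and products.\<close>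

definition char_det :: "nat \<Rightarrow> (nat \<Rightarrow> nat \<Rightarrow> complex) \<Rightarrow> complex \<Rightarrow> complex" where
  "char_det N C \<mu> = (\<Sum>p | p permutes {0..<N}.
     signof p * (\<Prod>i = 0..<N. (if i = p i then \<mu> else 0) - C i (p i)))"

lemma char_det_eq: "char_det N C \<mu> = poly (char_poly (Matrix.mat N N (\<lambda>(i, j). C i j))) \<mu>"
proof -
  have c: "char_poly_matrix (Matrix.mat N N (\<lambda>(i, j). C i j)) \<in> carrier_mat N N"
    by simp
  have "poly (char_poly (Matrix.mat N N (\<lambda>(i, j). C i j))) \<mu> =
    (\<Sum>p | p permutes {0..<N}. poly (signof p *
      (\<Prod>i = 0..<N. char_poly_matrix (Matrix.mat N N (\<lambda>(i, j). C i j)) $$ (i, p i))) \<mu>)"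
    unfolding char_poly_def det_def'[OF c] by (simp add: poly_sum)
  also have "\<dots> = char_det N C \<mu>"
    unfolding char_det_def
  proof (rule sum.cong)
    fix p assume "p \<in> {p. p permutes {0..<N}}"
    then have p: "p i < N" if "i < N" for i
      using that permutes_in_image[of p "{0..<N}" i] by auto
    show "poly (signof p *
      (\<Prod>i = 0..<N. char_poly_matrix (Matrix.mat N N (\<lambda>(i, j). C i j)) $$ (i, p i))) \<mu>
      = signof p * (\<Prod>i = 0..<N. (if i = p i then \<mu> else 0) - C i (p i))"
      using p by (auto simp: poly_prod char_poly_matrix_def sign_def intro!: prod.cong)
  qed simp
  finally show ?thesis ..
qed

lemma char_det_zero_iff: "char_det N C \<mu> = 0 \<longleftrightarrow> eigen_fun N C \<mu>"
  unfolding char_det_eq eigen_fun_iff_eigenvalue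
  by (rule eigenvalue_root_char_poly[symmetric, where n = N]) simp

text \<open>The characteristic polynomial splits into \<open>N\<close> monic linear factors, each of
  modulus at least \<epsilon> at \<mu>. This bound does the work of Rouche's theorem when
  eigenvalues are followed under perturbation.\<close>

lemma norm_char_det_ge:
  assumes "\<And>\<nu>. eigen_fun N C \<nu> \<Longrightarrow> \<epsilon> \<le> norm (\<mu> - \<nu>)" "\<epsilon> \<ge> 0"
  shows "\<epsilon> ^ N \<le> norm (char_det N C \<mu>)"
proof -
  have "Matrix.mat N N (\<lambda>(i, j). C i j) \<in> carrier_mat N N" by simp
  from char_poly_factorized[OF this] obtain as where
    as: "char_poly (Matrix.mat N N (\<lambda>(i, j). C i j)) = (\<Prod>a\<leftarrow>as. [:- a, 1:])" "length as = N"
    by blast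
  have ge: "\<epsilon> \<le> norm (\<mu> - a)" if "a \<in> set as" for a
  proof (rule assms(1))
    have "char_det N C a = 0"
      unfolding char_det_eq as using that by (auto simp: poly_prod_list prod_list_zero_iff)
    then show "eigen_fun N C a"
      by (simp add: char_det_zero_iff)
  qed
  have "\<epsilon> ^ length bs \<le> norm (\<Prod>a\<leftarrow>bs. \<mu> - a)" if "set bs \<subseteq> set as" for bs
    using that
  proof (induction bs)
    case (Cons b bs)
    then show ?case
      using ge[of b] assms(2) by (auto simp: norm_mult intro!: mult_mono)
  qed simp
  from this[of as] show ?thesis
    unfolding char_det_eq as by (simp add: poly_prod_list as o_def)
qed

lemma tendsto_char_det:
  assumes "\<And>i j. i < N \<Longrightarrow> j < N \<Longrightarrow> (\<lambda>k. C k i j) \<longlonglongrightarrow> C' i j" "\<mu> \<longlonglongrightarrow> \<mu>'"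
  shows "(\<lambda>k. char_det N (C k) (\<mu> k)) \<longlonglongrightarrow> char_det N C' \<mu>'"
  unfolding char_det_def
proof (intro tendsto_intros)
  fix p i assume "p \<in> {p. p permutes {0..<N}}" "i \<in> {0..<N}"
  then show "(\<lambda>k. C k i (p i)) \<longlonglongrightarrow> C' i (p i)"
    using assms(1) permutes_in_image[of p "{0..<N}" i] by auto
  show "(\<lambda>k. if i = p i then \<mu> k else 0) \<longlonglongrightarrow> (if i = p i then \<mu>' else 0)"
    using assms(2) by auto
qed

text \<open>Compare the coordinates at an index where the eigenvector is largest.\<close>

lemma eigen_fun_bound:
  assumes "eigen_fun N C \<mu>"
  shows "norm \<mu> \<le> (\<Sum>i<N. \<Sum>j<N. norm (C i j))"
proof -
  from assms obtain x i0 where x: "i0 < N" "x i0 \<noteq> 0" "\<forall>i<N. (\<Sum>j<N. C i j * x j) = \<mu> * x i"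
    unfolding eigen_fun_def by blast
  have "Max ((\<lambda>i. norm (x i)) ` {..<N}) \<in> (\<lambda>i. norm (x i)) ` {..<N}"
    using x(1) by (intro Max_in) auto
  then obtain i where "i < N" "norm (x i) = Max ((\<lambda>i. norm (x i)) ` {..<N})"
    by auto
  then have i: "i < N" "\<And>j. j < N \<Longrightarrow> norm (x j) \<le> norm (x i)"
    by auto
  have pos: "norm (x i) > 0"
    using i(2)[OF x(1)] x(2) by (metis less_le_trans zero_less_norm_iff)
  have "norm \<mu> * norm (x i) = norm (\<Sum>j<N. C i j * x j)"
    using x(3) i(1) by (simp add: norm_mult)
  also have "\<dots> \<le> (\<Sum>j<N. norm (C i j) * norm (x i))"
    by (rule order.trans[OF norm_sum]) (auto simp: norm_mult intro!: sum_mono mult_left_mono i(2))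
  also have "\<dots> = (\<Sum>j<N. norm (C i j)) * norm (x i)"
    by (simp add: sum_distrib_right)
  finally have "norm \<mu> \<le> (\<Sum>j<N. norm (C i j))"
    using pos by simp
  also have "\<dots> \<le> (\<Sum>i<N. \<Sum>j<N. norm (C i j))"
    using i(1) by (intro member_le_sum[of i "{..<N}" "\<lambda>i. \<Sum>j<N. norm (C i j)"]) (auto intro: sum_nonneg)
  finally show ?thesis .
qed

text \<open>A compactness argument along a sequence of matrices tending to \<open>C\<close>. It
  yields no rate, which is why the construction below picks \<eta> only after the operator of a
  stage is fixed.\<close>

lemma eigen_fun_continuity:
  assumes "\<epsilon> > 0"
  shows "\<exists>\<eta>>0. \<forall>C'. (\<forall>i<N. \<forall>j<N. norm (C' i j - C i j) < \<eta>) \<longrightarrow>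
     (\<forall>\<mu>'. eigen_fun N C' \<mu>' \<longrightarrow> (\<exists>\<mu>. eigen_fun N C \<mu> \<and> norm (\<mu>' - \<mu>) < \<epsilon>)) \<and>
     (\<forall>\<mu>. eigen_fun N C \<mu> \<longrightarrow> (\<exists>\<mu>'. eigen_fun N C' \<mu>' \<and> norm (\<mu> - \<mu>') < \<epsilon>))"
    (is "\<exists>\<eta>>0. \<forall>C'. ?close \<eta> C' \<longrightarrow> ?A C' \<and> ?B C'")
proof (rule ccontr)
  assume "\<not> ?thesis"
  then have "\<exists>C'. ?close (inverse (Suc k)) C' \<and> \<not> (?A C' \<and> ?B C')" for k :: nat
    by (metis inverse_positive_iff_positive of_nat_0_less_iff zero_less_Suc)
  then obtain D where D: "\<And>k. ?close (inverse (Suc k)) (D k)" "\<And>k. \<not> (?A (D k) \<and> ?B (D k))"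
    by metis
  have lim: "(\<lambda>k. D k i j) \<longlonglongrightarrow> C i j" if "i < N" "j < N" for i j
  proof (rule Lim_null_comparison[THEN Lim_null[THEN iffD2]])
    show "eventually (\<lambda>k. norm (D k i j - C i j) \<le> inverse (real (Suc k))) sequentially"
      using D(1) that by (auto intro!: always_eventually less_imp_le)
    show "(\<lambda>k. inverse (real (Suc k))) \<longlonglongrightarrow> 0"
      by (rule LIMSEQ_inverse_real_of_nat)
  qed
  \<comment> \<open>Perturbed eigenvalues that stay away from those of \<open>C\<close> would
    accumulate at a zero of the limit determinant, hence at an eigenvalue of
    \<open>C\<close>.\<close>
  have A: "eventually (\<lambda>k. ?A (D k)) sequentially"
  proof (rule ccontr)
    assume "\<not> ?thesis"
    then have inf: "infinite {k. \<not> ?A (D k)}"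
      by (simp add: frequently_cofinite[symmetric] not_eventually cofinite_eq_sequentially)
    define r where "r = enumerate {k. \<not> ?A (D k)}"
    have r: "strict_mono r" "\<And>k. \<not> ?A (D (r k))"
      using strict_mono_enumerate[OF inf] enumerate_in_set[OF inf] by (auto simp: r_def)
    from r(2) have "\<exists>\<mu>'. eigen_fun N (D (r k)) \<mu>' \<and>
        (\<forall>\<mu>. eigen_fun N C \<mu> \<longrightarrow> \<epsilon> \<le> norm (\<mu>' - \<mu>))" for k
      by (meson not_le)
    then obtain m where m: "\<And>k. eigen_fun N (D (r k)) (m k)"
      "\<And>k \<mu>. eigen_fun N C \<mu> \<Longrightarrow> \<epsilon> \<le> norm (m k - \<mu>)"
      by metis
    have "norm (m k) \<le> (\<Sum>i<N. \<Sum>j<N. norm (C i j) + 1)" for k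
    proof (rule order.trans[OF eigen_fun_bound[OF m(1)]], intro sum_mono)
      fix i j assume "i \<in> {..<N}" "j \<in> {..<N}"
      then have "norm (D (r k) i j - C i j) < inverse (real (Suc (r k)))"
        using D(1) by blast
      also have "\<dots> \<le> 1" by (simp add: field_simps)
      finally show "norm (D (r k) i j) \<le> norm (C i j) + 1"
        using norm_triangle_ineq2[of "D (r k) i j" "C i j"] by linarith
    qed
    then have "bounded (range m)"
      by (auto simp: bounded_iff)
    from bounded_imp_convergent_subsequence[OF this]
    obtain l s where s: "strict_mono s" "(m \<circ> s) \<longlonglongrightarrow> l" by auto
    have "(\<lambda>k. char_det N (D (r (s k))) ((m \<circ> s) k)) \<longlonglongrightarrow> char_det N C l"
    proof (rule tendsto_char_det[OF _ s(2)])
      fix i j assume "i < N" "j < N"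
      from LIMSEQ_subseq_LIMSEQ[OF lim[OF this] strict_mono_o[OF r(1) s(1)]]
      show "(\<lambda>k. D (r (s k)) i j) \<longlonglongrightarrow> C i j" by (simp add: o_def)
    qed
    moreover have "(\<lambda>k. char_det N (D (r (s k))) ((m \<circ> s) k)) = (\<lambda>k. 0)"
      using m(1) by (auto simp: char_det_zero_iff)
    ultimately have "char_det N C l = 0"
      by (metis LIMSEQ_const_iff)
    then have "\<epsilon> \<le> norm ((m \<circ> s) k - l)" for k
      using m(2) by (simp add: char_det_zero_iff)
    moreover have "eventually (\<lambda>k. norm ((m \<circ> s) k - l) < \<epsilon>) sequentially"
      using s(2) assms by (auto simp: tendsto_iff dist_norm)
    ultimately show False
      by (auto simp: eventually_sequentially not_less[symmetric])
  qed
  \<comment> \<open>Conversely, without perturbed eigenvalues near some eigenvalue of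
    \<open>C\<close>, the determinants would stay at least \<open>\<epsilon> ^ N\<close> in modulus
    and yet tend to 0.\<close>
  have B: "eventually (\<lambda>k. ?B (D k)) sequentially"
  proof (rule ccontr)
    assume "\<not> ?thesis"
    then have inf: "infinite {k. \<not> ?B (D k)}"
      by (simp add: frequently_cofinite[symmetric] not_eventually cofinite_eq_sequentially)
    define r where "r = enumerate {k. \<not> ?B (D k)}"
    have r: "strict_mono r" "\<And>k. \<not> ?B (D (r k))"
      using strict_mono_enumerate[OF inf] enumerate_in_set[OF inf] by (auto simp: r_def)
    from r(2) have "\<exists>\<mu>. eigen_fun N C \<mu> \<and>
        (\<forall>\<mu>'. eigen_fun N (D (r k)) \<mu>' \<longrightarrow> \<epsilon> \<le> norm (\<mu> - \<mu>'))" for k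
      by (meson not_le)
    then obtain m where m: "\<And>k. eigen_fun N C (m k)"
      "\<And>k \<mu>'. eigen_fun N (D (r k)) \<mu>' \<Longrightarrow> \<epsilon> \<le> norm (m k - \<mu>')"
      by metis
    have "bounded (range m)"
      using eigen_fun_bound[OF m(1)] by (auto simp: bounded_iff)
    from bounded_imp_convergent_subsequence[OF this]
    obtain l s where s: "strict_mono s" "(m \<circ> s) \<longlonglongrightarrow> l" by auto
    have "(\<lambda>k. char_det N C ((m \<circ> s) k)) \<longlonglongrightarrow> char_det N C l"
      by (rule tendsto_char_det[OF _ s(2)]) auto
    moreover have "(\<lambda>k. char_det N C ((m \<circ> s) k)) = (\<lambda>k. 0)"
      using m(1) by (auto simp: char_det_zero_iff)
    ultimately have 0: "char_det N C l = 0"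
      by (metis LIMSEQ_const_iff)
    have "(\<lambda>k. char_det N (D (r (s k))) ((m \<circ> s) k)) \<longlonglongrightarrow> char_det N C l"
    proof (rule tendsto_char_det[OF _ s(2)])
      fix i j assume "i < N" "j < N"
      from LIMSEQ_subseq_LIMSEQ[OF lim[OF this] strict_mono_o[OF r(1) s(1)]]
      show "(\<lambda>k. D (r (s k)) i j) \<longlonglongrightarrow> C i j" by (simp add: o_def)
    qed
    then have "(\<lambda>k. norm (char_det N (D (r (s k))) ((m \<circ> s) k))) \<longlonglongrightarrow> 0"
      by (simp add: 0 tendsto_norm_zero)
    moreover have "\<epsilon> ^ N \<le> norm (char_det N (D (r (s k))) ((m \<circ> s) k))" for k
      using norm_char_det_ge[of N "D (r (s k))" \<epsilon> "(m \<circ> s) k"] m(2) assms by auto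
    ultimately have "\<epsilon> ^ N \<le> 0"
      by (intro LIMSEQ_le_const) auto
    moreover have "0 < \<epsilon> ^ N" using assms by simp
    ultimately show False by linarith
  qed
  from eventually_conj[OF A B] D(2) show False
    by (auto simp: eventually_sequentially)
qed

section \<open>Complex inner product spaces\<close>

lemma cinner_add_right: "cinner x (y + z) = cinner x y + cinner x (z::'a::complex_inner)"
  by (metis cinner_add_left cinner_commute complex_cnj_add)

lemma cinner_scaleC_right: "cinner x (c *\<^sub>C y) = cnj c * cinner x (y::'a::complex_inner)"
  by (metis cinner_commute cinner_scaleC_left complex_cnj_mult)

lemma cinner_zero_left [simp]: "cinner 0 (x::'a::complex_inner) = 0"
  using cinner_add_left[of 0 0 x] by simp

lemma cinner_zero_right [simp]: "cinner (x::'a::complex_inner) 0 = 0"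
  using cinner_add_right[of x 0 0] by simp

lemma cinner_diff_left: "cinner (x - y) z = cinner x z - cinner y (z::'a::complex_inner)"
  by (metis cinner_diff_right cinner_commute complex_cnj_diff)

lemma cinner_minus_left: "cinner (- x) y = - cinner x (y::'a::complex_inner)"
  using cinner_diff_left[of 0 x y] by simp

lemma cinner_minus_right: "cinner x (- y) = - cinner x (y::'a::complex_inner)"
  using cinner_diff_right[of x 0 y] by simp

lemma cinner_sum_left: "cinner (\<Sum>i\<in>I. f i) x = (\<Sum>i\<in>I. cinner (f i) (x::'a::complex_inner))"
  by (induction I rule: infinite_finite_induct) (auto simp: cinner_add_left)

lemma cinner_sum_right: "cinner x (\<Sum>i\<in>I. f i) = (\<Sum>i\<in>I. cinner (x::'a::complex_inner) (f i))"
  by (induction I rule: infinite_finite_induct) (auto simp: cinner_add_right)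

lemmas cinner_simps = cinner_add_left cinner_add_right cinner_diff_left cinner_diff_right
  cinner_minus_left cinner_minus_right cinner_scaleC_left cinner_scaleC_right

lemma scaleR_cinner_left: "cinner (r *\<^sub>R x) y = of_real r * cinner x (y::'a::complex_inner)"
  by (simp add: scaleR_scaleC cinner_scaleC_left)

lemma scaleR_cinner_right: "cinner x (r *\<^sub>R y) = of_real r * cinner x (y::'a::complex_inner)"
  by (simp add: scaleR_scaleC cinner_scaleC_right)

lemma norm_sq_eq_cinner: "complex_of_real ((norm x)\<^sup>2) = cinner x (x::'a::complex_inner)"
proof -
  have "Im (cinner x x) = 0"
    using cinner_commute[of x x] by (simp add: complex_eq_iff)
  then show ?thesis
    using norm_eq_sqrt_cinner[of x] cinner_ge_zero[of x] by (simp add: complex_eq_iff)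
qed

lemma norm_sq_eq_Re_cinner: "(norm x)\<^sup>2 = Re (cinner x (x::'a::complex_inner))"
  using norm_sq_eq_cinner[of x] by (metis Re_complex_of_real)

lemma Re_cinner_commute: "Re (cinner x y) = Re (cinner y (x::'a::complex_inner))"
  by (metis cinner_commute complex_cnj(1) cnj.sel(1))

lemma norm_add_sq:
  "(norm (x + y))\<^sup>2 = (norm x)\<^sup>2 + 2 * Re (cinner x y) + (norm (y::'a::complex_inner))\<^sup>2"
  using Re_cinner_commute[of x y] by (simp add: norm_sq_eq_Re_cinner cinner_simps)

lemma norm_add_sq_orthogonal:
  "cinner x y = 0 \<Longrightarrow> (norm (x + y))\<^sup>2 = (norm x)\<^sup>2 + (norm (y::'a::complex_inner))\<^sup>2"
  by (simp add: norm_add_sq)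

lemma norm_scaleC: "norm (c *\<^sub>C x) = norm c * norm (x::'a::complex_inner)"
proof -
  have "cinner (c *\<^sub>C x) (c *\<^sub>C x) = (c * cnj c) * cinner x x"
    by (simp add: cinner_simps)
  then have "complex_of_real ((norm (c *\<^sub>C x))\<^sup>2) = complex_of_real ((norm c * norm x)\<^sup>2)"
    unfolding norm_sq_eq_cinner[symmetric] complex_norm_square[symmetric]
    by (simp add: power_mult_distrib)
  then have "(norm (c *\<^sub>C x))\<^sup>2 = (norm c * norm x)\<^sup>2"
    using of_real_eq_iff by blast
  then show ?thesis
    by (simp add: power2_eq_iff_nonneg)
qed

lemma cinner_Cauchy_Schwarz: "norm (cinner x y) \<le> norm x * norm (y::'a::complex_inner)"
proof (cases "y = 0")
  case False
  define c where "c = cinner x y / cinner y y"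
  have y: "cinner y y = of_real ((norm y)\<^sup>2)" "norm y > 0"
    using False norm_sq_eq_cinner[of y] by simp_all
  have "cinner (x - c *\<^sub>C y) y = 0"
    using y by (simp add: cinner_simps c_def)
  then have "cinner (x - c *\<^sub>C y) (c *\<^sub>C y) = 0"
    by (simp add: cinner_simps)
  from norm_add_sq_orthogonal[OF this] have "(norm (c *\<^sub>C y))\<^sup>2 \<le> (norm x)\<^sup>2"
    by simp
  then have "norm (c *\<^sub>C y) \<le> norm x"
    by (simp add: power2_le_iff_abs_le)
  then have "norm (cinner x y) / (norm y)\<^sup>2 * norm y \<le> norm x"
    by (simp add: norm_scaleC c_def y norm_divide norm_power)
  then show ?thesis
    using y(2) by (simp add: field_simps power2_eq_square)
qed simp

lemma cinner_eqI: "(\<And>z. cinner x z = cinner y z) \<Longrightarrow> x = (y::'a::complex_inner)"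
  using cinner_eq_zero[of "x - y"] by (simp add: cinner_diff_left)

lemma bounded_linear_cinner_left: "bounded_linear (\<lambda>x. cinner x (y::'a::complex_inner))"
  by (rule bounded_linear_intro[where K = "norm y"])
    (auto simp: cinner_simps scaleR_cinner_left scaleR_conv_of_real intro: cinner_Cauchy_Schwarz)

lemma bounded_linear_cinner_right: "bounded_linear (\<lambda>y. cinner (x::'a::complex_inner) y)"
  by (rule bounded_linear_intro[where K = "norm x"])
    (auto simp: cinner_simps scaleR_cinner_right scaleR_conv_of_real mult.commute[of _ "norm x"]
      intro: cinner_Cauchy_Schwarz)

lemmas tendsto_cinner_left = bounded_linear.tendsto[OF bounded_linear_cinner_left]
lemmas tendsto_cinner_right = bounded_linear.tendsto[OF bounded_linear_cinner_right]

section \<open>Linear maps and adjoint pairs\<close>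

definition clin :: "('a::complex_inner \<Rightarrow> 'a) \<Rightarrow> bool" where
  "clin T \<longleftrightarrow> (\<forall>x y. T (x + y) = T x + T y) \<and> (\<forall>c x. T (c *\<^sub>C x) = c *\<^sub>C T x)"

definition adj_pair :: "('a::complex_inner \<Rightarrow> 'a) \<Rightarrow> ('a \<Rightarrow> 'a) \<Rightarrow> bool" where
  "adj_pair S T \<longleftrightarrow> (\<forall>x y. cinner (S x) y = cinner x (T y))"

lemma adj_pairD: "adj_pair S T \<Longrightarrow> cinner (S x) y = cinner x (T y)"
  by (simp add: adj_pair_def)

lemma adj_pair_sym: "adj_pair S T \<Longrightarrow> adj_pair T S"
  unfolding adj_pair_def by (metis cinner_commute)

text \<open>Move \<open>S\<close> to the other side of the inner product. Operators are introduced
  together with an adjoint, so that linearity comes for free.\<close>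

lemma adj_pair_clin:
  assumes "adj_pair S T"
  shows "clin S"
  unfolding clin_def
proof (intro conjI allI cinner_eqI)
  show "cinner (S (x + y)) z = cinner (S x + S y) z" for x y z
    by (simp only: cinner_add_left adj_pairD[OF assms])
  show "cinner (S (c *\<^sub>C x)) z = cinner (c *\<^sub>C S x) z" for c x z
    by (simp only: cinner_scaleC_left adj_pairD[OF assms])
qed

context
  fixes T :: "'a::complex_inner \<Rightarrow> 'a"
  assumes T: "clin T"
begin

lemma clin_add: "T (x + y) = T x + T y"
  and clin_scaleC: "T (c *\<^sub>C x) = c *\<^sub>C T x"
  using T by (auto simp: clin_def)

lemma clin_zero: "T 0 = 0"
  using clin_add[of 0 0] by simp

lemma clin_minus: "T (- x) = - T x"
  using clin_add[of x "- x"] clin_zero by (simp add: eq_neg_iff_add_eq_0 add.commute)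

lemma clin_diff: "T (x - y) = T x - T y"
  using clin_add[of x "- y"] clin_minus[of y] by simp

lemma clin_scaleR: "T (r *\<^sub>R x) = r *\<^sub>R T x"
  by (simp add: scaleR_scaleC clin_scaleC)

lemma clin_sum: "T (\<Sum>i\<in>I. f i) = (\<Sum>i\<in>I. T (f i))"
  by (induction I rule: infinite_finite_induct) (simp_all add: clin_zero clin_add)

end

lemmas clin_simps = clin_add clin_diff clin_minus clin_scaleC clin_scaleR clin_zero

lemma clin_bounded_clinear:
  assumes T: "clin T" and K: "\<And>x. norm (T x) \<le> K * norm x"
  shows "bounded_clinear T"
proof -
  have "bounded_linear T"
    by (rule bounded_linear_intro[where K = K]) (use K in \<open>auto simp: clin_simps[OF T] mult.commute\<close>)
  then show ?thesis
    by (simp add: bounded_clinear_def clin_scaleC[OF T])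
qed

lemma adj_pair_norm_le:
  fixes S T :: "'a::complex_inner \<Rightarrow> 'a"
  assumes "adj_pair S T" "\<And>x. norm (S x) \<le> K * norm x"
  shows "norm (T x) \<le> K * norm x"
proof -
  have K: "K * norm x \<ge> 0" for x :: 'a
    using norm_ge_zero[of "S x"] assms(2)[of x] by linarith
  have "(norm (T x))\<^sup>2 = Re (cinner (S (T x)) x)"
    by (simp add: norm_sq_eq_Re_cinner adj_pairD[OF assms(1)])
  also have "\<dots> \<le> norm (S (T x)) * norm x"
    by (rule order.trans[OF complex_Re_le_cmod cinner_Cauchy_Schwarz])
  also have "\<dots> \<le> K * norm (T x) * norm x"
    by (intro mult_right_mono assms) auto
  finally have "norm (T x) * norm (T x) \<le> norm (T x) * (K * norm x)"
    by (simp add: power2_eq_square mult_ac)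
  then show ?thesis
    using K[of x] by (cases "T x = 0") auto
qed

text \<open>Polarisation, with \<open>T x\<close> rescaled to the norm of \<open>x\<close>.\<close>

lemma sadj_norm_le:
  fixes T :: "'a::complex_inner \<Rightarrow> 'a"
  assumes S: "adj_pair T T" and R: "\<And>x. \<bar>Re (cinner (T x) x)\<bar> \<le> R * (norm x)\<^sup>2"
  shows "norm (T x) \<le> R * norm x"
proof (cases "T x = 0")
  case False
  note lin = adj_pair_clin[OF S]
  from False have "x \<noteq> 0"
    using clin_zero[OF lin] by auto
  define k where "k = norm x / norm (T x)"
  have k: "k > 0"
    using False \<open>x \<noteq> 0\<close> by (simp add: k_def)
  define y where "y = k *\<^sub>R T x"
  have ny: "norm y = norm x"
    using False by (simp add: y_def k_def)
  have "Re (cinner (T (x + y)) (x + y)) - Re (cinner (T (x - y)) (x - y)) =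
    2 * (Re (cinner (T x) y) + Re (cinner (T y) x))"
    by (simp add: clin_simps[OF lin] cinner_simps)
  also have "Re (cinner (T y) x) = Re (cinner (T x) y)"
    using Re_cinner_commute[of "T y" x] by (simp add: adj_pairD[OF S])
  also have "Re (cinner (T x) y) = k * (norm (T x))\<^sup>2"
    by (simp add: y_def scaleR_cinner_right norm_sq_eq_Re_cinner)
  finally have "4 * (k * (norm (T x))\<^sup>2) \<le> R * (norm (x + y))\<^sup>2 + R * (norm (x - y))\<^sup>2"
    using abs_le_D1[OF R[of "x + y"]] abs_le_D2[OF R[of "x - y"]] by (simp add: algebra_simps)
  also have "\<dots> = R * (2 * (norm x)\<^sup>2 + 2 * (norm y)\<^sup>2)"
    unfolding distrib_left[symmetric]
    using norm_add_sq[of x y] norm_add_sq[of x "- y"] by (simp add: cinner_simps)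
  finally have "k * (norm (T x))\<^sup>2 \<le> R * (norm x)\<^sup>2"
    by (simp add: ny)
  then have "norm x * norm (T x) \<le> norm x * (R * norm x)"
    using False by (simp add: k_def power2_eq_square mult_ac)
  then show ?thesis
    using \<open>x \<noteq> 0\<close> by simp
next
  case True
  show ?thesis
  proof (cases "x = 0")
    case False
    have "0 \<le> R * (norm x)\<^sup>2"
      using R[of x] abs_ge_zero order.trans by blast
    then have "R \<ge> 0"
      using False by (simp add: zero_le_mult_iff)
    then show ?thesis using True by simp
  qed (use True in simp)
qed

text \<open>Projections, shifts and diagonal operators below all have this form; passing to the
  adjoint exchanges \<open>a\<close> and \<open>b\<close> and conjugates \<open>c\<close>.\<close>

definition finop :: "('i \<Rightarrow> 'a) \<Rightarrow> ('i \<Rightarrow> 'a) \<Rightarrow> 'i set \<Rightarrow> ('i \<Rightarrow> complex) \<Rightarrow> 'a \<Rightarrow> 'a::complex_inner" where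
  "finop a b I c x = (\<Sum>p\<in>I. (c p * cinner x (b p)) *\<^sub>C a p)"

lemma adj_pair_finop: "adj_pair (finop a b I c) (finop b a I (\<lambda>p. cnj (c p)))"
  unfolding adj_pair_def finop_def cinner_sum_left cinner_sum_right
proof (intro allI sum.cong refl)
  fix x y p
  show "cinner ((c p * cinner x (b p)) *\<^sub>C a p) y = cinner x ((cnj (c p) * cinner y (a p)) *\<^sub>C b p)"
    using cinner_commute[of "a p" y] by (simp add: cinner_simps)
qed

lemma cinner_finop:
  assumes "\<And>p. p \<in> I \<Longrightarrow> cinner (a p) y = (if p = q then 1 else 0)" "finite I"
  shows "cinner (finop a b I c x) y = (if q \<in> I then c q * cinner x (b q) else 0)"
  unfolding finop_def cinner_sum_left cinner_scaleC_left
  using assms by (simp add: sum.If_cases if_distrib[of "\<lambda>z. _ * z"] cong: if_cong)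

section \<open>Finite orthonormal families\<close>

definition orthonormal_on :: "('i \<Rightarrow> 'a::complex_inner) \<Rightarrow> 'i set \<Rightarrow> bool" where
  "orthonormal_on w I \<longleftrightarrow> (\<forall>i\<in>I. \<forall>j\<in>I. cinner (w i) (w j) = (if i = j then 1 else 0))"

definition oproj :: "('i \<Rightarrow> 'a::complex_inner) \<Rightarrow> 'i set \<Rightarrow> 'a \<Rightarrow> 'a" where
  "oproj w I = finop w w I (\<lambda>_. 1)"

lemma orthonormal_onD:
  "orthonormal_on w I \<Longrightarrow> i \<in> I \<Longrightarrow> j \<in> I \<Longrightarrow> cinner (w i) (w j) = (if i = j then 1 else 0)"
  by (simp add: orthonormal_on_def)

lemma orthonormal_on_norm: "orthonormal_on w I \<Longrightarrow> i \<in> I \<Longrightarrow> norm (w i) = 1"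
  by (simp add: norm_eq_sqrt_cinner orthonormal_onD)

lemma adj_pair_oproj: "adj_pair (oproj w I) (oproj w I)"
  using adj_pair_finop[of w w I "\<lambda>_. 1"] by (simp add: oproj_def)

lemmas clin_oproj = adj_pair_clin[OF adj_pair_oproj]

lemma finop_in_span: "a ` I \<subseteq> S \<Longrightarrow> finop a b I c x \<in> cspan S"
  unfolding finop_def
  by (intro complex_vector.span_sum complex_vector.span_scale complex_vector.span_base) auto

lemma oproj_in_span: "oproj w I x \<in> cspan (w ` I)"
  unfolding oproj_def by (rule finop_in_span) auto

context
  fixes w :: "'i \<Rightarrow> 'a::complex_inner" and I
  assumes w: "orthonormal_on w I" and fin: "finite I"
begin

lemma oproj_basis: "p \<in> I \<Longrightarrow> oproj w I (w p) = w p"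
proof -
  assume p: "p \<in> I"
  have "oproj w I (w p) = (\<Sum>q\<in>I. (if q = p then w p else 0))"
    unfolding oproj_def finop_def
    by (rule sum.cong) (use p orthonormal_onD[OF w] in auto)
  then show ?thesis using p fin by simp
qed

lemma oproj_id: "x \<in> cspan (w ` I) \<Longrightarrow> oproj w I x = x"
proof (induction rule: complex_vector.span_induct_alt)
  case (step c x y)
  then show ?case
    by (auto simp: clin_simps[OF clin_oproj] oproj_basis)
qed (simp add: clin_zero[OF clin_oproj])

lemma in_span_iff_oproj: "x \<in> cspan (w ` I) \<longleftrightarrow> oproj w I x = x"
  using oproj_id oproj_in_span by metis

lemma oproj_orthogonal: "z \<in> cspan (w ` I) \<Longrightarrow> cinner (x - oproj w I x) z = 0"
  using adj_pairD[OF adj_pair_oproj, of w I x z] oproj_id[of z] by (simp add: cinner_simps)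

lemma oproj_pythagoras: "(norm x)\<^sup>2 = (norm (oproj w I x))\<^sup>2 + (norm (x - oproj w I x))\<^sup>2"
  using norm_add_sq_orthogonal[of "x - oproj w I x" "oproj w I x"]
  by (simp add: oproj_orthogonal[OF oproj_in_span])

lemma norm_oproj_le: "norm (oproj w I x) \<le> norm x"
  by (rule power2_le_imp_le) (simp_all add: oproj_pythagoras[of x])

lemma oproj_minimal:
  assumes "z \<in> cspan (w ` I)"
  shows "norm (x - oproj w I x) \<le> norm (x - z)"
proof -
  have "cinner (x - oproj w I x) (oproj w I x - z) = 0"
    by (intro oproj_orthogonal complex_vector.span_diff oproj_in_span assms)
  from norm_add_sq_orthogonal[OF this] show ?thesis
    by (auto intro: power2_le_imp_le)
qed

lemma cproj_eq_oproj: "cproj (cspan (w ` I)) x = oproj w I x"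
  unfolding cproj_def
proof (rule the_equality)
  show "oproj w I x \<in> cspan (w ` I) \<and> (\<forall>z\<in>cspan (w ` I). cinner (x - oproj w I x) z = 0)"
    by (simp add: oproj_in_span oproj_orthogonal)
next
  fix y assume y: "y \<in> cspan (w ` I) \<and> (\<forall>z\<in>cspan (w ` I). cinner (x - y) z = 0)"
  then have d: "y - oproj w I x \<in> cspan (w ` I)"
    by (intro complex_vector.span_diff oproj_in_span) auto
  have "cinner ((x - oproj w I x) - (x - y)) (y - oproj w I x) = 0"
    unfolding cinner_diff_left[of "x - oproj w I x"]
    using y d oproj_orthogonal[OF d] by simp
  then have "cinner (y - oproj w I x) (y - oproj w I x) = 0"
    by simp
  from cinner_eq_zero[OF this] show "y = oproj w I x" by simp
qed

text \<open>A Gram-Schmidt step. The two memberships together say that replacing \<open>x\<close> by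
  \<open>r\<close> does not change the span.\<close>

lemma orthonormal_extend:
  assumes "x \<notin> cspan (w ` I)"
  obtains r where "norm r = 1" "\<And>i. i \<in> I \<Longrightarrow> cinner r (w i) = 0"
    "x \<in> cspan (insert r (w ` I))" "r \<in> cspan (insert x (w ` I))"
proof
  define u where "u = x - oproj w I x"
  have u: "u \<noteq> 0"
    using assms in_span_iff_oproj[of x] by (auto simp: u_def)
  define k where "k = complex_of_real (norm u)"
  have k: "k \<noteq> 0" using u by (simp add: k_def)
  define r where "r = inverse k *\<^sub>C u"
  show "norm r = 1"
    using u by (simp add: r_def norm_scaleC k_def norm_inverse)
  show "cinner r (w i) = 0" if "i \<in> I" for i
    using that oproj_orthogonal[of "w i" x]
    by (simp add: r_def cinner_simps u_def complex_vector.span_base)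
  have "x = k *\<^sub>C r + oproj w I x"
    using k by (simp add: r_def scaleC_scaleC u_def)
  moreover have "oproj w I x \<in> cspan (insert r (w ` I))" for r
    using oproj_in_span complex_vector.span_mono[of "w ` I" "insert r (w ` I)"] by blast
  ultimately show "x \<in> cspan (insert r (w ` I))"
    by (metis complex_vector.span_add complex_vector.span_base complex_vector.span_scale insertI1)
  show "r \<in> cspan (insert x (w ` I))"
    unfolding r_def u_def
    by (intro complex_vector.span_scale complex_vector.span_diff
        \<open>\<And>r. oproj w I x \<in> cspan (insert r (w ` I))\<close>) (simp add: complex_vector.span_base)
qed

end

lemma orthonormal_on_Suc:
  assumes "orthonormal_on w {..<d}" "norm r = 1" "\<And>i. i < d \<Longrightarrow> cinner r (w i) = 0"
  shows "orthonormal_on (w(d := r)) {..<Suc d}"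
proof -
  have "cinner (w i) r = 0" if "i < d" for i
    using assms(3)[OF that] cinner_commute[of "w i" r] by simp
  moreover have "cinner r r = 1"
    using assms(2) norm_sq_eq_cinner[of r] by simp
  ultimately show ?thesis
    using assms by (auto simp: orthonormal_on_def lessThan_Suc)
qed

lemma finite_dim_orthonormal_basis:
  fixes L :: "'a::complex_inner set"
  assumes "cfinite_dim L"
  obtains w :: "nat \<Rightarrow> 'a" and d where "orthonormal_on w {..<d}" "cspan (w ` {..<d}) = L"
proof -
  from assms obtain B where B: "finite B" "cspan B = L"
    by (auto simp: cfinite_dim_def)
  from B(1) have "\<exists>(w :: nat \<Rightarrow> 'a) d. orthonormal_on w {..<d} \<and> cspan (w ` {..<d}) = cspan B"
  proof induction
    case empty
    show ?case
      by (rule exI[of _ undefined], rule exI[of _ 0]) (simp add: orthonormal_on_def)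
  next
    case (insert b B)
    then obtain w :: "nat \<Rightarrow> 'a" and d where w: "orthonormal_on w {..<d}"
      "cspan (w ` {..<d}) = cspan B" by blast
    show ?case
    proof (cases "b \<in> cspan B")
      case True
      then have "cspan (insert b B) = cspan B"
        by (rule complex_vector.span_redundant)
      then show ?thesis using w by auto
    next
      case False
      then obtain r where r: "norm r = 1" "\<And>i. i \<in> {..<d} \<Longrightarrow> cinner r (w i) = 0"
        "b \<in> cspan (insert r (w ` {..<d}))" "r \<in> cspan (insert b (w ` {..<d}))"
        using orthonormal_extend[OF w(1), of b] w(2) by auto
      have eq: "(w(d := r)) ` {..<Suc d} = insert r (w ` {..<d})"
        by (auto simp: lessThan_Suc)
      have sub: "cspan (insert x (w ` {..<d})) = cspan (insert x B)" for x
        using complex_vector.span_insert w(2) by metis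
      have "cspan (insert r B) = cspan (insert b B)"
        unfolding complex_vector.span_eq
      proof (intro conjI subsetI)
        fix x assume "x \<in> insert r B"
        then show "x \<in> cspan (insert b B)"
          using r(4) by (auto simp: sub intro: complex_vector.span_base)
      next
        fix x assume "x \<in> insert b B"
        then show "x \<in> cspan (insert r B)"
          using r(3) by (auto simp: sub intro: complex_vector.span_base)
      qed
      then have "cspan ((w(d := r)) ` {..<Suc d}) = cspan (insert b B)"
        unfolding eq sub .
      moreover have "orthonormal_on (w(d := r)) {..<Suc d}"
        using orthonormal_on_Suc[OF w(1) r(1)] r(2) by auto
      ultimately show ?thesis by blast
    qed
  qed
  then show ?thesis using that B by blast
qed

text \<open>The image of a basis of \<open>L\<close> is independent and of the same size, so no
  vector of \<open>L\<close> can lie outside its span.\<close>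

lemma finite_dim_inj_imp_surj:
  fixes f :: "'a::complex_inner \<Rightarrow> 'a"
  assumes lin: "clin f" and L: "cfinite_dim L" and sub: "csubspace L"
    and into: "\<And>x. x \<in> L \<Longrightarrow> f x \<in> L" and inj: "\<And>x. x \<in> L \<Longrightarrow> f x = 0 \<Longrightarrow> x = 0"
  shows "bij_betw f L L"
proof -
  interpret vp: vector_space_pair "scaleC :: complex \<Rightarrow> 'a \<Rightarrow> 'a" "scaleC :: complex \<Rightarrow> 'a \<Rightarrow> 'a" ..
  have linf: "Vector_Spaces.linear scaleC scaleC f"
    unfolding Vector_Spaces.linear_iff
    by (simp add: clin_add[OF lin] clin_scaleC[OF lin] complex_vector.vector_space_axioms)
  obtain B where B: "finite B" "cspan B = L" "complex_vector.independent B"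
  proof -
    from L obtain B0 where B0: "finite B0" "cspan B0 = L"
      by (auto simp: cfinite_dim_def)
    from complex_vector.maximal_independent_subset[of B0] obtain B where
      B: "B \<subseteq> B0" "complex_vector.independent B" "B0 \<subseteq> cspan B" by blast
    then have "cspan B = L"
      using B0 by (metis complex_vector.span_eq complex_vector.span_mono complex_vector.span_superset subset_antisym complex_vector.span_minimal complex_vector.subspace_span)
    then show thesis using that B B0 finite_subset by blast
  qed
  have injL: "inj_on f (cspan B)"
    unfolding B(2)
  proof (rule inj_onI)
    fix x y assume xy: "x \<in> L" "y \<in> L" "f x = f y"
    then have "f (x - y) = 0" by (simp add: clin_diff[OF lin])
    then show "x = y"
      using inj[of "x - y"] xy complex_vector.subspace_diff[OF sub] by simp
  qed
  have ind: "complex_vector.independent (f ` B)"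
    by (rule vp.linear_independent_injective_image[OF linf B(3) injL[unfolded cspan_def]])
  have card: "card (f ` B) = card B"
    by (intro card_image inj_on_subset[OF injL] complex_vector.span_superset)
  have "L \<subseteq> f ` L"
  proof (rule ccontr)
    assume "\<not> L \<subseteq> f ` L"
    then obtain y where y: "y \<in> L" "y \<notin> f ` L" by blast
    then have ny: "y \<notin> cspan (f ` B)"
      using vp.linear_span_image[OF linf, of B, folded cspan_def] B(2) by auto
    then have "complex_vector.independent (insert y (f ` B))"
      using ind by (rule complex_vector.independent_insertI)
    moreover have "insert y (f ` B) \<subseteq> cspan B"
      using y into B(2) complex_vector.span_superset[of B] by blast
    ultimately have "card (insert y (f ` B)) \<le> card B"
      using complex_vector.independent_span_bound[OF B(1)] by blast
    moreover have "y \<notin> f ` B"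
      using ny complex_vector.span_base[of y "f ` B"] by blast
    ultimately show False
      using card B(1) by simp
  qed
  then show ?thesis
    using injL into B(2) by (auto simp: bij_betw_def)
qed

text \<open>In finite dimension, failing to be bijective means having a kernel, and a projection to
  \<open>L\<close> vanishes iff all inner products with \<open>L\<close> do. This removes
  \<open>cproj\<close> from all later arguments.\<close>

lemma spectrum2_iff:
  fixes T :: "'a::complex_inner \<Rightarrow> 'a"
  assumes T: "clin T" and L: "cfinite_dim L" "csubspace L"
  shows "\<mu> \<in> spectrum2 T L \<longleftrightarrow>
    (\<exists>x\<in>L. x \<noteq> 0 \<and> (\<forall>y\<in>L. cinner (T (T x) - (2 * \<mu>) *\<^sub>C T x + \<mu>\<^sup>2 *\<^sub>C x) y = 0))"
proof -
  obtain w :: "nat \<Rightarrow> 'a" and d where w: "orthonormal_on w {..<d}" and Lw: "cspan (w ` {..<d}) = L"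
    using finite_dim_orthonormal_basis[OF L(1)] .
  note proj = cproj_eq_oproj[OF w finite_lessThan, unfolded Lw]
  define q where "q x = T (T x) - (2 * \<mu>) *\<^sub>C T x + \<mu>\<^sup>2 *\<^sub>C x" for x
  have q: "((\<lambda>y. T y - \<mu> *\<^sub>C y) ^^ 2) x = q x" for x
    unfolding q_def mult_2 scaleC_add_left
    by (simp add: numeral_2_eq_2 clin_simps[OF T] scaleC_scaleC complex_vector.scale_right_diff_distrib
        algebra_simps)
  define f where "f = (\<lambda>x. oproj w {..<d} (q x))"
  have linq: "clin q"
    unfolding clin_def q_def
    by (simp add: clin_simps[OF T] scaleC_add_right complex_vector.scale_right_diff_distrib algebra_simps scaleC_scaleC)
  have linf: "clin f"
    unfolding clin_def f_def
    by (simp add: clin_simps[OF clin_oproj] clin_add[OF linq] clin_scaleC[OF linq])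
  have fL: "f x \<in> L" for x
    using oproj_in_span[of w "{..<d}"] Lw by (auto simp: f_def)
  have f0: "f x = 0 \<longleftrightarrow> (\<forall>y\<in>L. cinner (q x) y = 0)" for x
  proof
    assume "f x = 0"
    then show "\<forall>y\<in>L. cinner (q x) y = 0"
      using oproj_orthogonal[OF w finite_lessThan, of _ "q x"] Lw by (simp add: f_def)
  next
    assume "\<forall>y\<in>L. cinner (q x) y = 0"
    then have "f x = 0"
      using Lw by (auto simp: f_def oproj_def finop_def complex_vector.span_base intro!: sum.neutral)
    then show "f x = 0" .
  qed
  have "(\<lambda>x. cproj L (((\<lambda>y. T y - \<mu> *\<^sub>C y) ^^ 2) x)) = f"
    by (rule ext) (simp only: f_def proj q)
  then have "\<mu> \<in> spectrum2 T L \<longleftrightarrow> \<not> bij_betw f L L"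
    unfolding spectrum2_def by simp
  also have "\<dots> \<longleftrightarrow> (\<exists>x\<in>L. x \<noteq> 0 \<and> f x = 0)"
  proof
    assume nb: "\<not> bij_betw f L L"
    show "\<exists>x\<in>L. x \<noteq> 0 \<and> f x = 0"
    proof (rule ccontr)
      assume "\<not> ?thesis"
      then have "x = 0" if "x \<in> L" "f x = 0" for x
        using that by auto
      from finite_dim_inj_imp_surj[OF linf L fL this] nb show False by simp
    qed
  next
    assume "\<exists>x\<in>L. x \<noteq> 0 \<and> f x = 0"
    then obtain x where x: "x \<in> L" "x \<noteq> 0" "f x = 0" by blast
    have "\<not> inj_on f L"
      using x clin_zero[OF linf] complex_vector.subspace_0[OF L(2)] by (metis inj_onD)
    then show "\<not> bij_betw f L L" by (simp add: bij_betw_def)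
  qed
  finally show ?thesis
    unfolding f0 q_def .
qed

section \<open>Perturbation of second order spectra\<close>

text \<open>Linearisation: with \<open>A\<close> and \<open>B\<close> the compressions of \<open>T\<close> and \<open>T\<^sup>2\<close> to \<open>L\<close>, the pencil
  \<open>\<mu>\<^sup>2 - 2 \<mu> A + B\<close> has the same eigenvalues as its companion matrix \<open>[[0, 1], [-B, 2 A]]\<close>.\<close>

definition companion ::
  "('a::complex_inner \<Rightarrow> 'a) \<Rightarrow> (nat \<Rightarrow> 'a) \<Rightarrow> nat \<Rightarrow> nat \<Rightarrow> nat \<Rightarrow> complex" where
  "companion T w d i j =
    (if i < d then (if j = i + d then 1 else 0)
     else if j < d then - cinner (T (T (w j))) (w (i - d))
     else 2 * cinner (T (w (j - d))) (w (i - d)))"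

lemma sum_lessThan_double:
  "(\<Sum>i<2 * d. f i) = (\<Sum>i<d. f i) + (\<Sum>i<d. f (i + d :: nat) :: 'b::comm_monoid_add)"
proof -
  have "{..<2 * d} = {..<d} \<union> {d..<2 * d}" "{..<d} \<inter> {d..<2 * d} = {}" by auto
  then have "(\<Sum>i<2 * d. f i) = (\<Sum>i<d. f i) + (\<Sum>i=d..<2 * d. f i)"
    by (simp add: sum.union_disjoint)
  also have "(\<Sum>i=d..<2 * d. f i) = (\<Sum>i<d. f (i + d))"
    using sum.shift_bounds_nat_ivl[of f 0 d d] by (simp add: mult_2 lessThan_atLeast0)
  finally show ?thesis .
qed

lemma spectrum2_companion:
  fixes T :: "'a::complex_inner \<Rightarrow> 'a"
  assumes T: "clin T" and w: "orthonormal_on w {..<d}"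
  shows "\<mu> \<in> spectrum2 T (cspan (w ` {..<d})) \<longleftrightarrow> eigen_fun (2 * d) (companion T w d) \<mu>"
proof -
  define L where "L = cspan (w ` {..<d})"
  have L: "cfinite_dim L" "csubspace L"
    by (auto simp: L_def cfinite_dim_def intro: complex_vector.subspace_span)
  define v where "v c = (\<Sum>j<d. c j *\<^sub>C w j)" for c
  have vL: "v c \<in> L" for c
    unfolding v_def L_def
    by (intro complex_vector.span_sum complex_vector.span_scale complex_vector.span_base) auto
  have Lv: "x = v (\<lambda>j. cinner x (w j))" if "x \<in> L" for x
    using in_span_iff_oproj[OF w finite_lessThan, of x] that
    by (simp add: L_def oproj_def finop_def v_def)
  have vw: "cinner (v c) (w i) = c i" if "i < d" for c i
  proof -
    have "cinner (v c) (w i) = (\<Sum>j<d. if j = i then c j else 0)"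
      unfolding v_def cinner_sum_left cinner_scaleC_left
      by (rule sum.cong) (use that orthonormal_onD[OF w] in auto)
    then show ?thesis using that by simp
  qed
  have Tv: "cinner (T (v c)) z = (\<Sum>j<d. cinner (T (w j)) z * c j)" for c z
    by (simp add: v_def clin_sum[OF T] clin_scaleC[OF T] cinner_sum_left cinner_simps mult.commute)
  have TTv: "cinner (T (T (v c))) z = (\<Sum>j<d. cinner (T (T (w j))) z * c j)" for c z
    by (simp add: v_def clin_sum[OF T] clin_scaleC[OF T] cinner_sum_left cinner_simps mult.commute)
  have orth: "(\<forall>y\<in>L. cinner x y = 0) \<longleftrightarrow> (\<forall>i<d. cinner x (w i) = 0)" for x
  proof
    assume r: "\<forall>i<d. cinner x (w i) = 0"
    show "\<forall>y\<in>L. cinner x y = 0"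
    proof
      fix y assume "y \<in> L"
      from Lv[OF this] show "cinner x y = 0"
        using r by (auto simp: v_def cinner_sum_right cinner_scaleC_right)
          (metis (no_types, lifting) cinner_scaleC_right cinner_sum_right lessThan_iff mult_zero_right sum.neutral)
    qed
  qed (auto simp: L_def complex_vector.span_base)
  define q where "q c i = (\<Sum>j<d. cinner (T (T (w j))) (w i) * c j)
     - 2 * \<mu> * (\<Sum>j<d. cinner (T (w j)) (w i) * c j) + \<mu>\<^sup>2 * c i" for c i
  have q: "cinner (T (T (v c)) - (2 * \<mu>) *\<^sub>C T (v c) + \<mu>\<^sup>2 *\<^sub>C v c) (w i) = q c i" if "i < d" for c i
    using that by (simp add: cinner_simps Tv TTv vw q_def)
  have "\<mu> \<in> spectrum2 T L \<longleftrightarrow> (\<exists>c. (\<exists>i<d. c i \<noteq> 0) \<and> (\<forall>i<d. q c i = 0))"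
    unfolding spectrum2_iff[OF T L]
  proof
    assume "\<exists>x\<in>L. x \<noteq> 0 \<and> (\<forall>y\<in>L. cinner (T (T x) - (2 * \<mu>) *\<^sub>C T x + \<mu>\<^sup>2 *\<^sub>C x) y = 0)"
    then obtain x where x: "x \<in> L" "x \<noteq> 0"
      "\<forall>y\<in>L. cinner (T (T x) - (2 * \<mu>) *\<^sub>C T x + \<mu>\<^sup>2 *\<^sub>C x) y = 0" by blast
    define c where "c = (\<lambda>j. cinner x (w j))"
    have xv: "x = v c" using Lv[OF x(1)] by (simp add: c_def)
    have "\<exists>i<d. c i \<noteq> 0"
    proof (rule ccontr)
      assume "\<not> ?thesis"
      then have "v c = 0" by (simp add: v_def)
      then show False using x(2) xv by simp
    qed
    moreover have "q c i = 0" if "i < d" for i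
      using x(3) q[OF that, of c] xv that vL by (simp add: orth)
    ultimately show "\<exists>c. (\<exists>i<d. c i \<noteq> 0) \<and> (\<forall>i<d. q c i = 0)" by blast
  next
    assume "\<exists>c. (\<exists>i<d. c i \<noteq> 0) \<and> (\<forall>i<d. q c i = 0)"
    then obtain c i where c: "i < d" "c i \<noteq> 0" "\<forall>i<d. q c i = 0" by blast
    have "v c \<noteq> 0" using vw[OF c(1), of c] c(2) by auto
    then show "\<exists>x\<in>L. x \<noteq> 0 \<and> (\<forall>y\<in>L. cinner (T (T x) - (2 * \<mu>) *\<^sub>C T x + \<mu>\<^sup>2 *\<^sub>C x) y = 0)"
      using vL[of c] c(3) q[of _ c] by (intro bexI[of _ "v c"]) (simp_all add: orth)
  qed
  also have "\<dots> \<longleftrightarrow> eigen_fun (2 * d) (companion T w d) \<mu>"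
  proof
    assume "\<exists>c. (\<exists>i<d. c i \<noteq> 0) \<and> (\<forall>i<d. q c i = 0)"
    then obtain c i where c: "i < d" "c i \<noteq> 0" "\<forall>i<d. q c i = 0" by blast
    \<comment> \<open>Eigenvectors of the companion matrix are stacked pairs of \<open>c\<close> and
      \<mu> times \<open>c\<close>.\<close>
    define x where "x i = (if i < d then c i else \<mu> * c (i - d))" for i
    have "(\<Sum>j<2 * d. companion T w d i j * x j) = \<mu> * x i" if i: "i < 2 * d" for i
    proof (cases "i < d")
      case True
      have "(\<Sum>j<2 * d. companion T w d i j * x j) = (\<Sum>j<2 * d. if j = i + d then \<mu> * c i else 0)"
        by (rule sum.cong) (use True in \<open>auto simp: companion_def x_def\<close>)
      then show ?thesis using True by (simp add: x_def)
    next
      case False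
      then have d: "i - d < d" using i by simp
      have "(\<Sum>j<2 * d. companion T w d i j * x j) =
        (\<Sum>j<d. - (cinner (T (T (w j))) (w (i - d)) * c j))
        + (\<Sum>j<d. 2 * \<mu> * (cinner (T (w j)) (w (i - d)) * c j))"
        unfolding sum_lessThan_double
        using False by (intro arg_cong2[of _ _ _ _ "(+)"] sum.cong) (auto simp: companion_def x_def)
      also have "\<dots> = \<mu>\<^sup>2 * c (i - d) - q c (i - d)"
        by (simp add: q_def sum_negf sum_distrib_left)
      finally show ?thesis
        using c(3) d False by (simp add: x_def power2_eq_square)
    qed
    moreover have "i < 2 * d" "x i \<noteq> 0" using c by (auto simp: x_def)
    ultimately show "eigen_fun (2 * d) (companion T w d) \<mu>"
      unfolding eigen_fun_def by blast
  next
    assume "eigen_fun (2 * d) (companion T w d) \<mu>"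
    then obtain x where x: "\<exists>i<2 * d. x i \<noteq> 0"
      "\<And>i. i < 2 * d \<Longrightarrow> (\<Sum>j<2 * d. companion T w d i j * x j) = \<mu> * x i"
      unfolding eigen_fun_def by blast
    have xd: "x (i + d) = \<mu> * x i" if "i < d" for i
    proof -
      have "(\<Sum>j<2 * d. companion T w d i j * x j) = (\<Sum>j<2 * d. if j = i + d then x j else 0)"
        by (rule sum.cong) (use that in \<open>auto simp: companion_def\<close>)
      then show ?thesis using x(2)[of i] that by simp
    qed
    have "\<exists>i<d. x i \<noteq> 0"
    proof (rule ccontr)
      assume 0: "\<not> (\<exists>i<d. x i \<noteq> 0)"
      obtain i where i: "i < 2 * d" "x i \<noteq> 0" using x(1) by blast
      then have "\<not> i < d" "i - d < d" using 0 by auto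
      then show False using 0 i(2) xd[of "i - d"] by simp
    qed
    moreover have "q x i = 0" if i: "i < d" for i
    proof -
      have "(\<Sum>j<2 * d. companion T w d (i + d) j * x j) =
        (\<Sum>j<d. - (cinner (T (T (w j))) (w i) * x j))
        + (\<Sum>j<d. 2 * \<mu> * (cinner (T (w j)) (w i) * x j))"
        unfolding sum_lessThan_double
        by (intro arg_cong2[of _ _ _ _ "(+)"] sum.cong) (auto simp: companion_def xd)
      also have "\<dots> = \<mu>\<^sup>2 * x i - q x i"
        by (simp add: q_def sum_negf sum_distrib_left)
      finally show ?thesis
        using x(2)[of "i + d"] xd[OF i] i by (simp add: power2_eq_square)
    qed
    ultimately show "\<exists>c. (\<exists>i<d. c i \<noteq> 0) \<and> (\<forall>i<d. q c i = 0)" by blast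
  qed
  finally show ?thesis unfolding L_def .
qed

text \<open>Closeness on \<open>L\<close> is enough although \<open>T\<close> may leave
  \<open>L\<close>: by self-adjointness the entries of the compressed square are inner products of
  \<open>T (w j)\<close> and \<open>T (w i)\<close>.\<close>

lemma spectrum2_perturbation:
  fixes T :: "'a::complex_inner \<Rightarrow> 'a"
  assumes T: "adj_pair T T" and L: "cfinite_dim L" and \<epsilon>: "\<epsilon> > 0"
  shows "\<exists>\<eta>>0. \<forall>T'. adj_pair T' T' \<longrightarrow> (\<forall>x\<in>L. norm (T' x - T x) \<le> \<eta> * norm x) \<longrightarrow>
     (\<forall>\<mu>'\<in>spectrum2 T' L. \<exists>\<mu>\<in>spectrum2 T L. norm (\<mu>' - \<mu>) < \<epsilon>) \<and>
     (\<forall>\<mu>\<in>spectrum2 T L. \<exists>\<mu>'\<in>spectrum2 T' L. norm (\<mu> - \<mu>') < \<epsilon>)"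
proof -
  obtain w :: "nat \<Rightarrow> 'a" and d where w: "orthonormal_on w {..<d}" and Lw: "cspan (w ` {..<d}) = L"
    using finite_dim_orthonormal_basis[OF L] .
  from eigen_fun_continuity[OF \<epsilon>, of "2 * d" "companion T w d"]
  obtain \<eta>0 where \<eta>0: "\<eta>0 > 0" and cont: "\<And>C'. (\<forall>i<2*d. \<forall>j<2*d. norm (C' i j - companion T w d i j) < \<eta>0) \<Longrightarrow>
     (\<forall>\<mu>'. eigen_fun (2*d) C' \<mu>' \<longrightarrow> (\<exists>\<mu>. eigen_fun (2*d) (companion T w d) \<mu> \<and> norm (\<mu>' - \<mu>) < \<epsilon>)) \<and>
     (\<forall>\<mu>. eigen_fun (2*d) (companion T w d) \<mu> \<longrightarrow> (\<exists>\<mu>'. eigen_fun (2*d) C' \<mu>' \<and> norm (\<mu> - \<mu>') < \<epsilon>))"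
    by blast
  define S where "S = (\<Sum>i<d. norm (T (w i)))"
  have S: "norm (T (w i)) \<le> S" if "i < d" for i
    unfolding S_def using that by (intro member_le_sum) auto
  have S0: "S \<ge> 0" unfolding S_def by (intro sum_nonneg) auto
  \<comment> \<open>With \<eta> \<le> 1, an entry of the compressed square moves by at most \<eta>
    (2 S + 1) and an entry of the doubled compression by 2 \<eta>; the 4 makes both strictly smaller
    than \<open>\<eta>0\<close>.\<close>
  define \<eta> where "\<eta> = min 1 (\<eta>0 / (2 * S + 4))"
  have "\<eta> \<le> \<eta>0 / (2 * S + 4)" by (simp add: \<eta>_def)
  then have "\<eta> * (2 * S + 4) \<le> \<eta>0"
    using S0 by (subst (asm) pos_le_divide_eq) auto
  then have \<eta>: "\<eta> > 0" "\<eta> \<le> 1" "\<eta> * (2 * S + 4) \<le> \<eta>0"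
    using \<eta>0 S0 by (auto simp: \<eta>_def)
  show ?thesis
  proof (intro exI[of _ \<eta>] conjI \<eta>(1) allI impI)
    fix T' :: "'a \<Rightarrow> 'a"
    assume T': "adj_pair T' T'" and close: "\<forall>x\<in>L. norm (T' x - T x) \<le> \<eta> * norm x"
    have d1: "norm (T' (w i) - T (w i)) \<le> \<eta>" if "i < d" for i
    proof -
      have "w i \<in> L" using that Lw complex_vector.span_base[of "w i" "w ` {..<d}"] by auto
      then show ?thesis using close orthonormal_on_norm[OF w, of i] that by auto
    qed
    have a: "norm (cinner (T' (w j)) (w i) - cinner (T (w j)) (w i)) \<le> \<eta>" if "i < d" "j < d" for i j
    proof -
      have "norm (cinner (T' (w j)) (w i) - cinner (T (w j)) (w i)) \<le> norm (T' (w j) - T (w j)) * norm (w i)"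
        unfolding cinner_diff_left[symmetric] by (rule cinner_Cauchy_Schwarz)
      then show ?thesis using d1[OF that(2)] orthonormal_on_norm[OF w, of i] that by simp
    qed
    have b: "norm (cinner (T' (T' (w j))) (w i) - cinner (T (T (w j))) (w i)) \<le> \<eta> * (2 * S + 1)"
      if "i < d" "j < d" for i j
    proof -
      let ?a = "T' (w j) - T (w j)" and ?b = "T' (w i) - T (w i)"
      have "cinner (T' (T' (w j))) (w i) - cinner (T (T (w j))) (w i) =
        cinner ?a (T' (w i)) + cinner (T (w j)) ?b"
        by (simp add: adj_pairD[OF T] adj_pairD[OF T'] cinner_simps)
      also have "\<dots> = cinner ?a ?b + cinner ?a (T (w i)) + cinner (T (w j)) ?b"
        by (simp add: cinner_simps)
      also have "norm \<dots> \<le> norm ?a * norm ?b + norm ?a * norm (T (w i)) + norm (T (w j)) * norm ?b"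
        by (intro order.trans[OF norm_triangle_ineq] add_mono cinner_Cauchy_Schwarz)
      also have "\<dots> \<le> \<eta> * 1 + \<eta> * S + S * \<eta>"
        using d1[OF that(1)] d1[OF that(2)] \<eta> S[OF that(1)] S[OF that(2)] S0
        by (intro add_mono mult_mono) auto
      finally show ?thesis by (simp add: algebra_simps)
    qed
    have "norm (companion T' w d i j - companion T w d i j) < \<eta>0" if "i < 2 * d" "j < 2 * d" for i j
    proof -
      have *: "\<eta> * (2 * S + 1) < \<eta>0" "2 * \<eta> < \<eta>0"
        using \<eta> mult_nonneg_nonneg[OF less_imp_le[OF \<eta>(1)] S0] by (auto simp: algebra_simps)
      consider "i < d" | "\<not> i < d" "j < d" | "\<not> i < d" "\<not> j < d" by blast
      then show ?thesis
      proof cases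
        case 1 then show ?thesis using \<eta>0 by (simp add: companion_def)
      next
        case 2
        then have "i - d < d" using that by simp
        then show ?thesis using b[of "i - d" j] 2 *
          by (simp add: companion_def norm_minus_commute)
      next
        case 3
        have "companion T' w d i j - companion T w d i j =
          2 * (cinner (T' (w (j - d))) (w (i - d)) - cinner (T (w (j - d))) (w (i - d)))"
          using 3 by (simp add: companion_def)
        then have "norm (companion T' w d i j - companion T w d i j) =
          2 * norm (cinner (T' (w (j - d))) (w (i - d)) - cinner (T (w (j - d))) (w (i - d)))"
          by (simp only: norm_mult norm_numeral)
        moreover have "i - d < d" "j - d < d" using 3 that by auto
        ultimately show ?thesis using a[of "i - d" "j - d"] * by simp
      qed
    qed
    from cont[of "companion T' w d"] this
    show "\<forall>\<mu>'\<in>spectrum2 T' L. \<exists>\<mu>\<in>spectrum2 T L. norm (\<mu>' - \<mu>) < \<epsilon>"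
      "\<forall>\<mu>\<in>spectrum2 T L. \<exists>\<mu>'\<in>spectrum2 T' L. norm (\<mu> - \<mu>') < \<epsilon>"
      unfolding Lw[symmetric] Ball_def Bex_def spectrum2_companion[OF adj_pair_clin[OF T] w]
        spectrum2_companion[OF adj_pair_clin[OF T'] w]
      by blast+
  qed
qed

section \<open>Orthonormal bases\<close>

text \<open>Gram-Schmidt on \<open>D\<close>. If \<open>D k\<close> already lies in the span, some
  vector outside replaces it, so the sequence never stops and still captures every
  \<open>D k\<close>.\<close>

lemma exists_orthonormal_sequence:
  fixes D :: "nat \<Rightarrow> 'a::complex_inner"
  assumes inf: "\<not> cfinite_dim (UNIV :: 'a set)"
  shows "\<exists>f. orthonormal_on f UNIV \<and> (\<forall>k. D k \<in> cspan (f ` {..k}))"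
proof -
  define P where "P f k r \<longleftrightarrow> norm r = 1 \<and> (\<forall>i<k. cinner r (f i) = 0) \<and>
    D k \<in> cspan (insert r (f ` {..<k}))" for f :: "nat \<Rightarrow> 'a" and k r
  have orth: "orthonormal_on f {..<k}" if "\<And>i. i < k \<Longrightarrow> P f i (f i)" for f k
    using that
  proof (induction k)
    case (Suc k)
    have "orthonormal_on (f(k := f k)) {..<Suc k}"
      using Suc.prems[of k] Suc by (intro orthonormal_on_Suc) (auto simp: P_def)
    then show ?case by simp
  qed (simp add: orthonormal_on_def)
  have "\<exists>f. \<forall>k. P f k (f k)"
  proof (rule dependent_wellorder_choice)
    fix r :: 'a and f g :: "nat \<Rightarrow> 'a" and k
    assume eq: "\<And>y. y < k \<Longrightarrow> f y = g y"
    then have "f ` {..<k} = g ` {..<k}" by (intro image_cong) auto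
    then show "P f k r = P g k r" using eq by (auto simp: P_def)
  next
    fix k and f :: "nat \<Rightarrow> 'a"
    assume "\<And>y. y < k \<Longrightarrow> P f y (f y)"
    then have o: "orthonormal_on f {..<k}" by (rule orth)
    obtain x where x: "x \<notin> cspan (f ` {..<k})" "D k \<in> cspan (insert x (f ` {..<k}))"
    proof (cases "D k \<in> cspan (f ` {..<k})")
      case True
      have "cspan (f ` {..<k}) \<noteq> UNIV"
        using inf by (auto simp: cfinite_dim_def)
      then obtain x where "x \<notin> cspan (f ` {..<k})" by blast
      then show thesis
        using that True complex_vector.span_mono[of "f ` {..<k}" "insert x (f ` {..<k})" for x] by blast
    qed (use that complex_vector.span_base[of "D k" "insert (D k) (f ` {..<k})"] in blast)
    obtain r where r: "norm r = 1" "\<And>i. i \<in> {..<k} \<Longrightarrow> cinner r (f i) = 0"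
      "x \<in> cspan (insert r (f ` {..<k}))" "r \<in> cspan (insert x (f ` {..<k}))"
      by (rule orthonormal_extend[OF o finite_lessThan x(1)]) blast
    have "cspan (insert x (f ` {..<k})) \<subseteq> cspan (insert r (f ` {..<k}))"
      by (rule complex_vector.span_minimal)
        (use r(3) in \<open>auto intro: complex_vector.span_base complex_vector.subspace_span\<close>)
    then show "\<exists>r. P f k r"
      using r x(2) unfolding P_def by (intro exI[of _ r]) auto
  qed
  then obtain f where f: "\<And>k. P f k (f k)" by blast
  have "orthonormal_on f UNIV"
    unfolding orthonormal_on_def
  proof (intro ballI)
    fix i j
    have "orthonormal_on f {..<Suc (max i j)}" by (rule orth[OF f])
    then show "cinner (f i) (f j) = (if i = j then 1 else 0)"
      by (rule orthonormal_onD) auto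
  qed
  moreover have "D k \<in> cspan (f ` {..k})" for k
  proof -
    have "insert (f k) (f ` {..<k}) = f ` {..k}"
      by (auto simp: lessThan_Suc_atMost[symmetric] lessThan_Suc)
    then show ?thesis using f[of k] by (simp add: P_def)
  qed
  ultimately show ?thesis by blast
qed

lemma orthonormal_on_subset: "orthonormal_on w I \<Longrightarrow> J \<subseteq> I \<Longrightarrow> orthonormal_on w J"
  unfolding orthonormal_on_def by blast

lemma exists_orthonormal_basis:
  assumes sep: "separable_space (euclidean :: 'a::complex_inner topology)"
    and inf: "\<not> cfinite_dim (UNIV :: 'a set)"
  shows "\<exists>f :: nat \<Rightarrow> 'a. orthonormal_on f UNIV \<and>
    (\<forall>x. \<forall>\<epsilon>>0. \<exists>m. norm (x - oproj f {..<m} x) < \<epsilon>)"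
proof -
  from sep obtain C :: "'a set" where C: "countable C" "closure C = UNIV"
    unfolding separable_space_def by auto
  then have "C \<noteq> {}" by auto
  define D where "D = from_nat_into C"
  have D: "range D = C"
    using C(1) \<open>C \<noteq> {}\<close> by (simp add: D_def range_from_nat_into)
  obtain f :: "nat \<Rightarrow> 'a" where f: "orthonormal_on f UNIV" "\<And>k. D k \<in> cspan (f ` {..k})"
    using exists_orthonormal_sequence[OF inf, of D] by blast
  have "\<exists>m. norm (x - oproj f {..<m} x) < \<epsilon>" if \<epsilon>: "\<epsilon> > 0" for x \<epsilon>
  proof -
    have "x \<in> closure C" using C by simp
    then obtain y where y: "y \<in> C" "dist y x < \<epsilon>"
      using \<epsilon> unfolding closure_approachable by blast
    then obtain k where k: "y = D k" using D by auto
    have "norm (x - oproj f {..k} x) \<le> norm (x - D k)"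
      by (rule oproj_minimal[OF orthonormal_on_subset[OF f(1)] _ f(2)]) auto
    also have "\<dots> < \<epsilon>" using y k by (simp add: dist_norm norm_minus_commute)
    finally show ?thesis
      by (auto simp: lessThan_Suc_atMost[symmetric])
  qed
  then show ?thesis using f(1) by blast
qed

section \<open>Coloured bases\<close>

text \<open>The basis vector \<open>e (j, i)\<close> belongs to the \<open>j\<close>-th interval of the spectrum; the operators
  constructed below do not mix different \<open>j\<close> (\<open>colours\<close>).\<close>

locale coloured_basis =
  fixes e :: "nat \<times> nat \<Rightarrow> 'a::complex_hilbert" and n :: nat
  assumes onb: "orthonormal_on e ({..<n} \<times> UNIV)"
    and total: "\<And>x \<epsilon>. \<epsilon> > 0 \<Longrightarrow> \<exists>m. norm (x - oproj e ({..<n} \<times> {..<m}) x) < \<epsilon>"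
begin

definition E :: "nat \<Rightarrow> 'a set" where "E m = cspan (e ` ({..<n} \<times> {..<m}))"
definition pr :: "nat \<Rightarrow> 'a \<Rightarrow> 'a" where "pr m = oproj e ({..<n} \<times> {..<m})"
text \<open>\<open>sh m\<close> carries \<open>E m\<close> isometrically to the fresh indices from
  \<open>m\<close> to \<open>2 * m - 1\<close>, and its adjoint \<open>sb m\<close> carries them
  back. So \<open>E (2 * m)\<close> is treated as two copies of \<open>E m\<close>, and operators on
  it as 2 by 2 block matrices.\<close>

definition sh :: "nat \<Rightarrow> 'a \<Rightarrow> 'a" where
  "sh m = finop (\<lambda>p. e (fst p, snd p + m)) e ({..<n} \<times> {..<m}) (\<lambda>_. 1)"
definition sb :: "nat \<Rightarrow> 'a \<Rightarrow> 'a" where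
  "sb m = finop e (\<lambda>p. e (fst p, snd p + m)) ({..<n} \<times> {..<m}) (\<lambda>_. 1)"
definition cp :: "nat \<Rightarrow> nat \<Rightarrow> 'a \<Rightarrow> 'a" where "cp j m = oproj e ({j} \<times> {..<m})"

lemma onb_fin: "orthonormal_on e ({..<n} \<times> {..<m})"
  by (rule orthonormal_on_subset[OF onb]) auto

lemma ee: "j < n \<Longrightarrow> j' < n \<Longrightarrow> cinner (e (j, i)) (e (j', i')) = (if j = j' \<and> i = i' then 1 else 0)"
  using orthonormal_onD[OF onb, of "(j, i)" "(j', i')"] by auto

lemma in_E_iff: "x \<in> E m \<longleftrightarrow> pr m x = x"
  unfolding E_def pr_def by (rule in_span_iff_oproj[OF onb_fin]) simp

lemma pr_in_E: "pr m x \<in> E m"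
  unfolding E_def pr_def by (rule oproj_in_span)

lemma pr_id: "x \<in> E m \<Longrightarrow> pr m x = x"
  by (simp add: in_E_iff)

lemma E_mono: "m \<le> m' \<Longrightarrow> E m \<subseteq> E m'"
  unfolding E_def by (intro complex_vector.span_mono image_mono) auto

lemma E_subspace: "csubspace (E m)"
  unfolding E_def by (rule complex_vector.subspace_span)

lemma E_finite_dim: "cfinite_dim (E m)"
  unfolding E_def cfinite_dim_def by (rule exI[of _ "e ` ({..<n} \<times> {..<m})"]) simp

lemmas E_add = complex_vector.subspace_add[OF E_subspace]
lemmas E_diff = complex_vector.subspace_diff[OF E_subspace]
lemmas E_scale = complex_vector.subspace_scale[OF E_subspace]
lemmas E_zero = complex_vector.subspace_0[OF E_subspace]
lemmas E_sum = complex_vector.subspace_sum[OF E_subspace]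

lemma E_scaleR: "x \<in> E m \<Longrightarrow> r *\<^sub>R x \<in> E m"
  by (simp add: scaleR_scaleC E_scale)

lemma E_minus: "x \<in> E m \<Longrightarrow> - x \<in> E m"
  using E_diff[OF E_zero] by force

lemmas E_intros = E_add E_diff E_scale E_zero E_scaleR E_minus

lemma adj_pr: "adj_pair (pr m) (pr m)"
  unfolding pr_def by (rule adj_pair_oproj)

lemma adj_sh: "adj_pair (sh m) (sb m)"
  using adj_pair_finop[of "\<lambda>p. e (fst p, snd p + m)" e "{..<n} \<times> {..<m}" "\<lambda>_. 1"]
  by (simp add: sh_def sb_def)

lemmas clin_pr = adj_pair_clin[OF adj_pr]
lemmas clin_sh = adj_pair_clin[OF adj_sh]
lemmas clin_sb = adj_pair_clin[OF adj_pair_sym[OF adj_sh]]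

lemma norm_pr_le: "norm (pr m x) \<le> norm x"
  unfolding pr_def by (rule norm_oproj_le[OF onb_fin]) simp

lemma cinner_pr: "j < n \<Longrightarrow> cinner (pr m x) (e (j, i)) = (if i < m then cinner x (e (j, i)) else 0)"
  unfolding pr_def oproj_def
  by (subst cinner_finop[of _ _ _ "(j, i)"]) (auto simp: ee split: if_splits)

lemma cinner_sb: "j < n \<Longrightarrow> cinner (sb m x) (e (j, i)) = (if i < m then cinner x (e (j, i + m)) else 0)"
  unfolding sb_def
  by (subst cinner_finop[of _ _ _ "(j, i)"]) (auto simp: ee split: if_splits)

lemma cinner_sh: "j < n \<Longrightarrow> cinner (sh m x) (e (j, i)) =
    (if m \<le> i \<and> i < 2 * m then cinner x (e (j, i - m)) else 0)"
proof (cases "m \<le> i")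
  case True
  assume "j < n"
  with True show ?thesis
    unfolding sh_def
    by (subst cinner_finop[of _ _ _ "(j, i - m)"]) (auto simp: ee split: if_splits)
next
  case False
  assume "j < n"
  with False show ?thesis
    by (auto simp: sh_def finop_def cinner_sum_left cinner_scaleC_left ee intro!: sum.neutral)
qed

lemma cinner_cp: "j < n \<Longrightarrow> j' < n \<Longrightarrow>
    cinner (cp j m x) (e (j', i)) = (if i < m \<and> j' = j then cinner x (e (j', i)) else 0)"
  unfolding cp_def oproj_def
  by (subst cinner_finop[of _ _ _ "(j', i)"]) (auto simp: ee split: if_splits)

lemma eqI:
  assumes "\<And>j i. j < n \<Longrightarrow> cinner x (e (j, i)) = cinner y (e (j, i))"
  shows "x = y"
proof (rule ccontr)
  assume "x \<noteq> y"
  then obtain m where "norm ((x - y) - pr m (x - y)) < norm (x - y)"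
    using total[of "norm (x - y)" "x - y"] by (auto simp: pr_def)
  moreover have "pr m (x - y) = 0"
    using assms by (auto simp: pr_def oproj_def finop_def cinner_diff_left intro!: sum.neutral)
  ultimately show False by simp
qed

lemma pr_pr: "pr m (pr m' x) = pr (min m m') x"
  by (rule eqI) (simp add: cinner_pr)

lemma pr_sh [simp]: "pr m (sh m x) = 0"
  by (rule eqI) (simp add: cinner_pr cinner_sh)

lemma sb_pr [simp]: "sb m (pr m x) = 0"
  by (rule eqI) (simp add: cinner_pr cinner_sb)

lemma sb_sh [simp]: "sb m (sh m x) = pr m x"
  by (rule eqI) (simp add: cinner_pr cinner_sb cinner_sh)

lemma pr_sb [simp]: "pr m (sb m x) = sb m x"
  by (rule eqI) (simp add: cinner_pr cinner_sb)

lemma sb_pr_double [simp]: "sb m (pr (2 * m) x) = sb m x"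
  by (rule eqI) (simp add: cinner_pr cinner_sb)

lemma pr_sh_double [simp]: "pr (2 * m) (sh m x) = sh m x"
  by (rule eqI) (simp add: cinner_pr cinner_sh)

lemma pr_double: "pr (2 * m) x = pr m x + sh m (sb m x)"
  by (rule eqI) (auto simp: cinner_pr cinner_sh cinner_sb cinner_add_left)

lemma sb_in_E: "sb m x \<in> E m" by (simp add: in_E_iff)
lemma sh_in_E: "sh m x \<in> E (2 * m)" by (simp add: in_E_iff)

lemma E_double: "x \<in> E (2 * m) \<Longrightarrow> x = pr m x + sh m (sb m x)"
  using pr_double[of m x] by (simp add: in_E_iff)

lemma cinner_pr_sh [simp]: "cinner (pr m x) (sh m y) = 0"
  by (simp add: adj_pairD[OF adj_pr])

lemma cinner_sh_sh [simp]: "cinner (sh m x) (sh m y) = cinner (pr m x) y"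
  by (simp add: adj_pairD[OF adj_sh] adj_pairD[OF adj_pr])

lemma norm_sh: "norm (sh m x) = norm (pr m x)"
proof -
  have "cinner (pr m x) (pr m x) = cinner (pr m x) x"
    by (metis adj_pairD[OF adj_pr] in_E_iff pr_in_E)
  then show ?thesis
    by (simp add: norm_eq_sqrt_cinner)
qed

lemma norm_E_double: "x \<in> E (2 * m) \<Longrightarrow> (norm x)\<^sup>2 = (norm (pr m x))\<^sup>2 + (norm (sb m x))\<^sup>2"
  using norm_add_sq_orthogonal[OF cinner_pr_sh, of m x "sb m x"] E_double[of x m] by (simp add: norm_sh)

definition col :: "nat \<Rightarrow> 'a \<Rightarrow> bool" where
  "col j x \<longleftrightarrow> (\<forall>j'<n. \<forall>i. j' \<noteq> j \<longrightarrow> cinner x (e (j', i)) = 0)"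

text \<open>Linear maps with this property are block diagonal on the spaces \<open>E m\<close>, so
  forms and eigenvectors can be studied one colour at a time.\<close>

definition colp :: "('a \<Rightarrow> 'a) \<Rightarrow> bool" where
  "colp T \<longleftrightarrow> (\<forall>j x. col j x \<longrightarrow> col j (T x))"

lemma colpD: "colp T \<Longrightarrow> col j x \<Longrightarrow> col j (T x)" by (simp add: colp_def)

lemma col_zero: "col j 0" by (simp add: col_def)
lemma col_add: "col j x \<Longrightarrow> col j y \<Longrightarrow> col j (x + y)" by (simp add: col_def cinner_simps)
lemma col_diff: "col j x \<Longrightarrow> col j y \<Longrightarrow> col j (x - y)" by (simp add: col_def cinner_simps)
lemma col_scale: "col j x \<Longrightarrow> col j (c *\<^sub>C x)" by (simp add: col_def cinner_simps)
lemma col_scaleR: "col j x \<Longrightarrow> col j (r *\<^sub>R x)" by (simp add: col_def scaleR_cinner_left)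
lemma col_minus: "col j x \<Longrightarrow> col j (- x)" by (simp add: col_def cinner_simps)

lemma col_pr: "col j x \<Longrightarrow> col j (pr m x)" by (simp add: col_def cinner_pr)
lemma col_sh: "col j x \<Longrightarrow> col j (sh m x)" by (simp add: col_def cinner_sh)
lemma col_sb: "col j x \<Longrightarrow> col j (sb m x)" by (simp add: col_def cinner_sb)
lemma col_cp: "j < n \<Longrightarrow> col j (cp j m x)" by (simp add: col_def cinner_cp)
lemma col_e: "j < n \<Longrightarrow> col j (e (j, i))" by (simp add: col_def ee)

lemmas col_intros = col_zero col_add col_diff col_scale col_scaleR col_minus col_pr col_sh col_sb

lemma cp_in_E: "j < n \<Longrightarrow> cp j m x \<in> E m"
  unfolding in_E_iff by (rule eqI) (simp add: cinner_pr cinner_cp)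

lemma sum_cp: "(\<Sum>j<n. cp j m x) = pr m x"
  by (rule eqI) (simp add: cinner_pr cinner_cp cinner_sum_left if_distrib cong: if_cong)

lemma cinner_E: "x \<in> E m \<Longrightarrow> cinner x y = (\<Sum>p\<in>{..<n} \<times> {..<m}. cinner x (e p) * cnj (cinner y (e p)))"
proof -
  assume "x \<in> E m"
  then have "cinner x y = cinner (pr m x) y" by (simp add: in_E_iff)
  also have "\<dots> = (\<Sum>p\<in>{..<n} \<times> {..<m}. cinner x (e p) * cnj (cinner y (e p)))"
    unfolding pr_def oproj_def finop_def cinner_sum_left
    by (rule sum.cong) (simp_all add: cinner_scaleC_left cinner_commute[symmetric])
  finally show ?thesis .
qed

lemma col_orthogonal: "x \<in> E m \<Longrightarrow> col j x \<Longrightarrow> col k y \<Longrightarrow> j \<noteq> k \<Longrightarrow> cinner x y = 0"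
  by (subst cinner_E[of x m y]) (auto simp: col_def intro!: sum.neutral)

lemma norm_sum_col:
  assumes "\<And>j. j < n \<Longrightarrow> y j \<in> E m" "\<And>j. j < n \<Longrightarrow> col j (y j)"
  shows "(norm (\<Sum>j<n. y j))\<^sup>2 = (\<Sum>j<n. (norm (y j))\<^sup>2)"
proof -
  have "cinner (y j) (\<Sum>k<n. y k) = cinner (y j) (y j)" if "j < n" for j
  proof -
    have "cinner (y j) (\<Sum>k<n. y k) = (\<Sum>k<n. if k = j then cinner (y j) (y j) else 0)"
      unfolding cinner_sum_right
      by (rule sum.cong) (use that assms in \<open>auto intro: col_orthogonal\<close>)
    then show ?thesis using that by simp
  qed
  then show ?thesis
    by (simp add: norm_sq_eq_Re_cinner cinner_sum_left)
qed

lemma e_in_E: "j < n \<Longrightarrow> i < m \<Longrightarrow> e (j, i) \<in> E m"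
  unfolding E_def by (intro complex_vector.span_base) auto

lemma norm_e: "j < n \<Longrightarrow> norm (e (j, i)) = 1"
  using ee[of j j i i] by (simp add: norm_eq_sqrt_cinner)

lemma pr_tendsto: "(\<lambda>m. pr m x) \<longlonglongrightarrow> x"
  unfolding LIMSEQ_iff
proof (intro allI impI)
  fix r :: real assume "r > 0"
  then obtain m where m: "norm (x - pr m x) < r"
    using total[of r x] by (auto simp: pr_def)
  have "norm (pr k x - x) < r" if "k \<ge> m" for k
  proof -
    have "norm (x - pr k x) \<le> norm (x - pr m x)"
      using oproj_minimal[OF onb_fin, of k "pr m x" x] E_mono[OF that] pr_in_E[of m x]
      by (auto simp: pr_def E_def)
    then show ?thesis using m by (simp add: norm_minus_commute)
  qed
  then show "\<exists>no. \<forall>k\<ge>no. norm (pr k x - x) < r" by blast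
qed

end

lemma exists_coloured_basis:
  assumes sep: "separable_space (euclidean :: 'a::complex_hilbert topology)"
    and inf: "\<not> cfinite_dim (UNIV :: 'a set)" and n: "n > 0"
  shows "\<exists>e :: nat \<times> nat \<Rightarrow> 'a. coloured_basis e n"
proof -
  obtain f :: "nat \<Rightarrow> 'a" where f: "orthonormal_on f UNIV"
    "\<And>x \<epsilon>. \<epsilon> > 0 \<Longrightarrow> \<exists>m. norm (x - oproj f {..<m} x) < \<epsilon>"
    using exists_orthonormal_basis[OF sep inf] by blast
  \<comment> \<open>The colours are the residue classes modulo \<open>n\<close>, so each receives
    infinitely many basis vectors.\<close>
  define e where "e = (\<lambda>(j, i). f (i * n + j))"
  have dm: "(i * n + j) div n = i" "(i * n + j) mod n = j" if "j < n" for i j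
    using that by auto
  have eq: "i * n + j = i' * n + j' \<longleftrightarrow> j = j' \<and> i = i'" if "j < n" "j' < n" for i j i' j'
    using dm[OF that(1), of i] dm[OF that(2), of i'] by auto
  have o: "orthonormal_on e ({..<n} \<times> UNIV)"
    using orthonormal_onD[OF f(1)] by (auto simp: orthonormal_on_def e_def eq)
  have "coloured_basis e n"
  proof (unfold_locales, rule o)
    fix x :: 'a and \<epsilon> :: real assume "\<epsilon> > 0"
    then obtain m where m: "norm (x - oproj f {..<m} x) < \<epsilon>" using f(2) by blast
    have "f ` {..<m} \<subseteq> e ` ({..<n} \<times> {..<m})"
    proof
      fix y assume "y \<in> f ` {..<m}"
      then obtain k where k: "k < m" "y = f k" by blast
      have "y = e (k mod n, k div n)" using k by (simp add: e_def)
      moreover have "k div n < m" using k(1) by (meson div_le_dividend le_less_trans)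
      ultimately show "y \<in> e ` ({..<n} \<times> {..<m})" using n by auto
    qed
    then have "oproj f {..<m} x \<in> cspan (e ` ({..<n} \<times> {..<m}))"
      using oproj_in_span complex_vector.span_mono by blast
    then have "norm (x - oproj e ({..<n} \<times> {..<m}) x) \<le> norm (x - oproj f {..<m} x)"
      by (intro oproj_minimal orthonormal_on_subset[OF o]) auto
    then show "\<exists>m. norm (x - oproj e ({..<n} \<times> {..<m}) x) < \<epsilon>" using m by (intro exI[of _ m]) simp
  qed
  then show ?thesis by blast
qed

section \<open>Limits of operators\<close>

instance complex_hilbert \<subseteq> banach ..

lemma convergent_if_summable_increments:
  fixes X :: "nat \<Rightarrow> 'a::banach"
  assumes "\<And>k. norm (X (Suc k) - X k) \<le> c k" "summable c"
  shows "convergent X"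
proof -
  have "summable (\<lambda>k. X (Suc k) - X k)"
    by (rule summable_comparison_test'[OF assms(2), of 0]) (use assms(1) in auto)
  then have "(\<lambda>k. (\<Sum>i<k. X (Suc i) - X i) + X 0) \<longlonglongrightarrow> (\<Sum>i. X (Suc i) - X i) + X 0"
    by (intro tendsto_add tendsto_const summable_LIMSEQ)
  moreover have "(\<lambda>k. (\<Sum>i<k. X (Suc i) - X i) + X 0) = X"
    by (simp add: sum_lessThan_telescope)
  ultimately show ?thesis
    by (auto simp: convergent_def)
qed

lemma adj_pair_limit:
  fixes T :: "nat \<Rightarrow> 'a::complex_inner \<Rightarrow> 'a"
  assumes "\<And>x. (\<lambda>k. T k x) \<longlonglongrightarrow> T' x" "\<And>k. adj_pair (T k) (T k)"
  shows "adj_pair T' T'"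
  unfolding adj_pair_def
proof (intro allI)
  fix x y
  have "(\<lambda>k. cinner (T k x) y) \<longlonglongrightarrow> cinner (T' x) y"
    by (intro tendsto_cinner_left assms)
  moreover have "(\<lambda>k. cinner x (T k y)) \<longlonglongrightarrow> cinner x (T' y)"
    by (intro tendsto_cinner_right assms)
  ultimately show "cinner (T' x) y = cinner x (T' y)"
    using adj_pairD[OF assms(2)] by (simp add: LIMSEQ_unique)
qed

lemma norm_bound_limit:
  assumes "X \<longlonglongrightarrow> x" "\<And>k. norm (X k) \<le> K"
  shows "norm x \<le> K"
  by (rule Lim_bounded[OF tendsto_norm[OF assms(1)]]) (use assms(2) in auto)

context coloured_basis
begin

lemma bounded_linear_pr: "bounded_linear (pr m)"
  by (rule bounded_linear_intro[where K = 1]) (simp_all add: clin_simps[OF clin_pr] norm_pr_le)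

lemma E_limit:
  assumes "X \<longlonglongrightarrow> x" "\<And>k. X k \<in> E m"
  shows "x \<in> E m"
  using LIMSEQ_unique[OF assms(1) bounded_linear.tendsto[OF bounded_linear_pr assms(1), of m, unfolded pr_id[OF assms(2)]]]
  by (simp add: in_E_iff)

lemma col_limit:
  assumes "X \<longlonglongrightarrow> x" "\<And>k. col j (X k)"
  shows "col j x"
  unfolding col_def
proof (intro allI impI)
  fix j' i assume "j' < n" "j' \<noteq> j"
  then have "(\<lambda>k. cinner (X k) (e (j', i))) = (\<lambda>k. 0)"
    using assms(2) by (auto simp: col_def)
  then show "cinner x (e (j', i)) = 0"
    using tendsto_cinner_left[OF assms(1), of "e (j', i)"] by (metis LIMSEQ_const_iff)
qed

text \<open>The fixed point equation says \<open>(1 - Y)\<^sup>2 = 1 - A\<close>.\<close>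

lemma operator_sqrt:
  assumes A: "adj_pair A A" "\<And>x. norm (A x) \<le> 1/4 * norm x" "\<And>x. A x \<in> E M" "colp A"
  shows "\<exists>Y. adj_pair Y Y \<and> (\<forall>x. norm (Y x) \<le> 1/4 * norm x) \<and> (\<forall>x. Y x \<in> E M) \<and> colp Y \<and>
    (\<forall>x. 2 *\<^sub>R Y x = A x + Y (Y x))"
proof -
  \<comment> \<open>Picard iteration for Y = (A + Y^2) / 2, started at 0. It preserves the bound 1/4
    since (1/4 + 1/16) / 2 < 1/4.\<close>
  define Y where "Y = rec_nat (\<lambda>x. 0) (\<lambda>k Yk x. (1/2) *\<^sub>R (A x + Yk (Yk x)))"
  have Y0: "Y 0 x = 0" and YS: "Y (Suc k) x = (1/2) *\<^sub>R (A x + Y k (Y k x))" for k x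
    by (simp_all add: Y_def)
  have adj: "adj_pair (Y k) (Y k)" for k
  proof (induction k)
    case 0 then show ?case by (simp add: adj_pair_def Y0)
  next
    case (Suc k)
    then show ?case
      by (simp add: adj_pair_def YS scaleR_cinner_left scaleR_cinner_right cinner_simps
          adj_pairD[OF A(1)] adj_pairD[OF Suc])
  qed
  have nrm: "norm (Y k x) \<le> 1/4 * norm x" for k x
  proof (induction k arbitrary: x)
    case (Suc k)
    have "norm (Y k (Y k x)) \<le> 1/4 * (1/4 * norm x)"
      using Suc[of "Y k x"] Suc[of x] by linarith
    then have "norm (A x + Y k (Y k x)) \<le> 1/2 * norm x"
      using A(2)[of x] norm_triangle_ineq[of "A x" "Y k (Y k x)"] norm_ge_zero[of x] by linarith
    then show ?case by (simp add: YS)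
  qed (simp add: Y0)
  have rng: "Y k x \<in> E M" for k x
    by (induction k arbitrary: x) (auto simp: Y0 YS intro!: E_intros A(3))
  have colY: "col j (Y k x)" if "col j x" for j k x
    using that
  proof (induction k arbitrary: x)
    case (Suc k)
    then show ?case by (auto simp: YS intro!: col_intros colpD[OF A(4)])
  qed (simp add: Y0 col_intros)
  have inc: "norm (Y (Suc k) x - Y k x) \<le> (1/4) ^ Suc k * norm x" for k x
  proof (induction k arbitrary: x)
    case 0
    have "norm (Y (Suc 0) x - Y 0 x) = 1/2 * norm (A x)"
      using clin_zero[OF adj_pair_clin[OF adj]] by (simp add: YS Y0)
    also have "\<dots> \<le> 1/2 * (1/4 * norm x)"
      by (intro mult_left_mono A) auto
    also have "\<dots> \<le> (1/4) ^ Suc 0 * norm x" by simp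
    finally show ?case .
  next
    case (Suc k)
    \<comment> \<open>For consecutive iterates Y and Y', the difference Y'^2 - Y^2 is split as Y'
      (Y' - Y) + (Y' - Y) Y, which avoids any appeal to commutation; the contraction factor is (1/4
      + 1/4) / 2.\<close>
    have "Y (Suc (Suc k)) x - Y (Suc k) x =
      (1/2) *\<^sub>R (A x + Y (Suc k) (Y (Suc k) x)) - (1/2) *\<^sub>R (A x + Y k (Y k x))"
      by (rule arg_cong2[of _ _ _ _ "(-)"]) (rule YS)+
    also have "\<dots> = (1/2) *\<^sub>R (Y (Suc k) (Y (Suc k) x - Y k x) + (Y (Suc k) (Y k x) - Y k (Y k x)))"
      by (simp add: clin_diff[OF adj_pair_clin[OF adj]] algebra_simps)
    also have "norm \<dots> \<le> 1/2 * (norm (Y (Suc k) (Y (Suc k) x - Y k x)) + norm (Y (Suc k) (Y k x) - Y k (Y k x)))"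
      by (simp add: norm_triangle_ineq)
    also have "\<dots> \<le> 1/2 * (1/4 * ((1/4) ^ Suc k * norm x) + (1/4) ^ Suc k * (1/4 * norm x))"
      by (intro mult_left_mono add_mono order.trans[OF nrm] order.trans[OF Suc] Suc nrm) auto
    also have "\<dots> = (1/4) ^ Suc (Suc k) * norm x" by simp
    finally show ?case .
  qed
  have "convergent (\<lambda>k. Y k x)" for x
    by (rule convergent_if_summable_increments[of "\<lambda>k. Y k x" "\<lambda>k. (1/4) ^ Suc k * norm x"])
      (use inc in \<open>auto intro!: summable_mult2 summable_mult summable_geometric\<close>)
  then obtain Z where Z: "\<And>x. (\<lambda>k. Y k x) \<longlonglongrightarrow> Z x"
    unfolding convergent_def by metis
  \<comment> \<open>Strong limits are compatible with composition here because the
    \<open>Y k\<close> are uniformly bounded.\<close>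
  have YY: "(\<lambda>k. Y k (Y k x)) \<longlonglongrightarrow> Z (Z x)" for x
  proof -
    have "(\<lambda>k. Y k (Y k x - Z x)) \<longlonglongrightarrow> 0"
    proof (rule Lim_null_comparison)
      show "eventually (\<lambda>k. norm (Y k (Y k x - Z x)) \<le> 1/4 * norm (Y k x - Z x)) sequentially"
        using nrm by simp
      show "(\<lambda>k. 1/4 * norm (Y k x - Z x)) \<longlonglongrightarrow> 0"
        using Z[of x] by (intro tendsto_mult_right_zero tendsto_norm_zero) (simp add: LIM_zero)
    qed
    from tendsto_add[OF this Z[of "Z x"]] show ?thesis
      by (simp add: clin_diff[OF adj_pair_clin[OF adj]])
  qed
  have "2 *\<^sub>R Z x = A x + Z (Z x)" for x
  proof -
    have "(\<lambda>k. 2 *\<^sub>R Y (Suc k) x) \<longlonglongrightarrow> 2 *\<^sub>R Z x"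
      by (intro tendsto_scaleR tendsto_const LIMSEQ_Suc Z)
    moreover have "(\<lambda>k. 2 *\<^sub>R Y (Suc k) x) \<longlonglongrightarrow> A x + Z (Z x)"
      unfolding YS using YY by (auto intro!: tendsto_intros)
    ultimately show ?thesis by (rule LIMSEQ_unique)
  qed
  moreover have "adj_pair Z Z" by (rule adj_pair_limit[OF Z adj])
  moreover have "norm (Z x) \<le> 1/4 * norm x" for x by (rule norm_bound_limit[OF Z nrm])
  moreover have "Z x \<in> E M" for x by (rule E_limit[OF Z rng])
  moreover have "colp Z" unfolding colp_def using col_limit[OF Z] colY by blast
  ultimately show ?thesis by blast
qed

section \<open>Nilpotent operators close to self-adjoint ones\<close>

text \<open>The adjoint of \<open>S\<close> has its range in \<open>E m\<close>, so \<open>S\<close>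
  vanishes on the orthogonal complement of \<open>E m\<close>.\<close>

lemma adj_pair_pr: "adj_pair S T \<Longrightarrow> (\<And>x. T x \<in> E m) \<Longrightarrow> S (pr m x) = S x"
proof (rule cinner_eqI)
  fix z assume S: "adj_pair S T" and T: "\<And>x. T x \<in> E m"
  show "cinner (S (pr m x)) z = cinner (S x) z"
    by (simp add: adj_pairD[OF S] adj_pairD[OF adj_pr] pr_id[OF T])
qed

lemma sb_E [simp]: "x \<in> E m \<Longrightarrow> sb m x = 0"
  using sb_pr[of m x] by (simp add: in_E_iff)

lemma norm_pr_sb_le: "(norm (pr m x))\<^sup>2 + (norm (sb m x))\<^sup>2 \<le> (norm x)\<^sup>2"
proof -
  have "(norm (pr (2 * m) x))\<^sup>2 = (norm (pr m x))\<^sup>2 + (norm (sb m x))\<^sup>2"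
    using norm_E_double[OF pr_in_E, of m x] by (simp add: pr_pr)
  then show ?thesis
    using norm_pr_le[of "2 * m" x] by (metis power_mono norm_ge_zero)
qed

text \<open>Up to the factor \<open>Q\<close>, on \<open>\<complex>\<^sup>2 \<otimes> \<dots> \<otimes> \<complex>\<^sup>2 \<otimes> E m\<close> the operator \<open>N = P + (V - U) / 2\<close> below is
  the sum over \<open>k < d\<close> of the nilpotent matrix \<open>[[1, 1], [-1, -1]] / 2\<close> acting on the \<open>k\<close>-th factor and
  of the projection to the first basis vector on the preceding factors. Its self-adjoint part has
  the eigenvalue \<open>d / 2\<close>, whereas its skew part has norm at most \<open>\<surd>d\<close>.\<close>

definition nilpotent_model ::
  "nat \<Rightarrow> ('a \<Rightarrow> 'a) \<Rightarrow> real \<Rightarrow> (nat \<Rightarrow> real) \<Rightarrow> (nat \<Rightarrow> real) \<Rightarrow> nat \<Rightarrow> nat \<Rightarrow>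
    ('a \<Rightarrow> 'a) \<Rightarrow> ('a \<Rightarrow> 'a) \<Rightarrow> ('a \<Rightarrow> 'a) \<Rightarrow> bool" where
  "nilpotent_model m Q R lo up d M P U V \<longleftrightarrow> m \<le> M \<and> adj_pair P P \<and> adj_pair U V \<and>
    (\<forall>x. P x \<in> E M \<and> U x \<in> E M \<and> V x \<in> E M) \<and> colp P \<and> colp U \<and> colp V \<and>
    (\<forall>x\<in>E m. P x = (real d / 2) *\<^sub>R Q x) \<and> (\<forall>x. pr m (U x) = 0) \<and>
    (\<forall>x. (norm (U x))\<^sup>2 \<le> real d * R\<^sup>2 * (norm x)\<^sup>2) \<and>
    (\<forall>j<n. \<forall>x\<in>E M. col j x \<longrightarrow>
      Re (cinner (P x) x) \<le> real d / 2 * up j * (norm x)\<^sup>2 + R / 2 * ((norm x)\<^sup>2 - (norm (pr m x))\<^sup>2) \<and>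
      real d / 2 * lo j * (norm x)\<^sup>2 - R / 2 * ((norm x)\<^sup>2 - (norm (pr m x))\<^sup>2) \<le> Re (cinner (P x) x)) \<and>
    (\<forall>\<nu> x. \<nu> \<noteq> 0 \<longrightarrow> x \<in> E M \<longrightarrow> P x + (1/2) *\<^sub>R (V x - U x) = \<nu> *\<^sub>C x \<longrightarrow> x = 0) \<and>
    (\<forall>\<nu> x. \<nu> \<noteq> 0 \<longrightarrow> x \<in> E M \<longrightarrow> P x - (1/2) *\<^sub>R (V x - U x) = \<nu> *\<^sub>C x \<longrightarrow> x = 0)"

text \<open>A doubling sends N = P + (V - U) / 2 to the operator taking (y, z) to (N y + Q (y + z) /
  2, N z - Q (y + z) / 2). The sum of the two components is N (y + z), which is how the absence of
  nonzero eigenvalues is inherited.\<close>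

lemma nilpotent_doubling:
  assumes Q: "adj_pair Q Q" "\<And>x. Q x \<in> E m" "colp Q" "\<And>x. norm (Q x) \<le> R * norm x"
    and lo: "\<And>j x. j < n \<Longrightarrow> col j x \<Longrightarrow> x \<in> E m \<Longrightarrow> lo j * (norm x)\<^sup>2 \<le> Re (cinner (Q x) x)"
    and up: "\<And>j x. j < n \<Longrightarrow> col j x \<Longrightarrow> x \<in> E m \<Longrightarrow> Re (cinner (Q x) x) \<le> up j * (norm x)\<^sup>2"
    and sgn: "\<And>j. j < n \<Longrightarrow> lo j \<le> 0 \<and> 0 \<le> up j"
  shows "\<exists>M P U V. nilpotent_model m Q R lo up d M P U V"
proof (induction d)
  case 0
  show ?case
    unfolding nilpotent_model_def
    by (rule exI[of _ m], rule exI[of _ "\<lambda>_. 0"], rule exI[of _ "\<lambda>_. 0"], rule exI[of _ "\<lambda>_. 0"])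
      (auto simp: adj_pair_def E_zero colp_def col_zero clin_zero[OF clin_pr] in_E_iff)
next
  case (Suc d)
  then obtain M P U V where H: "nilpotent_model m Q R lo up d M P U V" by blast
  have M: "m \<le> M" and P: "adj_pair P P" and UV: "adj_pair U V"
    and rng: "\<And>x. P x \<in> E M" "\<And>x. U x \<in> E M" "\<And>x. V x \<in> E M" and cols: "colp P" "colp U" "colp V"
    and PQ: "\<And>x. x \<in> E m \<Longrightarrow> P x = (real d / 2) *\<^sub>R Q x" and prU: "\<And>x. pr m (U x) = 0"
    and nU: "\<And>x. (norm (U x))\<^sup>2 \<le> real d * R\<^sup>2 * (norm x)\<^sup>2"
    and Pup: "\<And>j x. j < n \<Longrightarrow> x \<in> E M \<Longrightarrow> col j x \<Longrightarrow>
      Re (cinner (P x) x) \<le> real d / 2 * up j * (norm x)\<^sup>2 + R / 2 * ((norm x)\<^sup>2 - (norm (pr m x))\<^sup>2)"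
    and Plo: "\<And>j x. j < n \<Longrightarrow> x \<in> E M \<Longrightarrow> col j x \<Longrightarrow>
      real d / 2 * lo j * (norm x)\<^sup>2 - R / 2 * ((norm x)\<^sup>2 - (norm (pr m x))\<^sup>2) \<le> Re (cinner (P x) x)"
    and inj1: "\<And>\<nu> x. \<nu> \<noteq> 0 \<Longrightarrow> x \<in> E M \<Longrightarrow> P x + (1/2) *\<^sub>R (V x - U x) = \<nu> *\<^sub>C x \<Longrightarrow> x = 0"
    and inj2: "\<And>\<nu> x. \<nu> \<noteq> 0 \<Longrightarrow> x \<in> E M \<Longrightarrow> P x - (1/2) *\<^sub>R (V x - U x) = \<nu> *\<^sub>C x \<Longrightarrow> x = 0"
    using H unfolding nilpotent_model_def by simp_all
  define s t where "s = sh M" and "t = sb M"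
  note linP = adj_pair_clin[OF P] and linU = adj_pair_clin[OF UV]
    and linV = adj_pair_clin[OF adj_pair_sym[OF UV]] and linQ = adj_pair_clin[OF Q(1)]
  have lins: "clin s" and lint: "clin t" by (simp_all add: s_def t_def clin_sh clin_sb)
  note lin = clin_simps[OF linP] clin_simps[OF linU] clin_simps[OF linV] clin_simps[OF linQ]
    clin_simps[OF lins] clin_simps[OF lint]
  have st: "cinner (s x) y = cinner x (t y)" "cinner (t x) y = cinner x (s y)" for x y
    using adj_pairD[OF adj_sh] adj_pairD[OF adj_pair_sym[OF adj_sh]] by (simp_all add: s_def t_def)
  have QM: "Q x \<in> E M" for x using Q(2) E_mono[OF M] by blast
  have E2: "x \<in> E (2 * M)" if "x \<in> E M" for x using that E_mono[of M "2 * M"] by auto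
  have sE: "s x \<in> E (2 * M)" for x by (simp add: s_def sh_in_E)
  have prM: "P (pr M x) = P x" "U (pr M x) = U x" "V (pr M x) = V x" "Q (pr M x) = Q x" for x
    by (auto intro: adj_pair_pr[OF P rng(1)] adj_pair_pr[OF UV rng(3)]
        adj_pair_pr[OF adj_pair_sym[OF UV] rng(2)] adj_pair_pr[OF Q(1) QM])
  have Qm: "Q (pr m x) = Q x" for x by (rule adj_pair_pr[OF Q(1,2)])
  have tE: "t (P x) = 0" "t (U x) = 0" "t (V x) = 0" "t (Q x) = 0" for x
    by (simp_all add: t_def rng QM)
  have prE: "pr M (P x) = P x" "pr M (U x) = U x" "pr M (V x) = V x" "pr M (Q x) = Q x" for x
    by (simp_all add: pr_id rng QM)
  have prs: "pr M (s x) = 0" "t (s x) = pr M x" for x by (simp_all add: s_def t_def)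
  \<comment> \<open>In blocks, \<open>P'\<close> has the diagonal entries P + Q/2 and P - Q/2,
    \<open>U'\<close> is [[U, 0], [Q, U]] and \<open>V'\<close> is its adjoint.\<close>
  define P' where "P' x = P x + (1/2) *\<^sub>R Q x + s (P (t x) - (1/2) *\<^sub>R Q (t x))" for x
  define U' where "U' x = U x + s (U (t x) + Q x)" for x
  define V' where "V' x = V x + s (V (t x)) + Q (t x)" for x
  have adjP: "adj_pair P' P'"
    unfolding adj_pair_def P'_def
    by (simp add: cinner_simps scaleR_cinner_left scaleR_cinner_right st clin_simps[OF lins]
        adj_pairD[OF P] adj_pairD[OF Q(1)])
  have adjUV: "adj_pair U' V'"
    unfolding adj_pair_def U'_def V'_def
    by (simp add: cinner_simps st adj_pairD[OF UV] adj_pairD[OF Q(1)])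
  have rng': "P' x \<in> E (2 * M)" "U' x \<in> E (2 * M)" "V' x \<in> E (2 * M)" for x
    unfolding P'_def U'_def V'_def by (auto intro!: E_intros sE E2[OF rng(1)] E2[OF rng(2)] E2[OF rng(3)] E2[OF QM])
  have cols': "colp P'" "colp U'" "colp V'"
    unfolding colp_def P'_def U'_def V'_def s_def t_def
    by (auto intro!: col_intros colpD[OF cols(1)] colpD[OF cols(2)] colpD[OF cols(3)] colpD[OF Q(3)])
  have PQ': "P' x = (real (Suc d) / 2) *\<^sub>R Q x" if x: "x \<in> E m" for x
  proof -
    have "t x = 0" using x E_mono[OF M] by (auto simp: t_def)
    then show ?thesis
      by (simp add: P'_def PQ[OF x] lin add_divide_distrib scaleR_add_left)
  qed
  have prU': "pr m (U' x) = 0" for x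
  proof -
    have "pr m (s y) = 0" for y
      using pr_pr[of m M "s y"] M by (simp add: prs clin_zero[OF clin_pr] min_def split: if_splits)
    then show ?thesis by (simp add: U'_def clin_simps[OF clin_pr] prU)
  qed
  have nU': "(norm (U' x))\<^sup>2 \<le> real (Suc d) * R\<^sup>2 * (norm x)\<^sup>2" for x
  proof -
    have "cinner (U x) (s (U (t x) + Q x)) = 0"
      using cinner_pr_sh[of M "U x" "U (t x) + Q x"] by (simp add: prE s_def)
    then have "(norm (U' x))\<^sup>2 = (norm (U x))\<^sup>2 + (norm (s (U (t x) + Q x)))\<^sup>2"
      unfolding U'_def by (rule norm_add_sq_orthogonal)
    also have "norm (s (U (t x) + Q x)) = norm (U (t x) + Q x)"
      by (simp add: s_def norm_sh clin_simps[OF clin_pr] prE)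
    \<comment> \<open>The range of \<open>U\<close> is orthogonal to \<open>E m\<close>, which
      contains the range of \<open>Q\<close>. So squared norms add, and the skew part grows like
      sqrt d and not like d.\<close>
    also have "cinner (U (t x)) (Q x) = 0"
      using adj_pairD[OF adj_pr, of m "U (t x)" "Q x"] by (simp add: prU pr_id[OF Q(2)])
    then have "(norm (U (t x) + Q x))\<^sup>2 = (norm (U (t x)))\<^sup>2 + (norm (Q x))\<^sup>2"
      by (rule norm_add_sq_orthogonal)
    also have "(norm (U x))\<^sup>2 \<le> real d * R\<^sup>2 * (norm (pr M x))\<^sup>2"
      using nU[of "pr M x"] by (simp add: prM)
    also have "(norm (U (t x)))\<^sup>2 \<le> real d * R\<^sup>2 * (norm (t x))\<^sup>2" by (rule nU)
    also have "(norm (Q x))\<^sup>2 \<le> R\<^sup>2 * (norm x)\<^sup>2"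
      using power_mono[OF Q(4)[of x] norm_ge_zero, of 2] by (simp add: power_mult_distrib)
    finally have "(norm (U' x))\<^sup>2 \<le> real d * R\<^sup>2 * ((norm (pr M x))\<^sup>2 + (norm (t x))\<^sup>2) + R\<^sup>2 * (norm x)\<^sup>2"
      by (simp add: algebra_simps)
    also have "\<dots> \<le> real d * R\<^sup>2 * (norm x)\<^sup>2 + R\<^sup>2 * (norm x)\<^sup>2"
      using norm_pr_sb_le[of M x] by (intro add_mono mult_left_mono) (auto simp: t_def)
    finally show ?thesis by (simp add: algebra_simps)
  qed
  have form: "Re (cinner (P' x) x) = Re (cinner (P (pr M x)) (pr M x)) + Re (cinner (P (t x)) (t x))
      + 1/2 * Re (cinner (Q (pr m x)) (pr m x)) - 1/2 * Re (cinner (Q (pr m (t x))) (pr m (t x)))" for x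
  proof -
    have "cinner (P x) x = cinner (P (pr M x)) (pr M x)"
      using adj_pairD[OF adj_pr, of M "P x" x] by (simp add: prM prE)
    moreover have "cinner (Q x) x = cinner (Q (pr m x)) (pr m x)" for x
      using adj_pairD[OF adj_pr, of m "Q x" x] by (simp add: Qm pr_id[OF Q(2)])
    ultimately show ?thesis
      by (simp add: P'_def cinner_simps scaleR_cinner_left st)
  qed
  have Qabs: "\<bar>Re (cinner (Q y) y)\<bar> \<le> R * (norm y)\<^sup>2" for y
  proof -
    have "\<bar>Re (cinner (Q y) y)\<bar> \<le> norm (Q y) * norm y"
      by (rule order.trans[OF abs_Re_le_cmod cinner_Cauchy_Schwarz])
    also have "\<dots> \<le> R * norm y * norm y" by (intro mult_right_mono Q) auto
    finally show ?thesis by (simp add: power2_eq_square mult_ac)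
  qed
  \<comment> \<open>The overshoot stays at \<open>R / 2\<close> for every \<open>d\<close>: on the
    second copy, -Q/2 costs at most \<open>R / 2\<close> times the squared norm of
    \<open>pr m z\<close>, which is precisely what the bound for \<open>z\<close> leaves
    out.\<close>
  have bounds: "Re (cinner (P' x) x) \<le> real (Suc d) / 2 * up j * (norm x)\<^sup>2 + R / 2 * ((norm x)\<^sup>2 - (norm (pr m x))\<^sup>2) \<and>
      real (Suc d) / 2 * lo j * (norm x)\<^sup>2 - R / 2 * ((norm x)\<^sup>2 - (norm (pr m x))\<^sup>2) \<le> Re (cinner (P' x) x)"
    if j: "j < n" and x: "x \<in> E (2 * M)" and c: "col j x" for j x
  proof -
    define y z where "y = pr M x" and "z = t x"
    have yz: "y \<in> E M" "z \<in> E M" "col j y" "col j z"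
      using c by (auto simp: y_def z_def t_def pr_in_E sb_in_E col_pr col_sb)
    have nx: "(norm x)\<^sup>2 = (norm y)\<^sup>2 + (norm z)\<^sup>2"
      using norm_E_double[OF x] by (simp add: y_def z_def t_def)
    have prmy: "pr m y = pr m x"
      using M by (simp add: y_def pr_pr min_def)
    have q: "Re (cinner (Q (pr m x)) (pr m x)) \<le> up j * (norm (pr m x))\<^sup>2"
      "lo j * (norm (pr m x))\<^sup>2 \<le> Re (cinner (Q (pr m x)) (pr m x))"
      using j c by (auto intro!: up lo col_pr pr_in_E)
    have le: "(norm (pr m x))\<^sup>2 \<le> (norm x)\<^sup>2"
      by (intro power_mono norm_pr_le) auto
    have "up j * (norm (pr m x))\<^sup>2 \<le> up j * (norm x)\<^sup>2" "lo j * (norm x)\<^sup>2 \<le> lo j * (norm (pr m x))\<^sup>2"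
      using sgn[OF j] le by (auto intro: mult_left_mono mult_left_mono_neg)
    with q have q': "Re (cinner (Q (pr m x)) (pr m x)) \<le> up j * (norm x)\<^sup>2"
      "lo j * (norm x)\<^sup>2 \<le> Re (cinner (Q (pr m x)) (pr m x))" by linarith+
    show ?thesis
      unfolding form y_def[symmetric] z_def[symmetric]
      using Pup[OF j yz(1,3)] Pup[OF j yz(2,4)] Plo[OF j yz(1,3)] Plo[OF j yz(2,4)] q' Qabs[of "pr m z"]
      unfolding prmy nx by (simp add: algebra_simps add_divide_distrib abs_le_iff)
  qed
  have inj1': "x = 0" if \<nu>: "\<nu> \<noteq> 0" and x: "x \<in> E (2 * M)" and eq: "P' x + (1/2) *\<^sub>R (V' x - U' x) = \<nu> *\<^sub>C x" for \<nu> x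
  proof -
    define y z where "y = pr M x" and "z = t x"
    have yz: "y \<in> E M" "z \<in> E M" by (auto simp: y_def z_def t_def pr_in_E sb_in_E)
    have "pr M (P' x + (1/2) *\<^sub>R (V' x - U' x)) = \<nu> *\<^sub>C y"
      unfolding eq by (simp add: clin_simps[OF clin_pr] y_def)
    then have 1: "P y + (1/2) *\<^sub>R (V y - U y) + (1/2) *\<^sub>R Q (y + z) = \<nu> *\<^sub>C y"
      by (simp add: P'_def U'_def V'_def clin_simps[OF clin_pr] prE prs prM y_def z_def lin algebra_simps)
    have "t (P' x + (1/2) *\<^sub>R (V' x - U' x)) = \<nu> *\<^sub>C z"
      unfolding eq by (simp add: lin z_def)
    then have 2: "P z + (1/2) *\<^sub>R (V z - U z) - (1/2) *\<^sub>R Q (y + z) = \<nu> *\<^sub>C z"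
      by (simp add: P'_def U'_def V'_def clin_simps[OF clin_pr] prE prs prM tE y_def z_def lin algebra_simps)
    \<comment> \<open>Adding the components cancels \<open>Q\<close>. Once \<open>y + z\<close> is
      known to vanish, \<open>Q\<close> drops out of both equations, and each component satisfies
      the eigenvalue equation of the smaller model.\<close>
    have "P (y + z) + (1/2) *\<^sub>R (V (y + z) - U (y + z)) = \<nu> *\<^sub>C (y + z)"
      unfolding scaleC_add_right 1[symmetric] 2[symmetric] by (simp add: lin algebra_simps)
    from inj1[OF \<nu> E_add[OF yz] this] have yz0: "y + z = 0" .
    then have "Q (y + z) = 0" by (simp add: clin_zero[OF linQ])
    with 1 2 have "y = 0" "z = 0"
      using inj1[OF \<nu> yz(1)] inj1[OF \<nu> yz(2)] by simp_all
    then show ?thesis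
      using E_double[OF x] by (simp add: y_def z_def t_def clin_zero[OF clin_sh])
  qed
  have inj2': "x = 0" if \<nu>: "\<nu> \<noteq> 0" and x: "x \<in> E (2 * M)" and eq: "P' x - (1/2) *\<^sub>R (V' x - U' x) = \<nu> *\<^sub>C x" for \<nu> x
  proof -
    define y z where "y = pr M x" and "z = t x"
    have yz: "y \<in> E M" "z \<in> E M" by (auto simp: y_def z_def t_def pr_in_E sb_in_E)
    have "pr M (P' x - (1/2) *\<^sub>R (V' x - U' x)) = \<nu> *\<^sub>C y"
      unfolding eq by (simp add: clin_simps[OF clin_pr] y_def)
    then have 1: "P y - (1/2) *\<^sub>R (V y - U y) + (1/2) *\<^sub>R Q (y - z) = \<nu> *\<^sub>C y"
      by (simp add: P'_def U'_def V'_def clin_simps[OF clin_pr] prE prs prM y_def z_def lin algebra_simps)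
    have "t (P' x - (1/2) *\<^sub>R (V' x - U' x)) = \<nu> *\<^sub>C z"
      unfolding eq by (simp add: lin z_def)
    then have 2: "P z - (1/2) *\<^sub>R (V z - U z) + (1/2) *\<^sub>R Q (y - z) = \<nu> *\<^sub>C z"
      by (simp add: P'_def U'_def V'_def clin_simps[OF clin_pr] prE prs prM tE y_def z_def lin algebra_simps)
    \<comment> \<open>The adjoint couples the copies through \<open>y - z\<close>, so here the
      components are subtracted.\<close>
    have "P (y - z) - (1/2) *\<^sub>R (V (y - z) - U (y - z)) = \<nu> *\<^sub>C (y - z)"
      unfolding complex_vector.scale_right_diff_distrib 1[symmetric] 2[symmetric] by (simp add: lin algebra_simps)
    from inj2[OF \<nu> E_diff[OF yz] this] have yz0: "y - z = 0" .
    then have "Q (y - z) = 0" by (simp add: clin_zero[OF linQ])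
    with 1 2 have "y = 0" "z = 0"
      using inj2[OF \<nu> yz(1)] inj2[OF \<nu> yz(2)] by simp_all
    then show ?thesis
      using E_double[OF x] by (simp add: y_def z_def t_def clin_zero[OF clin_sh])
  qed
  show ?case
    unfolding nilpotent_model_def
    using M adjP adjUV rng' cols' PQ' prU' nU' bounds inj1' inj2'
    by (intro exI[of _ "2 * M"] exI[of _ P'] exI[of _ U'] exI[of _ V']) auto
qed

end

context coloured_basis
begin

section \<open>Operators acting on colours\<close>

definition Phi :: "(nat \<Rightarrow> real) \<Rightarrow> nat \<Rightarrow> 'a \<Rightarrow> 'a" where
  "Phi f m = finop e e ({..<n} \<times> {..<m}) (\<lambda>p. complex_of_real (f (fst p)))"

lemma adj_Phi: "adj_pair (Phi f m) (Phi f m)"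
  using adj_pair_finop[of e e "{..<n} \<times> {..<m}" "\<lambda>p. complex_of_real (f (fst p))"]
  by (simp add: Phi_def)

lemma cinner_Phi: "j < n \<Longrightarrow> cinner (Phi f m x) (e (j, i)) = (if i < m then f j * cinner x (e (j, i)) else 0)"
  unfolding Phi_def by (subst cinner_finop[of _ _ _ "(j, i)"]) (auto simp: ee split: if_splits)

lemma Phi_in_E: "Phi f m x \<in> E m"
  unfolding in_E_iff by (rule eqI) (simp add: cinner_pr cinner_Phi)

lemma colp_Phi: "colp (Phi f m)"
  by (simp add: colp_def col_def cinner_Phi)

lemma cinner_E_eq_0:
  assumes "x \<in> E m" "j < n" "\<not> i < m"
  shows "cinner x (e (j, i)) = 0"
  using cinner_pr[OF assms(2), of m x i] assms(3) unfolding pr_id[OF assms(1)] by (simp only: if_False)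

lemma Phi_col:
  assumes "col j x" "x \<in> E m"
  shows "Phi f m x = f j *\<^sub>R x"
proof (rule eqI)
  fix j' i assume j': "j' < n"
  then show "cinner (Phi f m x) (e (j', i)) = cinner (f j *\<^sub>R x) (e (j', i))"
    using assms(1) cinner_E_eq_0[OF assms(2) j', of i]
    by (cases "j' = j") (auto simp: cinner_Phi scaleR_cinner_left col_def)
qed

lemma Phi_mono: "x \<in> E m \<Longrightarrow> m \<le> M \<Longrightarrow> Phi f M x = Phi f m x"
proof (rule eqI)
  fix j i assume a: "x \<in> E m" "m \<le> M" "j < n"
  then show "cinner (Phi f M x) (e (j, i)) = cinner (Phi f m x) (e (j, i))"
    using cinner_E_eq_0[OF a(1,3), of i] by (auto simp: cinner_Phi)
qed

text \<open>Testing against a basis vector moves the question to its image under \<open>V\<close>,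
  which has a single colour and is thus merely scaled by \<open>Phi\<close>.\<close>

lemma Phi_commute:
  assumes UV: "adj_pair U V" and V: "\<And>x. V x \<in> E m" "colp V" and U: "\<And>x. U x \<in> E m"
  shows "U (Phi f m x) = Phi f m (U x)"
proof (rule eqI)
  fix j i assume j: "j < n"
  show "cinner (U (Phi f m x)) (e (j, i)) = cinner (Phi f m (U x)) (e (j, i))"
  proof (cases "i < m")
    case True
    have "Phi f m (V (e (j, i))) = f j *\<^sub>R V (e (j, i))"
      by (rule Phi_col[OF colpD[OF V(2) col_e[OF j]] V(1)])
    then have "cinner (U (Phi f m x)) (e (j, i)) = f j * cinner x (V (e (j, i)))"
      by (simp only: adj_pairD[OF UV] adj_pairD[OF adj_Phi] scaleR_cinner_right)
    then show ?thesis
      using True j by (simp only: cinner_Phi adj_pairD[OF UV] if_True)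
  next
    case False
    have "cinner (U (Phi f m x)) (e (j, i)) = 0"
      by (rule cinner_E_eq_0[OF U j False])
    then show ?thesis using False j by (simp add: cinner_Phi)
  qed
qed

text \<open>Cross terms between colours vanish, so bounds for each colour add up to a bound of the
  whole form, and self-adjointness turns it into a norm bound.\<close>

lemma norm_le_by_colours:
  assumes T: "adj_pair T T" "\<And>x. T x \<in> E m" "colp T"
    and R: "\<And>j x. j < n \<Longrightarrow> col j x \<Longrightarrow> x \<in> E m \<Longrightarrow> \<bar>Re (cinner (T x) x)\<bar> \<le> R * (norm x)\<^sup>2" and "0 \<le> R"
  shows "norm (T x) \<le> R * norm x"
proof (rule sadj_norm_le[OF T(1)])
  fix x
  define y where "y j = cp j m x" for j
  have y: "y j \<in> E m" "col j (y j)" if "j < n" for j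
    using that by (auto simp: y_def cp_in_E col_cp)
  have px: "pr m x = (\<Sum>j<n. y j)" by (simp add: y_def sum_cp)
  have "cinner (T x) x = cinner (T (pr m x)) (pr m x)"
    using adj_pairD[OF adj_pr, of m "T x" x] by (simp add: adj_pair_pr[OF T(1,2)] pr_id[OF T(2)])
  also have "\<dots> = (\<Sum>j<n. cinner (T (y j)) (pr m x))"
    unfolding px by (simp add: clin_sum[OF adj_pair_clin[OF T(1)]] cinner_sum_left)
  also have "\<dots> = (\<Sum>j<n. cinner (T (y j)) (y j))"
  proof (rule sum.cong)
    fix j assume j: "j \<in> {..<n}"
    have "cinner (T (y j)) (pr m x) = (\<Sum>k<n. if k = j then cinner (T (y j)) (y j) else 0)"
      unfolding px cinner_sum_right
      by (rule sum.cong) (use j y in \<open>auto intro!: col_orthogonal[of _ m j] T(2) colpD[OF T(3)]\<close>)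
    then show "cinner (T (y j)) (pr m x) = cinner (T (y j)) (y j)" using j by simp
  qed simp
  finally have "\<bar>Re (cinner (T x) x)\<bar> \<le> (\<Sum>j<n. \<bar>Re (cinner (T (y j)) (y j))\<bar>)"
    by (simp add: sum_abs)
  also have "\<dots> \<le> (\<Sum>j<n. R * (norm (y j))\<^sup>2)"
    by (intro sum_mono R) (use y in auto)
  also have "\<dots> = R * (norm (pr m x))\<^sup>2"
    using norm_sum_col[of y m] y by (simp add: px sum_distrib_left)
  also have "\<dots> \<le> R * (norm x)\<^sup>2"
    using \<open>0 \<le> R\<close> norm_pr_le[of m x] by (intro mult_left_mono power_mono) auto
  finally show "\<bar>Re (cinner (T x) x)\<bar> \<le> R * (norm x)\<^sup>2" .
qed

text \<open>The colour components of an eigenvector are eigenvectors or zero. This reduces to a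
  single colour, on which \<open>Phi f m\<close> is the scalar \<open>f j\<close>.\<close>

lemma coloured_eigenvector:
  assumes S: "clin S" "\<And>x. S x \<in> E m" "colp S" and w: "w \<in> E m" "w \<noteq> 0" "S w = \<nu> *\<^sub>C w"
  obtains j v where "j < n" "v \<in> E m" "col j v" "v \<noteq> 0" "S v = \<nu> *\<^sub>C v"
proof -
  define y where "y j = cp j m w" for j
  have y: "y j \<in> E m" "col j (y j)" if "j < n" for j
    using that by (auto simp: y_def cp_in_E col_cp)
  have wy: "w = (\<Sum>j<n. y j)" using pr_id[OF w(1)] by (simp add: y_def sum_cp)
  have "(norm (\<Sum>j<n. S (y j) - \<nu> *\<^sub>C y j))\<^sup>2 = (\<Sum>j<n. (norm (S (y j) - \<nu> *\<^sub>C y j))\<^sup>2)"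
    by (rule norm_sum_col[of _ m]) (auto intro!: E_intros S(2) y col_intros colpD[OF S(3)])
  moreover have "(\<Sum>j<n. S (y j) - \<nu> *\<^sub>C y j) = 0"
    using w(3) unfolding wy
    by (simp add: clin_sum[OF S(1)] sum_subtractf complex_vector.scale_sum_right)
  ultimately have "(\<Sum>j<n. (norm (S (y j) - \<nu> *\<^sub>C y j))\<^sup>2) = 0"
    by simp
  then have 0: "S (y j) = \<nu> *\<^sub>C y j" if "j < n" for j
    using that by (simp add: sum_nonneg_eq_0_iff)
  have "\<exists>j<n. y j \<noteq> 0"
    using w(2) unfolding wy by (metis lessThan_iff sum.neutral)
  then show thesis using that y 0 by blast
qed

section \<open>The absorption step\<close>

definition coloured_model :: "(nat \<Rightarrow> real) \<Rightarrow> (nat \<Rightarrow> real) \<Rightarrow> nat \<Rightarrow> ('a \<Rightarrow> 'a) \<Rightarrow> bool" where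
  "coloured_model lo up m T \<longleftrightarrow> adj_pair T T \<and> (\<forall>x. T x \<in> E m) \<and> colp T \<and>
    (\<forall>j<n. \<forall>x\<in>E m. col j x \<longrightarrow>
       lo j * (norm x)\<^sup>2 \<le> Re (cinner (T x) x) \<and> Re (cinner (T x) x) \<le> up j * (norm x)\<^sup>2)"

lemma coloured_modelD:
  assumes "coloured_model lo up m T"
  shows "adj_pair T T" "\<And>x. T x \<in> E m" "colp T"
    "\<And>j x. j < n \<Longrightarrow> col j x \<Longrightarrow> x \<in> E m \<Longrightarrow> lo j * (norm x)\<^sup>2 \<le> Re (cinner (T x) x)"
    "\<And>j x. j < n \<Longrightarrow> col j x \<Longrightarrow> x \<in> E m \<Longrightarrow> Re (cinner (T x) x) \<le> up j * (norm x)\<^sup>2"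
  using assms by (auto simp: coloured_model_def)

text \<open>The compression of \<open>T'\<close> to \<open>E M\<close> is \<open>A\<close>, and that of \<open>T'\<^sup>2\<close> is \<open>Ms Mo\<close> with \<open>Mo\<close> upper triangular up to
  a change of basis, \<open>Ms\<close> its adjoint and \<open>A = (Mo + Ms) / 2\<close>. Hence the quadratic pencil of \<open>T'\<close> factors as
  \<open>(Ms - \<mu>) (Mo - \<mu>)\<close>. Since \<open>Mo\<close> is nearly self-adjoint, adding \<open>i\<gamma>\<close> to it makes
  \<open>Ms Mo - A\<^sup>2\<close> positive, which is what the existence of \<open>T'\<close> amounts to.\<close>

lemma absorption:
  assumes T: "coloured_model lo up m T"
    and f: "\<And>j. j < n \<Longrightarrow> lo j < f j \<and> f j < up j" and \<xi>: "\<xi> > 0"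
  shows "\<exists>M T'. m \<le> M \<and> coloured_model (\<lambda>j. lo j - \<xi>) (\<lambda>j. up j + \<xi>) (2 * M) T' \<and>
    (\<forall>x\<in>E m. norm (T' x - T x) \<le> \<xi> * norm x) \<and>
    (\<forall>\<mu>\<in>spectrum2 T' (E M). \<exists>j<n. norm (\<mu> - of_real (f j)) \<le> \<xi>)"
proof -
  note T' = coloured_modelD[OF T]
  define R where "R = (\<Sum>j<n. up j - lo j)"
  have R: "up j - lo j \<le> R" if "j < n" for j
    unfolding R_def using that f by (intro member_le_sum[of j "{..<n}" "\<lambda>j. up j - lo j"]) fastforce+
  have R0: "R \<ge> 0" unfolding R_def using f by (intro sum_nonneg) fastforce
  \<comment> \<open>The deviation of \<open>T\<close> from the target points \<open>f j\<close>; its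
    form bounds on each colour straddle 0, as the doubling requires.\<close>
  define Q where "Q x = T x - Phi f m x" for x
  have Q: "adj_pair Q Q" "\<And>x. Q x \<in> E m" "colp Q"
    using adj_pairD[OF T'(1)] adj_pairD[OF adj_Phi]
    by (auto simp: adj_pair_def Q_def cinner_simps colp_def
        intro!: E_intros T'(2) Phi_in_E col_intros colpD[OF T'(3)] colpD[OF colp_Phi])
  have Qform: "Re (cinner (Q x) x) = Re (cinner (T x) x) - f j * (norm x)\<^sup>2" if "col j x" "x \<in> E m" for j x
    by (simp add: Q_def cinner_simps Phi_col[OF that] scaleR_cinner_left norm_sq_eq_Re_cinner)
  have Qlo: "(lo j - f j) * (norm x)\<^sup>2 \<le> Re (cinner (Q x) x)"
    and Qup: "Re (cinner (Q x) x) \<le> (up j - f j) * (norm x)\<^sup>2" if "j < n" "col j x" "x \<in> E m" for j x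
    using T'(4)[OF that] T'(5)[OF that] by (simp_all add: Qform[OF that(2,3)] algebra_simps)
  have nQ: "norm (Q x) \<le> R * norm x" for x
  proof (rule norm_le_by_colours[OF Q _ R0])
    fix j x assume jx: "j < n" "col j x" "x \<in> E m"
    have "(up j - f j) * (norm x)\<^sup>2 \<le> R * (norm x)\<^sup>2" "- R * (norm x)\<^sup>2 \<le> (lo j - f j) * (norm x)\<^sup>2"
      using f[OF jx(1)] R[OF jx(1)] by (intro mult_right_mono; simp)+
    then show "\<bar>Re (cinner (Q x) x)\<bar> \<le> R * (norm x)\<^sup>2"
      using Qlo[OF jx] Qup[OF jx] by (simp add: abs_le_iff)
  qed
  \<comment> \<open>The budget: an off-diagonal coupling of norm at most 2 \<gamma> = \<xi> / 2 and
    an overshoot of at most \<xi> / 2 from \<open>R / real d\<close> widen the form bounds by at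
    most \<xi>.\<close>
  define \<gamma> where "\<gamma> = \<xi> / 4"
  have \<gamma>: "\<gamma> > 0" using \<xi> by (simp add: \<gamma>_def)
  \<comment> \<open>Here 2 R / sqrt d will bound the skew part \<open>S\<close>, and 2 R the
    operator \<open>P'\<close>. The last inequality makes all terms of \<open>K\<close> that contain
    \<open>S\<close> at most a quarter of \<gamma>^2 in norm.\<close>
  have "\<exists>d::nat. d > 0 \<and> R / real d \<le> \<xi> / 2 \<and>
    4 * R * (2 * R / sqrt d) + 2 * \<gamma> * (2 * R / sqrt d) + (2 * R / sqrt d)\<^sup>2 \<le> \<gamma>\<^sup>2 / 4"
  proof -
    have s: "(\<lambda>d. 2 * R / sqrt (real d)) \<longlonglongrightarrow> 0"
      by (rule real_tendsto_divide_at_top[OF tendsto_const])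
        (rule filterlim_compose[OF sqrt_at_top filterlim_real_sequentially])
    have "(\<lambda>d. R / real d) \<longlonglongrightarrow> 0"
      by (rule real_tendsto_divide_at_top[OF tendsto_const filterlim_real_sequentially])
    then have "eventually (\<lambda>d. R / real d < \<xi> / 2) sequentially"
      using \<xi> by (intro order_tendstoD(2)) auto
    moreover have "(\<lambda>d. 4 * R * (2 * R / sqrt (real d)) + 2 * \<gamma> * (2 * R / sqrt (real d)) + (2 * R / sqrt (real d))\<^sup>2)
      \<longlonglongrightarrow> 4 * R * 0 + 2 * \<gamma> * 0 + 0\<^sup>2"
      by (intro tendsto_intros s)
    then have "eventually (\<lambda>d. 4 * R * (2 * R / sqrt (real d)) + 2 * \<gamma> * (2 * R / sqrt (real d)) + (2 * R / sqrt (real d))\<^sup>2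
      < \<gamma>\<^sup>2 / 4) sequentially"
      using \<gamma> by (intro order_tendstoD(2)) auto
    ultimately have "eventually (\<lambda>d. d > 0 \<and> R / real d \<le> \<xi> / 2 \<and>
      4 * R * (2 * R / sqrt d) + 2 * \<gamma> * (2 * R / sqrt d) + (2 * R / sqrt d)\<^sup>2 \<le> \<gamma>\<^sup>2 / 4) sequentially"
      using eventually_gt_at_top[of "0::nat"] by eventually_elim auto
    then show ?thesis by (rule eventually_happens'[OF sequentially_bot])
  qed
  then obtain d :: nat where d: "d > 0" "R / real d \<le> \<xi> / 2"
    "4 * R * (2 * R / sqrt d) + 2 * \<gamma> * (2 * R / sqrt d) + (2 * R / sqrt d)\<^sup>2 \<le> \<gamma>\<^sup>2 / 4" by blast
  define \<eta> where "\<eta> = 2 * R / sqrt d"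
  have \<eta>: "4 * R * \<eta> + 2 * \<gamma> * \<eta> + \<eta>\<^sup>2 \<le> \<gamma>\<^sup>2 / 4" "\<eta> \<ge> 0"
    using d(3) R0 by (auto simp: \<eta>_def)
  have sgn: "lo j - f j \<le> 0 \<and> 0 \<le> up j - f j" if "j < n" for j using f[OF that] by auto
  obtain M P U V where H: "nilpotent_model m Q R (\<lambda>j. lo j - f j) (\<lambda>j. up j - f j) d M P U V"
    using nilpotent_doubling[where lo = "\<lambda>j. lo j - f j" and up = "\<lambda>j. up j - f j" and d = d,
        OF Q nQ Qlo Qup sgn] by blast
  have M: "m \<le> M" and P: "adj_pair P P" and UV: "adj_pair U V"
    and rng: "\<And>x. P x \<in> E M" "\<And>x. U x \<in> E M" "\<And>x. V x \<in> E M" and cols: "colp P" "colp U" "colp V"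
    and PQ: "\<And>x. x \<in> E m \<Longrightarrow> P x = (real d / 2) *\<^sub>R Q x"
    and nU: "\<And>x. (norm (U x))\<^sup>2 \<le> real d * R\<^sup>2 * (norm x)\<^sup>2"
    and Pup: "\<And>j x. j < n \<Longrightarrow> x \<in> E M \<Longrightarrow> col j x \<Longrightarrow>
      Re (cinner (P x) x) \<le> real d / 2 * (up j - f j) * (norm x)\<^sup>2 + R / 2 * ((norm x)\<^sup>2 - (norm (pr m x))\<^sup>2)"
    and Plo: "\<And>j x. j < n \<Longrightarrow> x \<in> E M \<Longrightarrow> col j x \<Longrightarrow>
      real d / 2 * (lo j - f j) * (norm x)\<^sup>2 - R / 2 * ((norm x)\<^sup>2 - (norm (pr m x))\<^sup>2) \<le> Re (cinner (P x) x)"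
    and inj1: "\<And>\<nu> x. \<nu> \<noteq> 0 \<Longrightarrow> x \<in> E M \<Longrightarrow> P x + (1/2) *\<^sub>R (V x - U x) = \<nu> *\<^sub>C x \<Longrightarrow> x = 0"
    and inj2: "\<And>\<nu> x. \<nu> \<noteq> 0 \<Longrightarrow> x \<in> E M \<Longrightarrow> P x - (1/2) *\<^sub>R (V x - U x) = \<nu> *\<^sub>C x \<Longrightarrow> x = 0"
    using H unfolding nilpotent_model_def by simp_all
  \<comment> \<open>This scale turns \<open>P\<close> into \<open>Q\<close> on \<open>E m\<close>,
    so that \<open>A\<close> agrees with \<open>T\<close> there.\<close>
  define \<theta> where "\<theta> = 2 / real d"
  have \<theta>: "\<theta> > 0" "\<theta> * (real d / 2) = 1" "\<theta> * (R / 2) = R / real d" using d by (auto simp: \<theta>_def)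
  define Ph where "Ph = Phi f M"
  define P' where "P' x = \<theta> *\<^sub>R P x" for x
  define A where "A x = Ph x + P' x" for x
  define S where "S x = (\<theta> / 2) *\<^sub>R (V x - U x)" for x
  have P'adj: "adj_pair P' P'"
    using adj_pairD[OF P] by (auto simp: adj_pair_def P'_def scaleR_cinner_left scaleR_cinner_right)
  have P'E: "P' x \<in> E M" for x by (simp add: P'_def E_scaleR rng)
  have P'col: "colp P'" unfolding colp_def P'_def by (auto intro!: col_intros colpD[OF cols(1)])
  have P'form: "Re (cinner (P' x) x) \<le> (up j - f j + R / real d) * (norm x)\<^sup>2"
    "(lo j - f j - R / real d) * (norm x)\<^sup>2 \<le> Re (cinner (P' x) x)" if jx: "j < n" "x \<in> E M" "col j x" for j x
  proof -
    have "R / 2 * ((norm x)\<^sup>2 - (norm (pr m x))\<^sup>2) \<le> R / 2 * (norm x)\<^sup>2"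
      using R0 by (intro mult_left_mono) auto
    with Pup[OF jx] Plo[OF jx]
    have "Re (cinner (P x) x) \<le> real d / 2 * (up j - f j) * (norm x)\<^sup>2 + R / 2 * (norm x)\<^sup>2"
      "real d / 2 * (lo j - f j) * (norm x)\<^sup>2 - R / 2 * (norm x)\<^sup>2 \<le> Re (cinner (P x) x)" by linarith+
    then have "\<theta> * Re (cinner (P x) x) \<le> \<theta> * (real d / 2 * (up j - f j) * (norm x)\<^sup>2 + R / 2 * (norm x)\<^sup>2)"
      "\<theta> * (real d / 2 * (lo j - f j) * (norm x)\<^sup>2 - R / 2 * (norm x)\<^sup>2) \<le> \<theta> * Re (cinner (P x) x)"
      using \<theta>(1) by auto
    moreover have "\<theta> * (real d / 2 * u * (norm x)\<^sup>2 + R / 2 * (norm x)\<^sup>2) = (u + R / real d) * (norm x)\<^sup>2"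
      "\<theta> * (real d / 2 * u * (norm x)\<^sup>2 - R / 2 * (norm x)\<^sup>2) = (u - R / real d) * (norm x)\<^sup>2" for u
      using d(1) by (simp_all add: \<theta>_def field_simps)
    moreover have "Re (cinner (P' x) x) = \<theta> * Re (cinner (P x) x)"
      by (simp add: P'_def scaleR_cinner_left)
    ultimately show "Re (cinner (P' x) x) \<le> (up j - f j + R / real d) * (norm x)\<^sup>2"
      "(lo j - f j - R / real d) * (norm x)\<^sup>2 \<le> Re (cinner (P' x) x)"
      by (simp_all only:)
  qed
  have nP': "norm (P' x) \<le> (2 * R) * norm x" for x
  proof (rule norm_le_by_colours[OF P'adj P'E P'col])
    fix j x assume jx: "j < n" "col j x" "x \<in> E M"
    have Rd: "R / real d \<le> R" using d(1) R0 by (simp add: field_simps mult_le_cancel_left1)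
    have "(up j - f j + R / real d) * (norm x)\<^sup>2 \<le> 2 * R * (norm x)\<^sup>2"
      "- (2 * R) * (norm x)\<^sup>2 \<le> (lo j - f j - R / real d) * (norm x)\<^sup>2"
      using f[OF jx(1)] R[OF jx(1)] Rd by (intro mult_right_mono; simp)+
    then show "\<bar>Re (cinner (P' x) x)\<bar> \<le> 2 * R * (norm x)\<^sup>2"
      using P'form[OF jx(1,3,2)] by (simp add: abs_le_iff)
  qed (use R0 in simp)
  have Ph: "adj_pair Ph Ph" "\<And>x. Ph x \<in> E M" "colp Ph"
    by (simp_all add: Ph_def adj_Phi Phi_in_E colp_Phi)
  have A: "adj_pair A A" "\<And>x. A x \<in> E M" "colp A"
    using adj_pairD[OF Ph(1)] adj_pairD[OF P'adj]
    by (auto simp: adj_pair_def A_def cinner_simps colp_def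
        intro!: E_intros Ph(2) P'E col_intros colpD[OF Ph(3)] colpD[OF P'col])
  have nUs: "norm (U x) \<le> sqrt d * R * norm x" for x
  proof (rule power2_le_imp_le)
    show "(norm (U x))\<^sup>2 \<le> (sqrt d * R * norm x)\<^sup>2"
      using nU[of x] by (simp add: power_mult_distrib)
  qed (use R0 in simp)
  have nVs: "norm (V x) \<le> sqrt d * R * norm x" for x
    by (rule adj_pair_norm_le[OF UV nUs])
  have nS: "norm (S x) \<le> \<eta> * norm x" for x
  proof -
    have "norm (S x) \<le> \<theta> / 2 * (norm (V x) + norm (U x))"
      using \<theta>(1) by (simp add: S_def norm_triangle_ineq4)
    also have "\<dots> \<le> \<theta> / 2 * (sqrt d * R * norm x + sqrt d * R * norm x)"
      using \<theta>(1) by (intro mult_left_mono add_mono nUs nVs) auto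
    also have "\<dots> = \<eta> * norm x"
      using d(1) by (simp add: \<theta>_def \<eta>_def field_simps power2_eq_square[symmetric])
    finally show ?thesis .
  qed
  have SE: "S x \<in> E M" for x by (auto simp: S_def intro!: E_intros rng)
  have Scol: "colp S" unfolding colp_def S_def by (auto intro!: col_intros colpD[OF cols(2)] colpD[OF cols(3)])
  have Sadj: "adj_pair S (\<lambda>x. - S x)"
    using adj_pairD[OF UV] adj_pairD[OF adj_pair_sym[OF UV]]
    by (simp add: adj_pair_def S_def scaleR_cinner_left scaleR_cinner_right cinner_simps algebra_simps)
  note linS = adj_pair_clin[OF Sadj] and linA = adj_pair_clin[OF A(1)] and linP' = adj_pair_clin[OF P'adj]
  \<comment> \<open>Hence only \<open>P'\<close>, bounded by \<open>R\<close>, contributes to the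
    commutator of \<open>A\<close> and \<open>S\<close>.\<close>
  have comm: "S (Ph x) = Ph (S x)" for x
    unfolding Ph_def
    by (rule Phi_commute[OF Sadj _ _ SE]) (auto intro!: E_intros SE col_intros colpD[OF Scol] simp: colp_def)
  define g where "g = Complex 0 \<gamma>"
  have g: "cnj g = - g" "g * g = - complex_of_real (\<gamma>\<^sup>2)" "norm g = \<gamma>"
    using \<gamma> by (simp_all add: g_def complex_eq_iff power2_eq_square norm_complex_def)
  \<comment> \<open>On colour \<open>j\<close> within \<open>E M\<close> this is f j + i\<gamma>
    plus \<theta> times the nilpotent model, so f j + i\<gamma> is the only possible
    eigenvalue.\<close>
  define Mo where "Mo x = A x + g *\<^sub>C pr M x + S x" for x
  define Ms where "Ms x = A x - g *\<^sub>C pr M x - S x" for x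
  have Madj: "adj_pair Mo Ms"
    using adj_pairD[OF A(1)] adj_pairD[OF adj_pr, of M] adj_pairD[OF Sadj]
    by (simp add: adj_pair_def Mo_def Ms_def cinner_simps g)
  have ME: "Mo x \<in> E M" "Ms x \<in> E M" for x
    unfolding Mo_def Ms_def by (auto intro!: E_intros A SE pr_in_E)
  have Mcol: "colp Mo" "colp Ms"
    unfolding colp_def Mo_def Ms_def by (auto intro!: col_intros colpD[OF A(3)] colpD[OF Scol])
  note linMo = adj_pair_clin[OF Madj] and linMs = adj_pair_clin[OF adj_pair_sym[OF Madj]]
  have prM: "A (pr M x) = A x" "S (pr M x) = S x" "pr M (A x) = A x" "pr M (S x) = S x" "pr M (pr M x) = pr M x" for x
    by (auto intro: adj_pair_pr[OF A(1,2)] adj_pair_pr[OF Sadj E_minus[OF SE]] simp: pr_id A SE pr_in_E)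
  define K where "K x = Ms (Mo x) - A (A x)" for x
  \<comment> \<open>Expanding (A - g - S) (A + g + S) leaves, besides A^2, the positive term -g^2 =
    \<gamma>^2 and terms that all contain the small operator \<open>S\<close>.\<close>
  have Keq: "K x = complex_of_real (\<gamma>\<^sup>2) *\<^sub>C pr M x + (P' (S x) - S (P' x)) - (2 * g) *\<^sub>C S x - S (S x)" for x
  proof -
    have "A (S x) - S (A x) = P' (S x) - S (P' x)"
      by (simp add: A_def clin_simps[OF linS] comm)
    moreover have "K x = complex_of_real (\<gamma>\<^sup>2) *\<^sub>C pr M x + (A (S x) - S (A x)) - (g *\<^sub>C S x + g *\<^sub>C S x) - S (S x)"
      using g(2) by (simp add: K_def Mo_def Ms_def clin_simps[OF linS] clin_simps[OF linA] clin_simps[OF clin_pr] prM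
          scaleC_add_right scaleC_scaleC complex_vector.scale_right_diff_distrib complex_vector.scale_minus_left)
    ultimately show ?thesis
      by (simp only: mult_2 scaleC_add_left)
  qed
  have Kadj: "adj_pair K K"
    using adj_pairD[OF Madj] adj_pairD[OF adj_pair_sym[OF Madj]] adj_pairD[OF A(1)]
    by (simp add: adj_pair_def K_def cinner_simps)
  have KE: "K x \<in> E M" for x by (auto simp: K_def intro!: E_intros ME A)
  have Kcol: "colp K" unfolding colp_def K_def
    by (auto intro!: col_intros colpD[OF A(3)] colpD[OF Mcol(1)] colpD[OF Mcol(2)])
  \<comment> \<open>On \<open>E M\<close>, \<open>K\<close> is \<gamma>^2 (1 - B) with
    \<open>B\<close> small, so \<gamma> times the square root 1 - Y of 1 - B is a square root of
    \<open>K\<close>.\<close>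
  define B where "B x = pr M x - inverse (\<gamma>\<^sup>2) *\<^sub>R K x" for x
  have B: "adj_pair B B" "\<And>x. B x \<in> E M" "colp B"
    using adj_pairD[OF Kadj] adj_pairD[OF adj_pr, of M]
    by (auto simp: adj_pair_def B_def cinner_simps colp_def scaleR_cinner_left scaleR_cinner_right
        intro!: E_intros pr_in_E KE col_intros colpD[OF Kcol])
  have nB: "norm (B x) \<le> 1/4 * norm x" for x
  proof -
    have "K x - \<gamma>\<^sup>2 *\<^sub>R pr M x = (P' (S x) - S (P' x)) - (2 * g) *\<^sub>C S x - S (S x)"
      by (simp add: Keq scaleR_scaleC)
    also have "norm \<dots> \<le> norm (P' (S x)) + norm (S (P' x)) + norm ((2 * g) *\<^sub>C S x) + norm (S (S x))"
      by (intro order.trans[OF norm_triangle_ineq4] add_mono order.refl)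
    also have "\<dots> \<le> 2 * R * (\<eta> * norm x) + \<eta> * (2 * R * norm x) + 2 * \<gamma> * (\<eta> * norm x) + \<eta> * (\<eta> * norm x)"
    proof (intro add_mono)
      show "norm (P' (S x)) \<le> 2 * R * (\<eta> * norm x)"
        using R0 by (intro order.trans[OF nP'] mult_left_mono nS) auto
      show "norm (S (P' x)) \<le> \<eta> * (2 * R * norm x)"
        using \<eta>(2) by (intro order.trans[OF nS] mult_left_mono nP') auto
      show "norm ((2 * g) *\<^sub>C S x) \<le> 2 * \<gamma> * (\<eta> * norm x)"
        using \<gamma> nS[of x] by (simp add: norm_scaleC norm_mult g(3))
      show "norm (S (S x)) \<le> \<eta> * (\<eta> * norm x)"
        using \<eta>(2) by (intro order.trans[OF nS] mult_left_mono nS) auto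
    qed
    also have "\<dots> = (4 * R * \<eta> + 2 * \<gamma> * \<eta> + \<eta>\<^sup>2) * norm x"
      by (simp add: algebra_simps power2_eq_square)
    also have "\<dots> \<le> \<gamma>\<^sup>2 / 4 * norm x"
      by (intro mult_right_mono \<eta>) auto
    finally have 1: "norm (K x - \<gamma>\<^sup>2 *\<^sub>R pr M x) \<le> \<gamma>\<^sup>2 / 4 * norm x" .
    have "B x = - (inverse (\<gamma>\<^sup>2) *\<^sub>R (K x - \<gamma>\<^sup>2 *\<^sub>R pr M x))"
      using \<gamma> by (simp add: B_def scaleR_diff_right)
    then have "norm (B x) = inverse (\<gamma>\<^sup>2) * norm (K x - \<gamma>\<^sup>2 *\<^sub>R pr M x)"
      by simp
    also have "\<dots> \<le> inverse (\<gamma>\<^sup>2) * (\<gamma>\<^sup>2 / 4 * norm x)"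
      using 1 by (intro mult_left_mono) auto
    also have "\<dots> = 1/4 * norm x" using \<gamma> by (simp add: field_simps)
    finally show ?thesis .
  qed
  obtain Y where Y: "adj_pair Y Y" "\<And>x. norm (Y x) \<le> 1/4 * norm x" "\<And>x. Y x \<in> E M" "colp Y"
    "\<And>x. 2 *\<^sub>R Y x = B x + Y (Y x)"
    using operator_sqrt[OF B(1) nB B(2,3)] by blast
  define X where "X x = \<gamma> *\<^sub>R (pr M x - Y x)" for x
  have X: "adj_pair X X" "\<And>x. X x \<in> E M" "colp X"
    using adj_pairD[OF Y(1)] adj_pairD[OF adj_pr, of M]
    by (auto simp: adj_pair_def X_def cinner_simps colp_def scaleR_cinner_left scaleR_cinner_right
        intro!: E_intros pr_in_E Y col_intros colpD[OF Y(4)])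
  note linX = adj_pair_clin[OF X(1)]
  have XX: "X (X x) = K x" for x
  proof -
    have YpY: "Y (pr M x) = Y x" by (rule adj_pair_pr[OF Y(1,3)])
    have "X (X x) = (\<gamma> * \<gamma>) *\<^sub>R (pr M x - (2 *\<^sub>R Y x - Y (Y x)))"
      by (simp add: X_def clin_simps[OF clin_pr] clin_simps[OF adj_pair_clin[OF Y(1)]] prM pr_id[OF Y(3)] YpY
          scaleR_2 algebra_simps)
    also have "\<dots> = K x"
      unfolding Y(5) using \<gamma> by (simp add: B_def power2_eq_square[symmetric])
    finally show ?thesis .
  qed
  have nX: "norm (X x) \<le> 2 * \<gamma> * norm x" for x
  proof -
    have "norm (X x) \<le> \<gamma> * (norm (pr M x) + norm (Y x))"
      using \<gamma> by (simp add: X_def norm_triangle_ineq4)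
    also have "\<dots> \<le> \<gamma> * (norm x + 1/4 * norm x)"
      using \<gamma> by (intro mult_left_mono add_mono Y(2) norm_pr_le) auto
    also have "\<dots> \<le> 2 * \<gamma> * norm x" using \<gamma> by simp
    finally show ?thesis .
  qed
  define s t where "s = sh M" and "t = sb M"
  have lins: "clin s" and lint: "clin t" by (simp_all add: s_def t_def clin_sh clin_sb)
  have st: "cinner (s x) y = cinner x (t y)" "cinner (t x) y = cinner x (s y)" for x y
    using adj_pairD[OF adj_sh] adj_pairD[OF adj_pair_sym[OF adj_sh]] by (simp_all add: s_def t_def)
  \<comment> \<open>In blocks this is [[A, X], [X, Ph]]. Its square compresses to A^2 + X^2 = A^2 +
    K = Ms Mo on \<open>E M\<close>; the corner \<open>Ph\<close> does not enter there and holds the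
    form on the fresh vectors at \<open>f j\<close>.\<close>
  define T1 where "T1 x = A x + s (X x) + X (t x) + s (Ph (t x))" for x
  have E2: "x \<in> E (2 * M)" if "x \<in> E M" for x using that E_mono[of M "2 * M"] by auto
  have sE: "s x \<in> E (2 * M)" for x by (simp add: s_def sh_in_E)
  have T1adj: "adj_pair T1 T1"
    using adj_pairD[OF A(1)] adj_pairD[OF X(1)] adj_pairD[OF Ph(1)]
    by (simp add: adj_pair_def T1_def cinner_simps st)
  have T1E: "T1 x \<in> E (2 * M)" for x
    unfolding T1_def by (intro E_intros sE E2[OF A(2)] E2[OF X(2)])
  have T1col: "colp T1"
    unfolding colp_def T1_def s_def t_def
    by (auto intro!: col_intros colpD[OF A(3)] colpD[OF X(3)] colpD[OF Ph(3)])
  have form: "(lo j - \<xi>) * (norm x)\<^sup>2 \<le> Re (cinner (T1 x) x) \<and> Re (cinner (T1 x) x) \<le> (up j + \<xi>) * (norm x)\<^sup>2"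
    if j: "j < n" and x: "x \<in> E (2 * M)" and c: "col j x" for j x
  proof -
    define y z where "y = pr M x" and "z = t x"
    have yz: "y \<in> E M" "z \<in> E M" "col j y" "col j z"
      using c by (auto simp: y_def z_def t_def pr_in_E sb_in_E col_pr col_sb)
    have nx: "(norm x)\<^sup>2 = (norm y)\<^sup>2 + (norm z)\<^sup>2"
      using norm_E_double[OF x] by (simp add: y_def z_def t_def)
    have "cinner (A x) x = cinner (A y) y"
      using adj_pairD[OF adj_pr, of M "A x" x] by (simp add: prM y_def)
    moreover have "cinner (X z) x = cinner (X z) y"
      using adj_pairD[OF adj_pr, of M "X z" x] by (simp add: pr_id[OF X(2)] y_def)
    moreover have "X x = X y" unfolding y_def by (rule adj_pair_pr[OF X(1,2), symmetric])
    ultimately have "Re (cinner (T1 x) x) = Re (cinner (A y) y) + (Re (cinner (X y) z) + Re (cinner (X z) y)) + Re (cinner (Ph z) z)"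
      by (simp add: T1_def cinner_simps st z_def)
    also have "Re (cinner (X z) y) = Re (cinner (X y) z)"
      using adj_pairD[OF X(1), of z y] Re_cinner_commute[of z "X y"] by simp
    also have "Re (cinner (Ph z) z) = f j * (norm z)\<^sup>2"
      by (simp add: Ph_def Phi_col[OF yz(4,2)] scaleR_cinner_left norm_sq_eq_Re_cinner)
    also have "Re (cinner (A y) y) = f j * (norm y)\<^sup>2 + Re (cinner (P' y) y)"
      by (simp add: A_def Ph_def Phi_col[OF yz(3,1)] scaleR_cinner_left cinner_simps norm_sq_eq_Re_cinner)
    finally have eq: "Re (cinner (T1 x) x) = f j * (norm x)\<^sup>2 + Re (cinner (P' y) y) + 2 * Re (cinner (X y) z)"
      by (simp add: nx algebra_simps)
    have "\<bar>Re (cinner (X y) z)\<bar> \<le> norm (X y) * norm z"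
      by (rule order.trans[OF abs_Re_le_cmod cinner_Cauchy_Schwarz])
    also have "\<dots> \<le> 2 * \<gamma> * norm y * norm z" by (intro mult_right_mono nX) auto
    also have "\<dots> = \<gamma> * (2 * norm y * norm z)" by simp
    also have "\<dots> \<le> \<gamma> * (norm x)\<^sup>2"
      using \<gamma> sum_squares_bound[of "norm y" "norm z"] by (intro mult_left_mono) (auto simp: nx)
    finally have X1: "\<bar>Re (cinner (X y) z)\<bar> \<le> \<gamma> * (norm x)\<^sup>2" .
    \<comment> \<open>The form of \<open>P'\<close> sees only \<open>y\<close>; as its bounds
      straddle 0, they may be relaxed to the full norm of \<open>x\<close>.\<close>
    have "0 \<le> (up j - f j + R / real d) * (norm z)\<^sup>2" "(lo j - f j - R / real d) * (norm z)\<^sup>2 \<le> 0"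
      using f[OF j] R0 by (auto intro!: mult_nonneg_nonneg mult_nonpos_nonneg)
        (use divide_nonneg_nonneg[OF R0 of_nat_0_le_iff[of d]] in linarith)+
    with P'form[OF j yz(1,3)] have P1: "Re (cinner (P' y) y) \<le> (up j - f j + R / real d) * (norm x)\<^sup>2"
      "(lo j - f j - R / real d) * (norm x)\<^sup>2 \<le> Re (cinner (P' y) y)"
      by (simp_all add: nx algebra_simps)
    have "(R / real d) * (norm x)\<^sup>2 \<le> \<xi> / 2 * (norm x)\<^sup>2"
      using d(2) by (intro mult_right_mono) auto
    moreover define r where "r = R / real d"
    ultimately show ?thesis
      using abs_le_D1[OF X1] abs_le_D2[OF X1] P1 unfolding eq \<gamma>_def r_def[symmetric]
      by (simp add: algebra_simps)
  qed
  have close: "norm (T1 x - T x) \<le> \<xi> * norm x" if x: "x \<in> E m" for x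
  proof -
    have "x \<in> E M" using x E_mono[OF M] by auto
    then have "t x = 0" by (simp add: t_def)
    moreover have "A x = T x"
      using Phi_mono[OF x M, of f] \<theta>(2)
      by (simp add: A_def P'_def Ph_def PQ[OF x] Q_def)
    ultimately have "T1 x - T x = s (X x)"
      by (simp add: T1_def clin_zero[OF linX] clin_zero[OF lins] clin_zero[OF adj_pair_clin[OF Ph(1)]])
    then have "norm (T1 x - T x) = norm (X x)"
      by (simp add: s_def norm_sh pr_id[OF X(2)])
    also have "\<dots> \<le> 2 * \<gamma> * norm x" by (rule nX)
    also have "\<dots> \<le> \<xi> * norm x" using \<xi> by (intro mult_right_mono) (auto simp: \<gamma>_def)
    finally show ?thesis .
  qed
  have spec: "\<exists>j<n. norm (\<mu> - of_real (f j)) \<le> \<xi>" if \<mu>: "\<mu> \<in> spectrum2 T1 (E M)" for \<mu>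
  proof -
    obtain x where x: "x \<in> E M" "x \<noteq> 0"
      and 0: "\<And>y. y \<in> E M \<Longrightarrow> cinner (T1 (T1 x) - (2 * \<mu>) *\<^sub>C T1 x + \<mu>\<^sup>2 *\<^sub>C x) y = 0"
      using \<mu> unfolding spectrum2_iff[OF adj_pair_clin[OF T1adj] E_finite_dim E_subspace] by blast
    have tx: "t x = 0" using x(1) by (simp add: t_def)
    have T1x: "T1 x = A x + s (X x)"
      by (simp add: T1_def tx clin_zero[OF linX] clin_zero[OF lins] clin_zero[OF adj_pair_clin[OF Ph(1)]])
    have sy: "cinner (s w) y = 0" if "y \<in> E M" for w y
      using that by (simp add: st t_def)
    have TT: "cinner (T1 (T1 x)) y = cinner (A (A x) + K x) y" if y: "y \<in> E M" for y
    proof -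
      have "cinner (T1 (T1 x)) y = cinner (T1 x) (T1 y)" by (rule adj_pairD[OF T1adj])
      also have "T1 y = A y + s (X y)"
        using y by (simp add: T1_def t_def clin_zero[OF linX] clin_zero[OF lins] clin_zero[OF adj_pair_clin[OF Ph(1)]])
      also have "cinner (T1 x) (A y + s (X y)) = cinner (A x) (A y) + cinner (X x) (X y)"
        unfolding T1x
        using cinner_pr_sh[of M "A x" "X y"] sy[OF A(2)]
        by (simp add: cinner_simps s_def pr_id[OF X(2)] prM)
      also have "\<dots> = cinner (A (A x) + K x) y"
        by (simp add: cinner_simps adj_pairD[OF A(1)] adj_pairD[OF X(1)] XX[symmetric])
      finally show ?thesis .
    qed
    \<comment> \<open>The pencil factors as (Ms - \<mu>) (Mo - \<mu>): either \<open>w\<close> is an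
      eigenvector of \<open>Ms\<close>, or \<open>w\<close> vanishes and \<open>x\<close> is one of
      \<open>Mo\<close>.\<close>
    define w where "w = Mo x - \<mu> *\<^sub>C x"
    have wE: "w \<in> E M" by (auto simp: w_def intro!: E_intros ME x)
    have "Ms w - \<mu> *\<^sub>C w = A (A x) + K x - (2 * \<mu>) *\<^sub>C A x + \<mu>\<^sup>2 *\<^sub>C x"
    proof -
      have "Ms x + Mo x = A x + A x" by (simp add: Ms_def Mo_def)
      then have "\<mu> *\<^sub>C Ms x + \<mu> *\<^sub>C Mo x = (2 * \<mu>) *\<^sub>C A x"
        by (metis mult_2 scaleC_add_left scaleC_add_right)
      then show ?thesis
        by (simp add: w_def K_def clin_simps[OF linMs] complex_vector.scale_right_diff_distrib scaleC_scaleC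
            power2_eq_square algebra_simps)
    qed
    moreover have "cinner (A (A x) + K x - (2 * \<mu>) *\<^sub>C A x + \<mu>\<^sup>2 *\<^sub>C x) y = 0" if y: "y \<in> E M" for y
      using 0[OF y] TT[OF y] sy[OF y] by (simp add: cinner_simps T1x)
    moreover have "Ms w - \<mu> *\<^sub>C w \<in> E M" by (auto intro!: E_intros ME wE)
    ultimately have "cinner (Ms w - \<mu> *\<^sub>C w) (Ms w - \<mu> *\<^sub>C w) = 0" by simp
    then have w0: "Ms w = \<mu> *\<^sub>C w" using cinner_eq_zero by fastforce
    show ?thesis
    proof (cases "w = 0")
      case False
      obtain j v where v: "j < n" "v \<in> E M" "col j v" "v \<noteq> 0" "Ms v = \<mu> *\<^sub>C v"
        by (rule coloured_eigenvector[OF linMs ME(2) Mcol(2) wE False w0])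
      \<comment> \<open>On colour \<open>j\<close>, \<open>v\<close> solves the eigenvalue equation
        of the adjoint nilpotent model with eigenvalue (\<mu> - f j + g) / \<theta>, which must then
        be 0.\<close>
      have "\<theta> *\<^sub>R (P v - (1/2) *\<^sub>R (V v - U v)) = (\<mu> - f j + g) *\<^sub>C v"
        using v(5) Phi_col[OF v(3,2), of f]
        by (simp add: Ms_def A_def Ph_def P'_def S_def pr_id[OF v(2)] scaleC_add_left scaleR_scaleC[of "f j"]
            complex_vector.scale_left_diff_distrib algebra_simps)
      then have "P v - (1/2) *\<^sub>R (V v - U v) = inverse \<theta> *\<^sub>R ((\<mu> - f j + g) *\<^sub>C v)"
        using \<theta>(1) by (metis inverse_eq_divide less_irrefl scaleR_one scaleR_scaleR left_inverse)
      then have "P v - (1/2) *\<^sub>R (V v - U v) = (inverse \<theta> * (\<mu> - f j + g)) *\<^sub>C v"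
        by (simp add: scaleR_scaleC scaleC_scaleC)
      from inj2[OF _ v(2) this] v(4) \<theta>(1) have "\<mu> - f j = - g"
        by (auto simp: add_eq_0_iff2)
      then have "norm (\<mu> - f j) = \<gamma>" using g(3) by simp
      then show ?thesis using v(1) \<xi> by (auto simp: \<gamma>_def)
    next
      case True
      then have "Mo x = \<mu> *\<^sub>C x" by (simp add: w_def)
      then obtain j v where v: "j < n" "v \<in> E M" "col j v" "v \<noteq> 0" "Mo v = \<mu> *\<^sub>C v"
        by (rule coloured_eigenvector[OF linMo ME(1) Mcol(1) x])
      have "\<theta> *\<^sub>R (P v + (1/2) *\<^sub>R (V v - U v)) = (\<mu> - f j - g) *\<^sub>C v"
        using v(5) Phi_col[OF v(3,2), of f]
        by (simp add: Mo_def A_def Ph_def P'_def S_def pr_id[OF v(2)] scaleC_add_left scaleR_scaleC[of "f j"]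
            complex_vector.scale_left_diff_distrib algebra_simps)
      then have "P v + (1/2) *\<^sub>R (V v - U v) = inverse \<theta> *\<^sub>R ((\<mu> - f j - g) *\<^sub>C v)"
        using \<theta>(1) by (metis inverse_eq_divide less_irrefl scaleR_one scaleR_scaleR left_inverse)
      then have "P v + (1/2) *\<^sub>R (V v - U v) = (inverse \<theta> * (\<mu> - f j - g)) *\<^sub>C v"
        by (simp add: scaleR_scaleC scaleC_scaleC)
      from inj1[OF _ v(2) this] v(4) \<theta>(1) have "\<mu> - f j = g"
        by auto
      then have "norm (\<mu> - f j) = \<gamma>" using g(3) by simp
      then show ?thesis using v(1) \<xi> by (auto simp: \<gamma>_def)
    qed
  qed
  have "coloured_model (\<lambda>j. lo j - \<xi>) (\<lambda>j. up j + \<xi>) (2 * M) T1"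
    unfolding coloured_model_def using T1adj T1E T1col form by blast
  then show ?thesis
    using M close spec by (intro exI[of _ M] exI[of _ T1]) blast
qed

end

section \<open>Direct sums\<close>

text \<open>The pencil on a subspace involves only inner products of vectors and their images under
  \<open>T\<close>. With the cross terms vanishing it is block diagonal, and each \<open>u r\<close>
  contributes a scalar quadratic equation.\<close>

lemma spectrum2_direct_sum:
  fixes T :: "'a::complex_inner \<Rightarrow> 'a" and u :: "nat \<Rightarrow> 'a" and \<alpha> \<beta> :: "nat \<Rightarrow> real"
  assumes T: "adj_pair T T" and B: "finite B"
    and orth: "\<And>x r. x \<in> cspan B \<Longrightarrow> r < p \<Longrightarrow> cinner x (u r) = 0"
      "\<And>x r. x \<in> cspan B \<Longrightarrow> r < p \<Longrightarrow> cinner (T x) (u r) = 0"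
      "\<And>x r. x \<in> cspan B \<Longrightarrow> r < p \<Longrightarrow> cinner (T x) (T (u r)) = 0"
    and u: "orthonormal_on u {..<p}"
    and \<alpha>: "\<And>r r'. r < p \<Longrightarrow> r' < p \<Longrightarrow> cinner (T (u r)) (u r') = (if r = r' then of_real (\<alpha> r) else 0)"
    and \<beta>: "\<And>r r'. r < p \<Longrightarrow> r' < p \<Longrightarrow> cinner (T (u r)) (T (u r')) = (if r = r' then of_real (\<beta> r) else 0)"
  shows "\<mu> \<in> spectrum2 T (cspan (B \<union> u ` {..<p})) \<Longrightarrow>
      \<mu> \<in> spectrum2 T (cspan B) \<or> (\<exists>r<p. \<mu>\<^sup>2 - 2 * \<mu> * \<alpha> r + \<beta> r = 0)"
    and "r < p \<Longrightarrow> \<mu>\<^sup>2 - 2 * \<mu> * \<alpha> r + \<beta> r = 0 \<Longrightarrow> \<mu> \<in> spectrum2 T (cspan (B \<union> u ` {..<p}))"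
proof -
  define L where "L = cspan (B \<union> u ` {..<p})"
  note lin = adj_pair_clin[OF T]
  have fd: "cfinite_dim (cspan C)" if "finite C" for C :: "'a set"
    using that unfolding cfinite_dim_def by blast
  have L: "cfinite_dim L" "csubspace L" and L0: "cfinite_dim (cspan B)" "csubspace (cspan B)"
    unfolding L_def by (intro fd complex_vector.subspace_span finite_UnI finite_imageI finite_lessThan B)+
  define q where "q x = T (T x) - (2 * \<mu>) *\<^sub>C T x + \<mu>\<^sup>2 *\<^sub>C x" for x
  have linq: "clin q"
    unfolding clin_def q_def
    by (simp add: clin_simps[OF lin] scaleC_add_right complex_vector.scale_right_diff_distrib algebra_simps scaleC_scaleC)
  have q0u: "cinner (q x) (u r) = 0" if "x \<in> cspan B" "r < p" for x r
    using orth[OF that] by (simp add: q_def cinner_simps adj_pairD[OF T, of "T x"])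
  have qu0: "cinner (q (u r)) x = 0" if "x \<in> cspan B" "r < p" for x r
  proof -
    have "cinner (u r) x = 0" "cinner (T (u r)) x = 0" "cinner (T (T (u r))) x = 0"
      using orth[OF that] cinner_commute[of _ x] cinner_commute[of "T (u r)" "T x"]
        adj_pairD[OF T, of "T (u r)" x] adj_pairD[OF T, of x "u r"]
      by (metis complex_cnj_zero)+
    then show ?thesis by (simp add: q_def cinner_simps)
  qed
  have quu: "cinner (q (u r)) (u r') = (if r = r' then \<mu>\<^sup>2 - 2 * \<mu> * \<alpha> r + \<beta> r else 0)" if "r < p" "r' < p" for r r'
    using \<alpha>[OF that] \<beta>[OF that] orthonormal_onD[OF u, of r r'] that
    by (auto simp: q_def cinner_simps adj_pairD[OF T, of "T (u r)"])
  have uL: "u r \<in> L" if "r < p" for r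
    using that by (auto simp: L_def intro!: complex_vector.span_base)
  have BL: "cspan B \<subseteq> L" unfolding L_def by (intro complex_vector.span_mono) auto
  have dec: "\<exists>x0\<in>cspan B. \<exists>c. x = x0 + (\<Sum>r<p. c r *\<^sub>C u r)" if xL: "x \<in> L" for x
  proof -
    obtain x0 x1 where x: "x = x0 + x1" "x0 \<in> cspan B" "x1 \<in> cspan (u ` {..<p})"
      using xL unfolding L_def complex_vector.span_Un by auto
    then have "oproj u {..<p} (x - x0) = x - x0"
      using oproj_id[OF u finite_lessThan, of x1] by simp
    then have "x = x0 + (\<Sum>r<p. cinner (x - x0) (u r) *\<^sub>C u r)"
      by (simp add: oproj_def finop_def)
    then show ?thesis using x(2) by (intro bexI[of _ x0] exI[of _ "\<lambda>r. cinner (x - x0) (u r)"])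
  qed
  show "\<mu> \<in> spectrum2 T (cspan B) \<or> (\<exists>r<p. \<mu>\<^sup>2 - 2 * \<mu> * \<alpha> r + \<beta> r = 0)"
    if "\<mu> \<in> spectrum2 T (cspan (B \<union> u ` {..<p}))"
  proof -
    from that obtain x where x: "x \<in> L" "x \<noteq> 0" "\<And>y. y \<in> L \<Longrightarrow> cinner (q x) y = 0"
      unfolding spectrum2_iff[OF lin L, unfolded L_def] L_def q_def by blast
    obtain x0 c where x0: "x0 \<in> cspan B" and xc: "x = x0 + (\<Sum>r<p. c r *\<^sub>C u r)"
      using dec[OF x(1)] by blast
    have qx: "q x = q x0 + (\<Sum>r<p. c r *\<^sub>C q (u r))"
      unfolding xc by (simp add: clin_add[OF linq] clin_sum[OF linq] clin_scaleC[OF linq])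
    show ?thesis
    proof (cases "\<exists>r<p. c r \<noteq> 0")
      case True
      then obtain r where r: "r < p" "c r \<noteq> 0" by blast
      have "cinner (q x) (u r) = (\<Sum>r'<p. if r' = r then c r * (\<mu>\<^sup>2 - 2 * \<mu> * \<alpha> r + \<beta> r) else 0)"
        unfolding qx cinner_add_left cinner_sum_left q0u[OF x0 r(1)] add_0 cinner_scaleC_left
        by (rule sum.cong) (use r quu in auto)
      then have "c r * (\<mu>\<^sup>2 - 2 * \<mu> * \<alpha> r + \<beta> r) = 0"
        using x(3)[OF uL[OF r(1)]] r(1) by simp
      then show ?thesis using r by auto
    next
      case False
      then have "x = x0" by (simp add: xc)
      then have "\<mu> \<in> spectrum2 T (cspan B)"
        unfolding spectrum2_iff[OF lin L0] using x x0 BL by (auto simp: q_def intro!: bexI[of _ x0])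
      then show ?thesis ..
    qed
  qed
  show "\<mu> \<in> spectrum2 T (cspan (B \<union> u ` {..<p}))" if r: "r < p" and 0: "\<mu>\<^sup>2 - 2 * \<mu> * \<alpha> r + \<beta> r = 0"
  proof -
    have "cinner (q (u r)) y = 0" if y: "y \<in> L" for y
    proof -
      obtain y0 c where y0: "y0 \<in> cspan B" and yc: "y = y0 + (\<Sum>r<p. c r *\<^sub>C u r)"
        using dec[OF y] by blast
      have "cinner (q (u r)) (\<Sum>r<p. c r *\<^sub>C u r) = 0"
        unfolding cinner_sum_right cinner_scaleC_right
        by (rule sum.neutral) (use quu[OF r] 0 in auto)
      then show ?thesis
        unfolding yc cinner_add_right using qu0[OF y0 r] by simp
    qed
    moreover have "u r \<noteq> 0" using orthonormal_on_norm[OF u, of r] r by auto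
    ultimately show ?thesis
      unfolding spectrum2_iff[OF lin L, unfolded L_def] using uL[OF r]
      by (auto simp: q_def L_def intro!: bexI[of _ "u r"])
  qed
qed

lemma quadratic_roots:
  fixes \<mu> :: complex
  assumes "v \<ge> 0"
  shows "\<mu>\<^sup>2 - 2 * \<mu> * of_real \<alpha> + of_real (\<alpha>\<^sup>2 + v) = 0 \<longleftrightarrow> \<mu> = Complex \<alpha> (sqrt v) \<or> \<mu> = Complex \<alpha> (- sqrt v)"
proof -
  have i: "Complex \<alpha> (sqrt v) * Complex \<alpha> (- sqrt v) = of_real (\<alpha>\<^sup>2 + v)"
    "Complex \<alpha> (sqrt v) + Complex \<alpha> (- sqrt v) = 2 * of_real \<alpha>"
    using assms by (simp_all add: complex_eq_iff power2_eq_square)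
  have "\<mu>\<^sup>2 - 2 * \<mu> * of_real \<alpha> + of_real (\<alpha>\<^sup>2 + v) = (\<mu> - Complex \<alpha> (sqrt v)) * (\<mu> - Complex \<alpha> (- sqrt v))"
    unfolding i(1)[symmetric] mult.assoc mult.left_commute[of 2] i(2)[symmetric]
    by (simp add: algebra_simps power2_eq_square)
  then show ?thesis by auto
qed

section \<open>Prescribed diagonal entries on fresh basis vectors\<close>

context coloured_basis
begin

definition nodes :: "nat \<Rightarrow> nat \<Rightarrow> (nat \<Rightarrow> nat \<Rightarrow> real) \<Rightarrow> 'a \<Rightarrow> 'a" where
  "nodes m k \<nu> = finop e e ({..<n} \<times> {m..<m + k}) (\<lambda>p. complex_of_real (\<nu> (fst p) (snd p)))"

lemma adj_nodes: "adj_pair (nodes m k \<nu>) (nodes m k \<nu>)"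
  using adj_pair_finop[of e e "{..<n} \<times> {m..<m + k}" "\<lambda>p. complex_of_real (\<nu> (fst p) (snd p))"]
  by (simp add: nodes_def)

lemma cinner_nodes: "j < n \<Longrightarrow> cinner (nodes m k \<nu> x) (e (j, i)) =
    (if m \<le> i \<and> i < m + k then \<nu> j i * cinner x (e (j, i)) else 0)"
  unfolding nodes_def by (subst cinner_finop[of _ _ _ "(j, i)"]) (auto simp: ee split: if_splits)

lemma norm_sq_E: "x \<in> E m \<Longrightarrow> (norm x)\<^sup>2 = (\<Sum>p\<in>{..<n} \<times> {..<m}. (norm (cinner x (e p)))\<^sup>2)"
  unfolding norm_sq_eq_Re_cinner
  by (subst cinner_E[of x m x]) (simp_all add: complex_norm_square[symmetric] del: of_real_power)

text \<open>\<open>T\<close> and the new diagonal part live on disjoint sets of basis vectors, so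
  the form splits; on vectors of colour \<open>j\<close> only entries of colour \<open>j\<close>
  count.\<close>

lemma add_nodes:
  assumes T: "coloured_model lo up m T"
    and \<nu>: "\<And>j i. j < n \<Longrightarrow> m \<le> i \<Longrightarrow> i < m + k \<Longrightarrow> lo j \<le> \<nu> j i \<and> \<nu> j i \<le> up j"
  shows "coloured_model lo up (m + k) (\<lambda>x. T x + nodes m k \<nu> x)"
    and "x \<in> E m \<Longrightarrow> T x + nodes m k \<nu> x = T x"
    and "j < n \<Longrightarrow> m \<le> i \<Longrightarrow> i < m + k \<Longrightarrow> T (e (j, i)) + nodes m k \<nu> (e (j, i)) = \<nu> j i *\<^sub>R e (j, i)"
proof -
  note T' = coloured_modelD[OF T]
  have E1: "x \<in> E (m + k)" if "x \<in> E m" for x using that E_mono[of m "m + k"] by auto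
  have NE: "nodes m k \<nu> x \<in> E (m + k)" for x
    unfolding in_E_iff by (rule eqI) (simp add: cinner_pr cinner_nodes)
  have Ncol: "colp (nodes m k \<nu>)"
    by (simp add: colp_def col_def cinner_nodes)
  have form: "lo j * (norm x)\<^sup>2 \<le> Re (cinner (T x + nodes m k \<nu> x) x) \<and>
       Re (cinner (T x + nodes m k \<nu> x) x) \<le> up j * (norm x)\<^sup>2"
    if j: "j < n" and x: "x \<in> E (m + k)" and c: "col j x" for j x
  proof -
    define D where "D p = (norm (cinner x (e p)))\<^sup>2" for p
    have "cinner (T x) x = cinner (T (pr m x)) (pr m x)"
      using adj_pairD[OF adj_pr, of m "T x" x] by (simp add: adj_pair_pr[OF T'(1,2)] pr_id[OF T'(2)])
    then have 1: "lo j * (norm (pr m x))\<^sup>2 \<le> Re (cinner (T x) x)" "Re (cinner (T x) x) \<le> up j * (norm (pr m x))\<^sup>2"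
      using T'(4)[OF j col_pr[OF c] pr_in_E] T'(5)[OF j col_pr[OF c] pr_in_E] by auto
    have un: "{..<n} \<times> {..<m + k} = {..<n} \<times> {..<m} \<union> {..<n} \<times> {m..<m + k}"
      "({..<n} \<times> {..<m}) \<inter> ({..<n} \<times> {m..<m + k}) = {}" by auto
    have "(norm x)\<^sup>2 = (\<Sum>p\<in>{..<n} \<times> {..<m}. D p) + (\<Sum>p\<in>{..<n} \<times> {m..<m + k}. D p)"
      unfolding norm_sq_E[OF x] un(1) D_def by (rule sum.union_disjoint) (use un(2) in auto)
    moreover have "(norm (pr m x))\<^sup>2 = (\<Sum>p\<in>{..<n} \<times> {..<m}. D p)"
      unfolding norm_sq_E[OF pr_in_E] D_def by (rule sum.cong) (auto simp: cinner_pr)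
    ultimately have nx: "(norm x)\<^sup>2 = (norm (pr m x))\<^sup>2 + (\<Sum>p\<in>{..<n} \<times> {m..<m + k}. D p)"
      by simp
    have "cinner (nodes m k \<nu> x) x = (\<Sum>p\<in>{..<n} \<times> {m..<m + k}. complex_of_real (\<nu> (fst p) (snd p) * D p))"
      unfolding nodes_def finop_def cinner_sum_left D_def
      by (rule sum.cong) (simp_all add: cinner_scaleC_left cinner_commute[of "e _" x] mult.assoc complex_norm_square
          del: of_real_power)
    then have N: "Re (cinner (nodes m k \<nu> x) x) = (\<Sum>p\<in>{..<n} \<times> {m..<m + k}. \<nu> (fst p) (snd p) * D p)"
      by (simp del: of_real_mult)
    have D: "D p = 0 \<or> fst p = j" if "p \<in> {..<n} \<times> {m..<m + k}" for p
      using that c by (cases p) (auto simp: D_def col_def)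
    have D0: "D p \<ge> 0" for p by (simp add: D_def)
    have "lo j * (\<Sum>p\<in>{..<n} \<times> {m..<m + k}. D p) \<le> Re (cinner (nodes m k \<nu> x) x)"
      unfolding N sum_distrib_left
    proof (rule sum_mono)
      fix p assume p: "p \<in> {..<n} \<times> {m..<m + k}"
      then show "lo j * D p \<le> \<nu> (fst p) (snd p) * D p"
        using D[OF p] D0[of p] \<nu>[of "fst p" "snd p"] by (cases "D p = 0") (auto intro!: mult_right_mono)
    qed
    moreover have "Re (cinner (nodes m k \<nu> x) x) \<le> up j * (\<Sum>p\<in>{..<n} \<times> {m..<m + k}. D p)"
      unfolding N sum_distrib_left
    proof (rule sum_mono)
      fix p assume p: "p \<in> {..<n} \<times> {m..<m + k}"
      then show "\<nu> (fst p) (snd p) * D p \<le> up j * D p"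
        using D[OF p] D0[of p] \<nu>[of "fst p" "snd p"] by (cases "D p = 0") (auto intro!: mult_right_mono)
    qed
    ultimately show ?thesis
      using 1 by (simp add: nx cinner_simps distrib_left)
  qed
  show "coloured_model lo up (m + k) (\<lambda>x. T x + nodes m k \<nu> x)"
    unfolding coloured_model_def
  proof (intro conjI allI ballI impI)
    show "adj_pair (\<lambda>x. T x + nodes m k \<nu> x) (\<lambda>x. T x + nodes m k \<nu> x)"
      using adj_pairD[OF T'(1)] adj_pairD[OF adj_nodes] by (simp add: adj_pair_def cinner_simps)
    show "T x + nodes m k \<nu> x \<in> E (m + k)" for x by (intro E_add E1 T'(2) NE)
    show "colp (\<lambda>x. T x + nodes m k \<nu> x)"
      unfolding colp_def by (auto intro!: col_add colpD[OF T'(3)] colpD[OF Ncol])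
  qed (use form in auto)
  show "T x + nodes m k \<nu> x = T x" if "x \<in> E m"
  proof -
    have "nodes m k \<nu> x = 0"
      by (rule eqI) (use cinner_E_eq_0[OF that] in \<open>auto simp: cinner_nodes\<close>)
    then show ?thesis by simp
  qed
  show "T (e (j, i)) + nodes m k \<nu> (e (j, i)) = \<nu> j i *\<^sub>R e (j, i)" if "j < n" "m \<le> i" "i < m + k"
  proof -
    have "pr m (e (j, i)) = 0"
      by (rule eqI) (use that in \<open>auto simp: cinner_pr ee\<close>)
    then have "T (e (j, i)) = 0"
      using adj_pair_pr[OF T'(1,2), of "e (j, i)"] clin_zero[OF adj_pair_clin[OF T'(1)]] by simp
    moreover have "nodes m k \<nu> (e (j, i)) = \<nu> j i *\<^sub>R e (j, i)"
      by (rule eqI) (use that in \<open>auto simp: cinner_nodes ee scaleR_cinner_left\<close>)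
    ultimately show ?thesis by simp
  qed
qed

end

section \<open>Discrete measures with prescribed mean and variance\<close>

lemma variance_nonneg:
  fixes w y :: "nat \<Rightarrow> real"
  assumes "\<And>s. s < k \<Longrightarrow> w s \<ge> 0" "(\<Sum>s<k. w s) = 1"
  shows "(\<Sum>s<k. w s * y s)\<^sup>2 \<le> (\<Sum>s<k. w s * (y s)\<^sup>2)"
proof -
  define \<alpha> where "\<alpha> = (\<Sum>s<k. w s * y s)"
  have "0 \<le> (\<Sum>s<k. w s * (y s - \<alpha>)\<^sup>2)" by (intro sum_nonneg mult_nonneg_nonneg assms) auto
  also have "\<dots> = (\<Sum>s<k. w s * (y s)\<^sup>2) - 2 * \<alpha> * (\<Sum>s<k. w s * y s) + \<alpha>\<^sup>2 * (\<Sum>s<k. w s)"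
    by (simp add: power2_diff sum_subtractf sum.distrib sum_distrib_left sum_distrib_right algebra_simps)
  finally show ?thesis
    using assms(2) by (simp add: \<alpha>_def power2_eq_square)
qed

lemma abs_sqrt_diff_le:
  assumes "0 \<le> a" "0 \<le> b"
  shows "\<bar>sqrt a - sqrt b\<bar> \<le> sqrt \<bar>a - b\<bar>"
proof -
  have *: "sqrt a - sqrt b \<le> sqrt \<bar>a - b\<bar>" if "0 \<le> a" "0 \<le> b" for a b
  proof -
    have "sqrt a \<le> sqrt (b + \<bar>a - b\<bar>)" by (intro real_sqrt_le_mono) auto
    also have "\<dots> \<le> sqrt b + sqrt \<bar>a - b\<bar>" using that by (intro sqrt_add_le_add_sqrt) auto
    finally show ?thesis by simp
  qed
  show ?thesis using *[OF assms] *[OF assms(2,1)] by (simp add: abs_minus_commute abs_le_iff)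
qed

text \<open>Moving the atoms by at most \<open>r\<close> changes the mean by at most
  \<open>r\<close>, the second moment and the squared mean by 2 B r each, hence the variance by 4 B
  r; the square root of the variance then moves by at most the root of that.\<close>

lemma perturbed_mean_variance:
  fixes w y y' :: "nat \<Rightarrow> real"
  assumes w: "\<And>s. s < k \<Longrightarrow> w s \<ge> 0" "(\<Sum>s<k. w s) = 1"
    and r: "\<And>s. s < k \<Longrightarrow> \<bar>y' s - y s\<bar> \<le> r" and B: "\<And>s. s < k \<Longrightarrow> \<bar>y s\<bar> \<le> B \<and> \<bar>y' s\<bar> \<le> B"
    and z: "(\<Sum>s<k. w s * y s) = Re z" "(\<Sum>s<k. w s * (y s)\<^sup>2) = (Re z)\<^sup>2 + (Im z)\<^sup>2"
    and \<alpha>: "\<alpha> = (\<Sum>s<k. w s * y' s)" and v: "v = (\<Sum>s<k. w s * (y' s)\<^sup>2) - \<alpha>\<^sup>2"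
    and \<sigma>: "\<sigma> = 1 \<or> \<sigma> = - 1"
  shows "norm (Complex \<alpha> (\<sigma> * sqrt v) - Complex (Re z) (\<sigma> * \<bar>Im z\<bar>)) \<le> r + sqrt (4 * B * r)"
proof -
  have r0: "0 \<le> r" and B0: "0 \<le> B"
    using w(2) r[of 0] B[of 0] by (cases k; force)+
  have mean: "\<bar>(\<Sum>s<k. w s * g s)\<bar> \<le> C" if "\<And>s. s < k \<Longrightarrow> \<bar>g s\<bar> \<le> C" for g C
  proof -
    have "\<bar>(\<Sum>s<k. w s * g s)\<bar> \<le> (\<Sum>s<k. w s * C)"
      by (rule order.trans[OF sum_abs]) (use that w(1) in \<open>auto simp: abs_mult intro!: sum_mono mult_left_mono\<close>)
    also have "\<dots> = C" by (simp add: sum_distrib_right[symmetric] w(2))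
    finally show ?thesis .
  qed
  have 1: "\<bar>\<alpha> - Re z\<bar> \<le> r"
    using mean[of "\<lambda>s. y' s - y s" r] r by (simp add: \<alpha> z(1)[symmetric] right_diff_distrib sum_subtractf)
  have sq: "\<bar>p\<^sup>2 - q\<^sup>2\<bar> \<le> 2 * B * r" if "\<bar>p - q\<bar> \<le> r" "\<bar>p\<bar> \<le> B" "\<bar>q\<bar> \<le> B" for p q
  proof -
    have "\<bar>p\<^sup>2 - q\<^sup>2\<bar> = \<bar>p + q\<bar> * \<bar>p - q\<bar>"
      by (simp add: abs_mult[symmetric] power2_eq_square algebra_simps)
    also have "\<dots> \<le> 2 * B * r" using that by (intro mult_mono) auto
    finally show ?thesis .
  qed
  have "\<bar>\<alpha>\<bar> \<le> B" "\<bar>Re z\<bar> \<le> B" using mean[of y' B] mean[of y B] B \<alpha> z(1) by auto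
  then have 2: "\<bar>\<alpha>\<^sup>2 - (Re z)\<^sup>2\<bar> \<le> 2 * B * r" using sq 1 by blast
  have "\<bar>(\<Sum>s<k. w s * ((y' s)\<^sup>2 - (y s)\<^sup>2))\<bar> \<le> 2 * B * r"
    using r B by (intro mean sq) auto
  then have 3: "\<bar>(\<Sum>s<k. w s * (y' s)\<^sup>2) - ((Re z)\<^sup>2 + (Im z)\<^sup>2)\<bar> \<le> 2 * B * r"
    by (simp add: z(2)[symmetric] right_diff_distrib sum_subtractf)
  have v0: "v \<ge> 0" using variance_nonneg[OF w, of y'] by (simp add: v \<alpha>)
  have vI: "\<bar>v - (Im z)\<^sup>2\<bar> \<le> 4 * B * r" using 2 3 unfolding v by linarith
  have "\<bar>sqrt v - \<bar>Im z\<bar>\<bar> \<le> sqrt \<bar>v - (Im z)\<^sup>2\<bar>"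
    using abs_sqrt_diff_le[OF v0, of "(Im z)\<^sup>2"] by simp
  also have "\<dots> \<le> sqrt (4 * B * r)" using vI by (rule real_sqrt_le_mono)
  finally have 4: "\<bar>sqrt v - \<bar>Im z\<bar>\<bar> \<le> sqrt (4 * B * r)" .
  have "norm (Complex \<alpha> (\<sigma> * sqrt v) - Complex (Re z) (\<sigma> * \<bar>Im z\<bar>)) \<le>
    \<bar>\<alpha> - Re z\<bar> + \<bar>\<sigma> * sqrt v - \<sigma> * \<bar>Im z\<bar>\<bar>"
    using cmod_le[of "Complex \<alpha> (\<sigma> * sqrt v) - Complex (Re z) (\<sigma> * \<bar>Im z\<bar>)"] by simp
  also have "\<bar>\<sigma> * sqrt v - \<sigma> * \<bar>Im z\<bar>\<bar> = \<bar>sqrt v - \<bar>Im z\<bar>\<bar>"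
    using \<sigma> by auto
  finally show ?thesis using 1 4 by linarith
qed

section \<open>Invertibility of operators bounded from below\<close>

text \<open>\<open>G\<close> is normal, so its adjoint \<open>H\<close> has the same lower bound and
  G H is coercive. Surjectivity follows from Banach's fixed point theorem, as in the proof of the
  Lax-Milgram theorem.\<close>

lemma bounded_below_invertible:
  fixes T :: "'a::complex_hilbert \<Rightarrow> 'a"
  assumes T: "adj_pair T T" and B: "\<And>x. norm (T x) \<le> B * norm x" and \<delta>: "\<delta> > 0"
    and low: "\<And>x. \<delta> * norm x \<le> norm (T x - \<mu> *\<^sub>C x)"
  shows "\<mu> \<notin> spectrum T"
proof -
  note lin = adj_pair_clin[OF T]
  define G where "G x = T x - \<mu> *\<^sub>C x" for x
  define H where "H x = T x - cnj \<mu> *\<^sub>C x" for x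
  have GH: "adj_pair G H" and HG: "adj_pair H G"
    using adj_pairD[OF T] by (simp_all add: adj_pair_def G_def H_def cinner_simps)
  note linG = adj_pair_clin[OF GH] and linH = adj_pair_clin[OF HG]
  \<comment> \<open>The summand \<delta> ensures \<delta> \<le> K, so that
    \<open>1 - \<delta> ^ 4 / K ^ 4\<close> is nonnegative below.\<close>
  define K where "K = \<bar>B\<bar> + norm \<mu> + \<delta> + 1"
  have K: "K > 0" using \<delta> by (simp add: K_def add_pos_nonneg add_nonneg_pos)
  have BK: "norm (T x) \<le> \<bar>B\<bar> * norm x" for x
    using B[of x] by (rule order.trans) (intro mult_right_mono, auto)
  have K1: "\<bar>B\<bar> * norm x + norm \<mu> * norm x \<le> K * norm x" for x :: 'a
    using \<delta> unfolding K_def by (simp add: distrib_right)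
  have nG: "norm (G x) \<le> K * norm x" for x
    using norm_triangle_ineq4[of "T x" "\<mu> *\<^sub>C x"] BK[of x] K1[of x] by (simp add: G_def norm_scaleC)
  have nH: "norm (H x) \<le> K * norm x" for x
    using norm_triangle_ineq4[of "T x" "cnj \<mu> *\<^sub>C x"] BK[of x] K1[of x] by (simp add: H_def norm_scaleC)
  have lowG: "\<delta> * norm x \<le> norm (G x)" for x using low by (simp add: G_def)
  have "(norm (H x))\<^sup>2 = (norm (G x))\<^sup>2" for x
  proof -
    have "Im (cinner (T x) x) = 0"
      using adj_pairD[OF T, of x x] cinner_commute[of "T x" x] by (simp add: complex_eq_iff)
    then have "Re (cinner (T x) (- (cnj \<mu> *\<^sub>C x))) = Re (cinner (T x) (- (\<mu> *\<^sub>C x)))"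
      by (simp add: cinner_simps)
    then show ?thesis
      using norm_add_sq[of "T x" "- (cnj \<mu> *\<^sub>C x)"] norm_add_sq[of "T x" "- (\<mu> *\<^sub>C x)"]
      by (simp add: H_def G_def norm_scaleC)
  qed
  then have lowH: "\<delta> * norm x \<le> norm (H x)" for x
    using lowG[of x] by (simp add: power2_eq_iff_nonneg)
  define C where "C x = G (H x)" for x
  have linC: "clin C" using linG linH by (simp add: clin_def C_def)
  have nC: "norm (C x) \<le> K\<^sup>2 * norm x" for x
    using order.trans[OF nG[of "H x"] mult_left_mono[OF nH[of x], of K]] K
    by (simp add: C_def power2_eq_square mult.assoc)
  have posC: "\<delta>\<^sup>2 * (norm x)\<^sup>2 \<le> Re (cinner (C x) x)" for x
    using power_mono[OF lowH[of x], of 2] \<delta>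
    by (simp add: C_def adj_pairD[OF GH] norm_sq_eq_Re_cinner[symmetric] power_mult_distrib)
  have "\<exists>x. G x = y" for y
  proof -
    \<comment> \<open>This step length minimises 1 - 2 \<rho> \<delta>^2 + \<rho>^2 K^4; the minimum
      is the square of the contraction constant \<open>c\<close>.\<close>
    define \<rho> where "\<rho> = \<delta>\<^sup>2 / K ^ 4"
    have \<rho>: "\<rho> > 0" using \<delta> K by (simp add: \<rho>_def)
    define c where "c = sqrt (1 - \<delta> ^ 4 / K ^ 4)"
    have "\<delta> ^ 4 \<le> K ^ 4" using \<delta> by (intro power_mono) (auto simp: K_def)
    then have c: "0 \<le> c" "c < 1" "c\<^sup>2 = 1 - \<delta> ^ 4 / K ^ 4"
      using \<delta> K by (simp_all add: c_def)
    define h where "h x = x - \<rho> *\<^sub>R (C x - y)" for x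
    have "dist (h x) (h x') \<le> c * dist x x'" for x x'
    proof -
      define d where "d = x - x'"
      have "h x - h x' = d + - (\<rho> *\<^sub>R C d)"
        by (simp add: h_def d_def clin_diff[OF linC] algebra_simps)
      then have "(norm (h x - h x'))\<^sup>2 = (norm d)\<^sup>2 - 2 * \<rho> * Re (cinner (C d) d) + \<rho>\<^sup>2 * (norm (C d))\<^sup>2"
        using \<rho> Re_cinner_commute[of d "C d"]
        by (simp only: norm_add_sq) (simp add: cinner_simps scaleR_cinner_right power_mult_distrib)
      also have "\<dots> \<le> (norm d)\<^sup>2 - 2 * \<rho> * (\<delta>\<^sup>2 * (norm d)\<^sup>2) + \<rho>\<^sup>2 * (K\<^sup>2 * norm d)\<^sup>2"
        using \<rho> posC[of d] nC[of d] by (intro add_mono diff_mono mult_left_mono power_mono) auto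
      also have "\<dots> = c\<^sup>2 * (norm d)\<^sup>2"
        unfolding c(3) \<rho>_def using K by (simp add: field_simps power2_eq_square eval_nat_numeral)
      also have "\<dots> = (c * norm d)\<^sup>2" by (simp add: power_mult_distrib)
      finally have "norm (h x - h x') \<le> c * norm d"
        using c(1) by (rule power2_le_imp_le[OF _ mult_nonneg_nonneg]) auto
      then show ?thesis by (simp add: dist_norm d_def)
    qed
    then obtain x where "h x = x" using banach_fix_type[OF c(1,2), of h] by blast
    then have "C x = y" using \<rho> by (simp add: h_def)
    then show ?thesis by (auto simp: C_def)
  qed
  then obtain S where S: "\<And>y. G (S y) = y" by metis
  have inj: "x = x'" if "G x = G x'" for x x'
  proof -
    have "\<delta> * norm (x - x') \<le> 0" using lowG[of "x - x'"] that by (simp add: clin_diff[OF linG])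
    then show ?thesis using \<delta> by (simp add: mult_le_0_iff)
  qed
  have SG: "S (G x) = x" for x by (rule inj) (simp add: S)
  have "clin S"
    unfolding clin_def
  proof (intro conjI allI)
    show "S (x + y) = S x + S y" for x y by (rule inj) (simp add: S clin_add[OF linG])
    show "S (d *\<^sub>C x) = d *\<^sub>C S x" for d x by (rule inj) (simp add: S clin_scaleC[OF linG])
  qed
  moreover have "norm (S y) \<le> (1 / \<delta>) * norm y" for y
    using lowG[of "S y"] \<delta> by (simp add: S field_simps)
  ultimately have "bounded_clinear S" by (rule clin_bounded_clinear)
  then show ?thesis
    unfolding spectrum_def using S SG by (auto simp: G_def)
qed

lemma approximate_eigenvalue_in_spectrum:
  fixes T :: "'a::complex_inner \<Rightarrow> 'a"
  assumes "\<And>\<epsilon>. \<epsilon> > 0 \<Longrightarrow> \<exists>v. norm v = 1 \<and> norm (T v - \<mu> *\<^sub>C v) < \<epsilon>"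
  shows "\<mu> \<in> spectrum T"
proof (rule ccontr)
  assume "\<mu> \<notin> spectrum T"
  then obtain S where S: "bounded_clinear S" "\<And>x. S (T x - \<mu> *\<^sub>C x) = x"
    unfolding spectrum_def by auto
  from S(1) obtain K where K: "K > 0" "\<And>x. norm (S x) \<le> norm x * K"
    unfolding bounded_clinear_def using bounded_linear.pos_bounded by blast
  obtain v where v: "norm v = 1" "norm (T v - \<mu> *\<^sub>C v) < 1 / K"
    using assms[of "1 / K"] K(1) by auto
  have "1 \<le> norm (T v - \<mu> *\<^sub>C v) * K" using K(2)[of "T v - \<mu> *\<^sub>C v"] S(2)[of v] v(1) by simp
  then show False using v(2) K(1) by (simp add: field_simps)
qed

lemma cproj_minimal:
  assumes L: "cfinite_dim L" and z: "z \<in> L"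
  shows "norm (x - cproj L x) \<le> norm (x - z)"
proof -
  obtain w :: "nat \<Rightarrow> 'a" and d where w: "orthonormal_on w {..<d}" "cspan (w ` {..<d}) = L"
    using finite_dim_orthonormal_basis[OF L] .
  show ?thesis
    using oproj_minimal[OF w(1) finite_lessThan, of z x] cproj_eq_oproj[OF w(1) finite_lessThan, of x] z
    by (simp add: w(2))
qed

section \<open>One stage of the construction\<close>

text \<open>All that the construction uses about the intervals and \<open>F\<close>. The region
  appears only through \<open>atoms\<close>, where \<open>c s\<close> names an interval containing
  the atom \<open>y s\<close>.\<close>

locale construction = coloured_basis e n for e :: "nat \<times> nat \<Rightarrow> 'a::complex_hilbert" and n +
  fixes a b f :: "nat \<Rightarrow> real" and F :: "complex set" and B :: real
  assumes ab: "\<And>j. j < n \<Longrightarrow> a j < f j \<and> f j < b j"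
    and bnd: "\<And>j. j < n \<Longrightarrow> \<bar>a j\<bar> \<le> B \<and> \<bar>b j\<bar> \<le> B" and B0: "B \<ge> 0"
    and fF: "\<And>j. j < n \<Longrightarrow> complex_of_real (f j) \<in> F"
    and compF: "compact F" and symF: "\<And>z. z \<in> F \<Longrightarrow> cnj z \<in> F"
    and atoms: "\<And>z. z \<in> F \<Longrightarrow> \<exists>w y c. (\<forall>s<4. (0::real) \<le> w s \<and> c s < n \<and> a (c s) \<le> y s \<and> y s \<le> b (c s)) \<and>
      (\<Sum>s<4. w s) = 1 \<and> (\<Sum>s<4::nat. w s * y s) = Re z \<and> (\<Sum>s<4. w s * (y s)\<^sup>2) = (Re z)\<^sup>2 + (Im z)\<^sup>2"
begin

text \<open>The margin \<open>r\<close> is the reserve from which later absorptions are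
  paid.\<close>

definition model :: "real \<Rightarrow> nat \<Rightarrow> ('a \<Rightarrow> 'a) \<Rightarrow> bool" where
  "model r = coloured_model (\<lambda>j. a j + r) (\<lambda>j. b j - r)"

lemma coloured_model_mono:
  assumes T: "coloured_model lo up m T" and le: "\<And>j. j < n \<Longrightarrow> lo' j \<le> lo j \<and> up j \<le> up' j"
  shows "coloured_model lo' up' m T"
proof -
  note T' = coloured_modelD[OF T]
  have "lo' j * (norm x)\<^sup>2 \<le> Re (cinner (T x) x) \<and> Re (cinner (T x) x) \<le> up' j * (norm x)\<^sup>2"
    if "j < n" "x \<in> E m" "col j x" for j x
    using T'(4)[OF that(1,3,2)] T'(5)[OF that(1,3,2)]
      mult_right_mono[of "lo' j" "lo j" "(norm x)\<^sup>2"] mult_right_mono[of "up j" "up' j" "(norm x)\<^sup>2"] le[OF that(1)]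
    by auto
  then show ?thesis using T'(1-3) by (auto simp: coloured_model_def)
qed

lemma stage:
  assumes T: "model r m T" and r: "\<And>j. j < n \<Longrightarrow> a j + r < f j \<and> f j < b j - r"
    and r': "0 < r'" "r' < r" and \<xi>: "\<xi> > 0"
  shows "\<exists>m' T' L. m < m' \<and> model r' m' T' \<and> E m \<subseteq> L \<and> L \<subseteq> E m' \<and> csubspace L \<and> cfinite_dim L \<and>
    (\<forall>x\<in>E m. norm (T' x - T x) \<le> \<xi> * norm x) \<and>
    (\<forall>\<mu>\<in>spectrum2 T' L. \<exists>z\<in>F. norm (\<mu> - z) \<le> \<xi> + (r' + sqrt (4 * B * r'))) \<and>
    (\<forall>z\<in>F. \<exists>\<mu>\<in>spectrum2 T' L. norm (z - \<mu>) \<le> \<xi> + (r' + sqrt (4 * B * r'))) \<and>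
    (\<forall>j<n. \<forall>t\<in>{a j..b j}. \<exists>v\<in>E m'. norm v = 1 \<and> norm (T' v - t *\<^sub>R v) \<le> \<xi> + r')"
proof -
  define \<delta> where "\<delta> = r' + sqrt (4 * B * r')"
  have \<delta>0: "\<delta> \<ge> 0" using r' B0 by (simp add: \<delta>_def)
  \<comment> \<open>Absorption may widen the form bounds by no more than the margin
    \<open>r - r'\<close> given up in this stage.\<close>
  have pos: "min \<xi> (r - r') > 0" using \<xi> r' by simp
  obtain M T1 where M: "m \<le> M"
    and T1a: "coloured_model (\<lambda>j. a j + r - min \<xi> (r - r')) (\<lambda>j. b j - r + min \<xi> (r - r')) (2 * M) T1"
    and close: "\<And>x. x \<in> E m \<Longrightarrow> norm (T1 x - T x) \<le> min \<xi> (r - r') * norm x"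
    and spec1: "\<And>\<mu>. \<mu> \<in> spectrum2 T1 (E M) \<Longrightarrow> \<exists>j<n. norm (\<mu> - of_real (f j)) \<le> min \<xi> (r - r')"
    using absorption[where f = f, OF T[unfolded model_def] r pos] by blast
  have T1: "coloured_model (\<lambda>j. a j + r') (\<lambda>j. b j - r') (2 * M) T1"
    by (rule coloured_model_mono[OF T1a]) auto
  define m1 where "m1 = 2 * M"
  have EM: "E M \<subseteq> E m1" unfolding m1_def by (rule E_mono) simp
  obtain Z where Z: "finite Z" "Z \<subseteq> F" "F \<subseteq> (\<Union>z\<in>Z. ball z \<xi>)"
    by (rule compactE_image[OF compF, of F "\<lambda>z. ball z \<xi>"]) (use \<xi> in auto)
  obtain p :: nat and z where zp: "Z = z ` {..<p}"
    using finite_imp_nat_seg_image_inj_on[OF Z(1)] by (auto simp: lessThan_def)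
  have zF: "z i \<in> F" if "i < p" for i using that zp Z(2) by auto
  define At where "At x w y c \<longleftrightarrow> (\<forall>s<4. (0::real) \<le> w s \<and> c s < n \<and> a (c s) \<le> y s \<and> y s \<le> b (c s)) \<and>
      (\<Sum>s<4. w s) = 1 \<and> (\<Sum>s<4::nat. w s * y s) = Re x \<and> (\<Sum>s<4. w s * (y s)\<^sup>2) = (Re x)\<^sup>2 + (Im x)\<^sup>2"
    for x w y c
  have "\<exists>w y c. At (z i) w y c" if "i < p" for i
    using atoms[OF zF[OF that]] unfolding At_def .
  then obtain w y c where At: "\<And>i. i < p \<Longrightarrow> At (z i) (w i) (y i) (c i)"
    by metis
  have at: "\<And>i s. i < p \<Longrightarrow> s < 4 \<Longrightarrow> (0::real) \<le> w i s \<and> c i s < n \<and> a (c i s) \<le> y i s \<and> y i s \<le> b (c i s)"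
    and w1: "\<And>i. i < p \<Longrightarrow> (\<Sum>s<4. w i s) = 1" and mean: "\<And>i. i < p \<Longrightarrow> (\<Sum>s<4::nat. w i s * y i s) = Re (z i)"
    and var: "\<And>i. i < p \<Longrightarrow> (\<Sum>s<4. w i s * (y i s)\<^sup>2) = (Re (z i))\<^sup>2 + (Im (z i))\<^sup>2"
    using At unfolding At_def by blast+
  \<comment> \<open>Clamps atoms to the shrunken interval, where the form of the new operator has to
    stay.\<close>
  define cl where "cl j t = max (a j + r') (min (b j - r') t)" for j t
  have rr: "a j + r' < b j - r'" if "j < n" for j using r[OF that] r' by linarith
  have cl: "a j + r' \<le> cl j t \<and> cl j t \<le> b j - r'" "t \<in> {a j..b j} \<Longrightarrow> \<bar>cl j t - t\<bar> \<le> r'" if "j < n" for j t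
    using rr[OF that] r' by (auto simp: cl_def max_def min_def)
  \<comment> \<open>A grid of \<open>g\<close> steps on an interval of length at most 2 B has mesh
    below \<xi>.\<close>
  obtain g :: nat where g: "2 * B / \<xi> < real g" using reals_Archimedean2 by blast
  have "0 \<le> 2 * B / \<xi>" using B0 \<xi> by simp
  then have g0: "real g > 0" using g by linarith
  \<comment> \<open>Counted from \<open>m1\<close>, index \<open>4 * i + s\<close> carries the
    \<open>s\<close>-th atom of the net point \<open>z i\<close> in the colour of that atom, with
    the filler \<open>f j\<close> in the other colours. The next \<open>g + 1\<close> indices run
    through a grid of the shrunken interval, which makes every point of the interval an approximate
    eigenvalue. \<open>min 1\<close> keeps the values in range for all \<open>q\<close>.\<close>
  define \<nu> where "\<nu> j q = (if q - m1 < 4 * p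
     then if c ((q - m1) div 4) ((q - m1) mod 4) = j then cl j (y ((q - m1) div 4) ((q - m1) mod 4)) else f j
     else a j + r' + (b j - a j - 2 * r') * min 1 (real (q - m1 - 4 * p) / real g))" for j q
  have \<nu>: "a j + r' \<le> \<nu> j q \<and> \<nu> j q \<le> b j - r'" if j: "j < n" for j q
  proof (cases "q - m1 < 4 * p")
    case True
    then show ?thesis using cl(1)[OF j] r[OF j] r' by (auto simp: \<nu>_def)
  next
    case False
    define h where "h = min 1 (real (q - m1 - 4 * p) / real g)"
    have h: "0 \<le> h" "h \<le> 1" by (auto simp: h_def)
    have "0 \<le> (b j - a j - 2 * r') * h" using h rr[OF j] by (intro mult_nonneg_nonneg) auto
    moreover have "(b j - a j - 2 * r') * h \<le> (b j - a j - 2 * r') * 1"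
      using h rr[OF j] by (intro mult_left_mono) auto
    moreover have "\<nu> j q = a j + r' + (b j - a j - 2 * r') * h"
      using False by (simp only: \<nu>_def h_def if_False)
    ultimately show ?thesis by simp
  qed
  define k where "k = 4 * p + g + 1"
  define T2 where "T2 x = T1 x + nodes m1 k \<nu> x" for x
  have T2: "coloured_model (\<lambda>j. a j + r') (\<lambda>j. b j - r') (m1 + k) T2"
    unfolding T2_def[abs_def] using add_nodes(1)[OF T1[folded m1_def], of k \<nu>] \<nu> by blast
  have T2E: "T2 x = T1 x" if "x \<in> E m1" for x
    unfolding T2_def using add_nodes(2)[OF T1[folded m1_def], of k \<nu>] \<nu> that by blast
  have T2e: "T2 (e (j, i)) = \<nu> j i *\<^sub>R e (j, i)" if "j < n" "m1 \<le> i" "i < m1 + k" for j i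
    unfolding T2_def using add_nodes(3)[OF T1[folded m1_def], of k \<nu>] \<nu> that by blast
  note T1D = coloured_modelD[OF T1[folded m1_def]] and T2D = coloured_modelD[OF T2]
  note lin2 = adj_pair_clin[OF T2D(1)]
  \<comment> \<open>Vectors on the four nodes of \<open>z i\<close>. \<open>T2\<close> acts on them
    by multiplying the coefficients with the clamped atoms, so all inner products reduce to
    \<open>UU\<close>.\<close>
  define U where "U h i = (\<Sum>s<4. complex_of_real (h s) *\<^sub>C e (c i s, m1 + 4 * i + s))" for h i
  have UU: "cinner (U h i) (U h' i') = (if i = i' then of_real (\<Sum>s<4. h s * h' s) else 0)" if "i < p" "i' < p" for h h' i i'
  proof -
    have idx: "m1 + 4 * i + s = m1 + 4 * i' + s' \<longleftrightarrow> i = i' \<and> s = s'" if "s < 4" "s' < 4" for s s' :: nat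
    proof -
      have "i = i' \<and> s = s'" if "4 * i + s = 4 * i' + s'"
        using arg_cong[OF that, of "\<lambda>x. x div 4"] arg_cong[OF that, of "\<lambda>x. x mod 4"]
          \<open>s < 4\<close> \<open>s' < 4\<close> by simp
      then show ?thesis by auto
    qed
    have "cinner (U h i) (U h' i') = (\<Sum>s<4. \<Sum>s'<4. if i = i' \<and> s = s' then of_real (h s * h' s) else 0)"
      unfolding U_def
      unfolding cinner_sum_left
      unfolding cinner_sum_right
    proof (intro sum.cong[OF refl])
      fix s s' :: nat assume s: "s \<in> {..<4}" "s' \<in> {..<4}"
      then have "c i s < n" "c i' s' < n" using at that by auto
      then show "cinner (complex_of_real (h s) *\<^sub>C e (c i s, m1 + 4 * i + s))
          (complex_of_real (h' s') *\<^sub>C e (c i' s', m1 + 4 * i' + s')) =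
        (if i = i' \<and> s = s' then of_real (h s * h' s) else 0)"
        using idx[of s s'] s by (auto simp: cinner_simps ee)
    qed
    also have "\<dots> = (if i = i' then of_real (\<Sum>s<4. h s * h' s) else 0)"
    proof (cases "i = i'")
      case True
      then show ?thesis by (simp add: sum.delta del: of_real_mult)
    qed simp
    finally show ?thesis .
  qed
  have EU: "cinner x (U h i) = 0" if "x \<in> E m1" "i < p" for x h i
    unfolding U_def cinner_sum_right cinner_scaleC_right
  proof (rule sum.neutral, intro ballI)
    fix s :: nat assume "s \<in> {..<4}"
    then have "c i s < n" using at that by auto
    then show "cnj (complex_of_real (h s)) * cinner x (e (c i s, m1 + 4 * i + s)) = 0"
      using cinner_E_eq_0[OF that(1)] by simp
  qed
  have ckp: "4 * i + s < 4 * p" if "i < p" "s < 4" for i s using that by simp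
  have TU: "T2 (U h i) = U (\<lambda>s. h s * cl (c i s) (y i s)) i" if i: "i < p" for h i
    unfolding U_def clin_sum[OF lin2] clin_scaleC[OF lin2]
  proof (rule sum.cong[OF refl])
    fix s :: nat assume s: "s \<in> {..<4}"
    have q: "m1 + 4 * i + s - m1 = 4 * i + s" "(4 * i + s) div 4 = i" "(4 * i + s) mod 4 = s" using s by auto
    have "\<nu> (c i s) (m1 + 4 * i + s) = cl (c i s) (y i s)"
      using ckp[OF i, of s] s unfolding \<nu>_def q by simp
    moreover have "m1 + 4 * i + s < m1 + k" using ckp[OF i, of s] s by (simp add: k_def)
    ultimately show "complex_of_real (h s) *\<^sub>C T2 (e (c i s, m1 + 4 * i + s)) =
      complex_of_real (h s * cl (c i s) (y i s)) *\<^sub>C e (c i s, m1 + 4 * i + s)"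
      using T2e[of "c i s" "m1 + 4 * i + s"] at[OF i, of s] s by (simp add: scaleR_scaleC scaleC_scaleC)
  qed
  \<comment> \<open>Square roots of the weights as coefficients make the clamped atoms with weights
    \<open>w i s\<close> the spectral measure of this unit vector.\<close>
  define u where "u i = U (\<lambda>s. sqrt (w i s)) i" for i
  define \<alpha> where "\<alpha> i = (\<Sum>s<4. w i s * cl (c i s) (y i s))" for i
  define \<beta> where "\<beta> i = (\<Sum>s<4. w i s * (cl (c i s) (y i s))\<^sup>2)" for i
  define v where "v i = \<beta> i - (\<alpha> i)\<^sup>2" for i
  have v0: "v i \<ge> 0" if "i < p" for i
    using variance_nonneg[of 4 "w i" "\<lambda>s. cl (c i s) (y i s)"] at[OF that] w1[OF that]
    by (simp add: v_def \<alpha>_def \<beta>_def)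
  have ww: "sqrt (w i s) * sqrt (w i s) = w i s" if "i < p" "s < 4" for i s using at[OF that] by simp
  have ou: "orthonormal_on u {..<p}"
    using w1 by (auto simp: orthonormal_on_def u_def UU ww simp del: real_sqrt_mult_self)
  have au: "cinner (T2 (u i)) (u i') = (if i = i' then of_real (\<alpha> i) else 0)" if "i < p" "i' < p" for i i'
  proof -
    have "(\<Sum>s<4. sqrt (w i s) * cl (c i s) (y i s) * sqrt (w i s)) = \<alpha> i"
      unfolding \<alpha>_def by (rule sum.cong) (use ww[OF that(1)] in \<open>auto simp: mult_ac\<close>)
    then show ?thesis using that by (auto simp: u_def TU UU simp del: of_real_sum)
  qed
  have bu: "cinner (T2 (u i)) (T2 (u i')) = (if i = i' then of_real (\<beta> i) else 0)" if "i < p" "i' < p" for i i'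
  proof -
    have "(\<Sum>s<4. sqrt (w i s) * cl (c i s) (y i s) * (sqrt (w i s) * cl (c i s) (y i s))) = \<beta> i"
      unfolding \<beta>_def by (rule sum.cong) (use ww[OF that(1)] in \<open>auto simp: mult_ac power2_eq_square\<close>)
    then show ?thesis using that by (auto simp: u_def TU UU simp del: of_real_sum)
  qed
  define Bs where "Bs = e ` ({..<n} \<times> {..<M})"
  have EB: "cspan Bs = E M" by (simp add: Bs_def E_def)
  \<comment> \<open>Only \<open>E M\<close> and the vectors \<open>u i\<close> enter. The rest of
    \<open>E m1\<close> would undo the absorption, and the grid vectors would add their own real
    eigenvalues.\<close>
  define L where "L = cspan (Bs \<union> u ` {..<p})"
  have E0: "x \<in> E m1 \<and> T2 x \<in> E m1" if "x \<in> cspan Bs" for x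
    using that EM T2E[of x] T1D(2)[of x] by (auto simp: EB)
  have prem: "finite Bs" "\<And>x r. x \<in> cspan Bs \<Longrightarrow> r < p \<Longrightarrow> cinner x (u r) = 0"
      "\<And>x r. x \<in> cspan Bs \<Longrightarrow> r < p \<Longrightarrow> cinner (T2 x) (u r) = 0"
      "\<And>x r. x \<in> cspan Bs \<Longrightarrow> r < p \<Longrightarrow> cinner (T2 x) (T2 (u r)) = 0"
    using E0 by (auto simp: Bs_def u_def EU TU)
  have ds1: "\<mu> \<in> spectrum2 T2 (cspan Bs) \<or> (\<exists>i<p. \<mu>\<^sup>2 - 2 * \<mu> * \<alpha> i + \<beta> i = 0)"
    if \<mu>: "\<mu> \<in> spectrum2 T2 L" for \<mu>
    by (rule spectrum2_direct_sum(1)[where p = p, OF T2D(1) prem ou au bu \<mu>[unfolded L_def]])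
  have ds2: "\<mu> \<in> spectrum2 T2 L" if \<mu>: "i < p" "\<mu>\<^sup>2 - 2 * \<mu> * \<alpha> i + \<beta> i = 0" for i and \<mu> :: complex
    unfolding L_def by (rule spectrum2_direct_sum(2)[where p = p, OF T2D(1) prem ou au bu \<mu>])
  have \<beta>v: "\<beta> i = (\<alpha> i)\<^sup>2 + v i" for i by (simp add: v_def)
  have root: "\<mu>\<^sup>2 - 2 * \<mu> * \<alpha> i + \<beta> i = 0 \<longleftrightarrow> \<mu> = Complex (\<alpha> i) (sqrt (v i)) \<or> \<mu> = Complex (\<alpha> i) (- sqrt (v i))"
    if "i < p" for i and \<mu> :: complex
    using quadratic_roots[OF v0[OF that], of \<mu> "\<alpha> i"] by (simp add: \<beta>v)
  have sub: "\<mu> \<in> spectrum2 T2 L \<Longrightarrow> \<mu> \<in> spectrum2 T2 (E M) \<or>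
      (\<exists>i<p. \<mu> = Complex (\<alpha> i) (sqrt (v i)) \<or> \<mu> = Complex (\<alpha> i) (- sqrt (v i)))" for \<mu>
    using ds1[of \<mu>] root by (auto simp: EB)
  have sup: "Complex (\<alpha> i) (sqrt (v i)) \<in> spectrum2 T2 L" "Complex (\<alpha> i) (- sqrt (v i)) \<in> spectrum2 T2 L" if "i < p" for i
    using ds2[OF that] root[OF that] by blast+
  \<comment> \<open>\<open>T1\<close> maps \<open>E M\<close> into \<open>E m1\<close>, where
    \<open>T1\<close> and \<open>T2\<close> agree.\<close>
  have s12: "spectrum2 T2 (E M) = spectrum2 T1 (E M)"
  proof (rule Set.set_eqI)
    fix \<mu>
    have "T2 x = T1 x \<and> T2 (T1 x) = T1 (T1 x)" if "x \<in> E M" for x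
      using that EM T2E T1D(2) by blast
    then show "\<mu> \<in> spectrum2 T2 (E M) \<longleftrightarrow> \<mu> \<in> spectrum2 T1 (E M)"
      unfolding spectrum2_iff[OF lin2 E_finite_dim E_subspace]
        spectrum2_iff[OF adj_pair_clin[OF T1D(1)] E_finite_dim E_subspace]
      by (intro bex_cong refl) auto
  qed
  have near: "norm (Complex (\<alpha> i) (\<sigma> * sqrt (v i)) - Complex (Re (z i)) (\<sigma> * \<bar>Im (z i)\<bar>)) \<le> \<delta>"
    if i: "i < p" and \<sigma>: "\<sigma> = 1 \<or> \<sigma> = - 1" for i \<sigma>
    unfolding \<delta>_def
  proof (rule perturbed_mean_variance[of 4 "w i" "\<lambda>s. cl (c i s) (y i s)" "y i"])
    show "\<bar>cl (c i s) (y i s) - y i s\<bar> \<le> r'" if "s < 4" for s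
      using cl(2)[of "c i s" "y i s"] at[OF i that] by auto
    show "\<bar>y i s\<bar> \<le> B \<and> \<bar>cl (c i s) (y i s)\<bar> \<le> B" if "s < 4" for s
      using cl(1)[of "c i s" "y i s"] at[OF i that] bnd[of "c i s"] r' by (auto simp: abs_le_iff)
  qed (use at[OF i] w1[OF i] mean[OF i] var[OF i] \<sigma> in \<open>auto simp: \<alpha>_def v_def \<beta>_def\<close>)
  \<comment> \<open>The roots near \<open>z i\<close> and its conjugate always come in pairs; by
    symmetry \<open>F\<close> contains both limits.\<close>
  have refl: "Complex (Re x) (\<sigma> * \<bar>Im x\<bar>) \<in> F" if "x \<in> F" "\<sigma> = 1 \<or> \<sigma> = - 1" for x \<sigma>
  proof -
    have "Complex (Re x) (\<sigma> * \<bar>Im x\<bar>) = x \<or> Complex (Re x) (\<sigma> * \<bar>Im x\<bar>) = cnj x"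
      using that(2) by (auto simp: complex_eq_iff)
    then show ?thesis using that(1) symF[OF that(1)] by metis
  qed
  have S1: "\<exists>x\<in>F. norm (\<mu> - x) \<le> \<xi> + \<delta>" if "\<mu> \<in> spectrum2 T2 L" for \<mu>
    using sub[OF that]
  proof (elim disjE exE conjE)
    assume "\<mu> \<in> spectrum2 T2 (E M)"
    then obtain j where j: "j < n" "norm (\<mu> - of_real (f j)) \<le> min \<xi> (r - r')" using spec1 s12 by auto
    then show ?thesis using fF[OF j(1)] \<delta>0 by (intro bexI[of _ "of_real (f j)"]) auto
  next
    fix i assume i: "i < p" "\<mu> = Complex (\<alpha> i) (sqrt (v i))"
    then show ?thesis using near[OF i(1), of 1] refl[OF zF[OF i(1)], of 1] \<xi> by (intro bexI[rotated]) auto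
  next
    fix i assume i: "i < p" "\<mu> = Complex (\<alpha> i) (- sqrt (v i))"
    then show ?thesis using near[OF i(1), of "-1"] refl[OF zF[OF i(1)], of "-1"] \<xi> by (intro bexI[rotated]) auto
  qed
  have S2: "\<exists>\<mu>\<in>spectrum2 T2 L. norm (x - \<mu>) \<le> \<xi> + \<delta>" if "x \<in> F" for x
  proof -
    from that Z(3) zp obtain i where i: "i < p" "norm (z i - x) < \<xi>" by (auto simp: dist_norm)
    define \<sigma> :: real where "\<sigma> = (if Im (z i) \<ge> 0 then 1 else - 1)"
    have \<sigma>: "\<sigma> = 1 \<or> \<sigma> = - 1" "Complex (Re (z i)) (\<sigma> * \<bar>Im (z i)\<bar>) = z i"
      by (auto simp: \<sigma>_def complex_eq_iff)
    have "norm (Complex (\<alpha> i) (\<sigma> * sqrt (v i)) - z i) \<le> \<delta>"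
      using near[OF i(1) \<sigma>(1)] \<sigma>(2) by simp
    then have "norm (x - Complex (\<alpha> i) (\<sigma> * sqrt (v i))) \<le> \<xi> + \<delta>"
      using i(2) norm_triangle_ineq[of "x - z i" "z i - Complex (\<alpha> i) (\<sigma> * sqrt (v i))"]
      by (simp add: norm_minus_commute)
    moreover have "Complex (\<alpha> i) (\<sigma> * sqrt (v i)) \<in> spectrum2 T2 L"
      using sup[OF i(1)] \<sigma>(1) by auto
    ultimately show ?thesis by blast
  qed
  have S3: "\<exists>v\<in>E (m1 + k). norm v = 1 \<and> norm (T2 v - t *\<^sub>R v) \<le> \<xi> + r'" if j: "j < n" and t: "t \<in> {a j..b j}" for j t
  proof -
    define l where "l = b j - a j - 2 * r'"
    have l: "l > 0" "l \<le> 2 * B" using rr[OF j] bnd[OF j] r' by (auto simp: l_def abs_le_iff)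
    define x where "x = (cl j t - (a j + r')) / l"
    have x: "0 \<le> x" "x \<le> 1" "cl j t = a j + r' + l * x"
      using cl(1)[OF j, of t] l by (auto simp: x_def l_def field_simps)
    \<comment> \<open>The grid point just below the clamped value; the mesh and the clamping
      contribute \<xi> and \<open>r'\<close> to the error.\<close>
    define i where "i = nat \<lfloor>x * g\<rfloor>"
    have ig: "real i \<le> x * g" "x * g < real i + 1" using x(1) g0 by (auto simp: i_def)
    have xg: "x * g \<le> g" using x(2) g0 by simp
    then have "i \<le> g" using ig(1) by linarith
    then have "\<nu> j (m1 + 4 * p + i) = a j + r' + l * (i / g)"
      using g0 by (simp add: \<nu>_def l_def min_def)
    then have "\<nu> j (m1 + 4 * p + i) - cl j t = l * (i / g - x)"
      unfolding x(3) right_diff_distrib by simp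
    then have "\<bar>\<nu> j (m1 + 4 * p + i) - cl j t\<bar> = l * \<bar>i / g - x\<bar>"
      using l(1) by (simp only: abs_mult abs_of_pos)
    also have "i / g - x = (i - x * g) / g" using g0 by (simp add: diff_divide_distrib)
    then have "\<bar>i / g - x\<bar> \<le> 1 / g"
      using ig g0 by (simp only: abs_divide abs_of_pos) (rule divide_right_mono, auto)
    then have "l * \<bar>i / g - x\<bar> \<le> 2 * B * (1 / g)" using l by (intro mult_mono) auto
    also have "\<dots> \<le> \<xi>" using g g0 \<xi> by (simp add: field_simps)
    finally have "\<bar>\<nu> j (m1 + 4 * p + i) - t\<bar> \<le> \<xi> + r'" using cl(2)[OF j t] by linarith
    moreover have "T2 (e (j, m1 + 4 * p + i)) - t *\<^sub>R e (j, m1 + 4 * p + i) =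
       (\<nu> j (m1 + 4 * p + i) - t) *\<^sub>R e (j, m1 + 4 * p + i)"
      using T2e[OF j, of "m1 + 4 * p + i"] \<open>i \<le> g\<close> by (simp add: k_def scaleR_diff_left)
    ultimately show ?thesis
      using \<open>i \<le> g\<close> j by (intro bexI[of _ "e (j, m1 + 4 * p + i)"] e_in_E) (auto simp: norm_e k_def)
  qed
  have "E m \<subseteq> L"
    using E_mono[OF M] complex_vector.span_mono[of Bs "Bs \<union> u ` {..<p}"] EB by (auto simp: L_def)
  moreover have "L \<subseteq> E (m1 + k)"
    unfolding L_def
  proof (rule complex_vector.span_minimal[OF _ E_subspace], intro Un_least subsetI)
    fix x assume "x \<in> Bs"
    then show "x \<in> E (m1 + k)" by (auto simp: Bs_def m1_def intro!: e_in_E)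
  next
    fix x assume "x \<in> u ` {..<p}"
    then obtain i where i: "i < p" "x = u i" by auto
    have "m1 + 4 * i + s < m1 + k" if "s < 4" for s
      using ckp[OF i(1) that] by (simp add: k_def)
    then show "x \<in> E (m1 + k)"
      unfolding i(2) u_def U_def
      using at[OF i(1)] by (intro E_sum E_scale e_in_E) auto
  qed
  moreover have "csubspace L"
    unfolding L_def by (rule complex_vector.subspace_span)
  moreover have "cfinite_dim L"
    unfolding L_def cfinite_dim_def using prem(1) by (intro exI[of _ "Bs \<union> u ` {..<p}"]) simp
  moreover have "norm (T2 x - T x) \<le> \<xi> * norm x" if "x \<in> E m" for x
  proof -
    have "T2 x = T1 x" using that E_mono[OF M] EM by (intro T2E) auto
    moreover have "min \<xi> (r - r') * norm x \<le> \<xi> * norm x" by (intro mult_right_mono) auto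
    ultimately show ?thesis using close[OF that] by simp
  qed
  moreover have "m < m1 + k" using M by (simp add: m1_def k_def)
  ultimately show ?thesis
    using T2 S1 S2 S3 unfolding model_def \<delta>_def[symmetric]
    by (intro exI[of _ "m1 + k"] exI[of _ T2] exI[of _ L]) auto
qed

end

section \<open>The limit operator\<close>

lemma hausdorff_distance_le:
  assumes "\<And>x. x \<in> A \<Longrightarrow> \<exists>y\<in>G. norm (x - y) \<le> \<kappa>" "\<And>y. y \<in> G \<Longrightarrow> \<exists>x\<in>A. norm (y - x) \<le> \<kappa>"
  shows "hausdorff_distance A G \<le> ennreal \<kappa>"
  unfolding hausdorff_distance_def
proof (intro max.boundedI SUP_least)
  fix x assume "x \<in> A"
  then obtain y where "y \<in> G" "norm (x - y) \<le> \<kappa>" using assms(1) by blast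
  then show "(INF y\<in>G. ennreal (norm (x - y))) \<le> ennreal \<kappa>"
    by (intro INF_lower2[of y]) (auto intro: ennreal_leI)
next
  fix y assume "y \<in> G"
  then obtain x where "x \<in> A" "norm (y - x) \<le> \<kappa>" using assms(2) by blast
  then show "(INF x\<in>A. ennreal (norm (x - y))) \<le> ennreal \<kappa>"
    by (intro INF_lower2[of x]) (auto intro: ennreal_leI simp: norm_minus_commute)
qed

lemma positive_lower_bound:
  fixes g :: "nat \<Rightarrow> real"
  assumes "\<And>j. j < n \<Longrightarrow> g j > 0"
  shows "\<exists>r>0. \<forall>j<n. r < g j"
  using assms
proof (induction n)
  case 0
  show ?case by (rule exI[of _ 1]) simp
next
  case (Suc n)
  then obtain r where r: "r > 0" "\<And>j. j < n \<Longrightarrow> r < g j" by auto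
  show ?case
    by (rule exI[of _ "min r (g n / 2)"]) (use r Suc.prems[of n] in \<open>auto simp: less_Suc_eq min_less_iff_disj\<close>)
qed

context construction
begin

text \<open>The perturbation property for a fixed radius \<eta>, as a predicate that the recursion
  can carry along.\<close>

definition stable :: "real \<Rightarrow> ('a \<Rightarrow> 'a) \<Rightarrow> 'a set \<Rightarrow> real \<Rightarrow> bool" where
  "stable \<epsilon> T L \<eta> \<longleftrightarrow> (\<forall>T'. adj_pair T' T' \<longrightarrow> (\<forall>x\<in>L. norm (T' x - T x) \<le> \<eta> * norm x) \<longrightarrow>
     (\<forall>\<mu>'\<in>spectrum2 T' L. \<exists>\<mu>\<in>spectrum2 T L. norm (\<mu>' - \<mu>) < \<epsilon>) \<and>
     (\<forall>\<mu>\<in>spectrum2 T L. \<exists>\<mu>'\<in>spectrum2 T' L. norm (\<mu> - \<mu>') < \<epsilon>))"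

text \<open>The first summand bounds the tolerance used in stage \<open>l\<close>; the rest is the
  cost of clamping the atoms to the margin \<open>r0 / Suc (Suc l)\<close>.\<close>

definition slack :: "real \<Rightarrow> nat \<Rightarrow> real" where
  "slack r0 l = 1 / Suc l + (r0 / Suc (Suc l) + sqrt (4 * B * (r0 / Suc (Suc l))))"

text \<open>Each \<eta> is a stability radius of the operator just built and at most half of its
  predecessor. If step \<open>l\<close> changes the operator by at most \<open>\<eta> l / 4\<close>,
  all later changes on \<open>E (m l)\<close> add up to at most \<open>\<eta> l / 2\<close>, so the
  limit stays within the radius of every stage.\<close>

lemma stages:
  assumes r0: "r0 > 0" "\<forall>j<n. a j + r0 < f j \<and> f j < b j - r0"
  shows "\<exists>m T L \<eta>. \<forall>l::nat. model (r0 / Suc l) (m l) (T l) \<and> \<eta> l > 0 \<and> L l \<subseteq> E (m l) \<and> csubspace (L l) \<and>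
      cfinite_dim (L l) \<and> stable (1 / Suc l) (T l) (L l) (\<eta> l) \<and>
      m l < m (Suc l) \<and> E (m l) \<subseteq> L (Suc l) \<and> \<eta> (Suc l) \<le> \<eta> l / 2 \<and> \<eta> l \<le> 1 \<and>
      (\<forall>x\<in>E (m l). norm (T (Suc l) x - T l x) \<le> \<eta> l / 4 * norm x) \<and>
      (\<forall>\<mu>\<in>spectrum2 (T (Suc l)) (L (Suc l)). \<exists>z\<in>F. norm (\<mu> - z) \<le> slack r0 l) \<and>
      (\<forall>z\<in>F. \<exists>\<mu>\<in>spectrum2 (T (Suc l)) (L (Suc l)). norm (z - \<mu>) \<le> slack r0 l) \<and>
      (\<forall>j<n. \<forall>t\<in>{a j..b j}. \<exists>v\<in>E (m (Suc l)). norm v = 1 \<and> norm (T (Suc l) v - t *\<^sub>R v) \<le> slack r0 l)"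
proof -
  define P where "P l s \<longleftrightarrow> (case s of (m, T, L, \<eta>) \<Rightarrow> model (r0 / Suc l) m T \<and> \<eta> > 0 \<and> \<eta> \<le> 1 \<and> L \<subseteq> E m \<and>
      csubspace L \<and> cfinite_dim L \<and> stable (1 / Suc l) T L \<eta>)" for l :: nat and s :: "nat \<times> ('a \<Rightarrow> 'a) \<times> 'a set \<times> real"
  define Q where "Q l s s' \<longleftrightarrow> (case s of (m, T, L, \<eta>) \<Rightarrow> case s' of (m', T', L', \<eta>') \<Rightarrow>
      m < m' \<and> E m \<subseteq> L' \<and> \<eta>' \<le> \<eta> / 2 \<and> (\<forall>x\<in>E m. norm (T' x - T x) \<le> \<eta> / 4 * norm x) \<and>
      (\<forall>\<mu>\<in>spectrum2 T' L'. \<exists>z\<in>F. norm (\<mu> - z) \<le> slack r0 l) \<and>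
      (\<forall>z\<in>F. \<exists>\<mu>\<in>spectrum2 T' L'. norm (z - \<mu>) \<le> slack r0 l) \<and>
      (\<forall>j<n. \<forall>t\<in>{a j..b j}. \<exists>v\<in>E m'. norm v = 1 \<and> norm (T' v - t *\<^sub>R v) \<le> slack r0 l))"
    for l :: nat and s s' :: "nat \<times> ('a \<Rightarrow> 'a) \<times> 'a set \<times> real"
  have "\<exists>s. \<forall>l. P l (s l) \<and> Q l (s l) (s (Suc l))"
  proof (rule dependent_nat_choice)
    \<comment> \<open>The start is the zero operator on the zero space, where the form bounds hold
      trivially; spectral claims begin only with the next stage.\<close>
    have E0: "E 0 = {0}" by (simp add: E_def complex_vector.span_empty)
    have "model (r0 / Suc 0) 0 (\<lambda>x. 0)"
      by (auto simp: model_def coloured_model_def adj_pair_def E0 colp_def col_zero)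
    moreover have adj0: "adj_pair (\<lambda>x::'a. 0) (\<lambda>x. 0)" by (simp add: adj_pair_def)
    obtain \<eta> where "\<eta> > 0" and st: "stable 1 (\<lambda>x. 0) (E 0) \<eta>"
      using spectrum2_perturbation[OF adj0 E_finite_dim[of 0], of 1] unfolding stable_def by auto
    moreover have "stable 1 (\<lambda>x. 0) (E 0) (min \<eta> 1)"
      using st unfolding stable_def E0 by auto
    ultimately have "P 0 (0, \<lambda>x. 0, E 0, min \<eta> 1)"
      using E_subspace[of 0] E_finite_dim[of 0] by (simp add: P_def)
    then show "\<exists>s. P 0 s" by blast
  next
    fix s l assume Ps: "P l s"
    obtain m T L \<eta> where s: "s = (m, T, L, \<eta>)" by (cases s) auto
    from Ps have T: "model (r0 / Suc l) m T" and \<eta>: "\<eta> > 0" "\<eta> \<le> 1"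
      by (auto simp: P_def s)
    \<comment> \<open>The first bound protects the stability of the earlier stages, the second makes
      the new spectrum approach \<open>F\<close>.\<close>
    define \<xi> where "\<xi> = min (\<eta> / 4) (1 / Suc l)"
    have \<xi>: "\<xi> > 0" using \<eta> by (simp add: \<xi>_def)
    have le: "r0 / Suc l \<le> r0" using r0(1) by (simp add: field_simps)
    have r: "a j + r0 / Suc l < f j \<and> f j < b j - r0 / Suc l" if "j < n" for j
      using r0(2) that le by fastforce
    have r': "0 < r0 / Suc (Suc l)" "r0 / Suc (Suc l) < r0 / Suc l"
      using r0(1) by (auto intro!: divide_strict_left_mono)
    define \<delta> where "\<delta> = r0 / Suc (Suc l) + sqrt (4 * B * (r0 / Suc (Suc l)))"
    have sl: "\<xi> + \<delta> \<le> slack r0 l" "\<xi> + r0 / Suc (Suc l) \<le> slack r0 l"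
    proof -
      have "\<xi> \<le> 1 / Suc l" by (simp add: \<xi>_def)
      moreover have "0 \<le> sqrt (4 * B * (r0 / Suc (Suc l)))" using B0 r0(1) by simp
      ultimately show "\<xi> + \<delta> \<le> slack r0 l" "\<xi> + r0 / Suc (Suc l) \<le> slack r0 l"
        unfolding slack_def \<delta>_def by linarith+
    qed
    obtain m' T' L' where st: "m < m'" "model (r0 / Suc (Suc l)) m' T'" "E m \<subseteq> L'" "L' \<subseteq> E m'"
        "csubspace L'" "cfinite_dim L'" "\<And>x. x \<in> E m \<Longrightarrow> norm (T' x - T x) \<le> \<xi> * norm x"
      and sp: "\<And>\<mu>. \<mu> \<in> spectrum2 T' L' \<Longrightarrow> \<exists>z\<in>F. norm (\<mu> - z) \<le> \<xi> + \<delta>"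
        "\<And>z. z \<in> F \<Longrightarrow> \<exists>\<mu>\<in>spectrum2 T' L'. norm (z - \<mu>) \<le> \<xi> + \<delta>"
        "\<And>j t. j < n \<Longrightarrow> t \<in> {a j..b j} \<Longrightarrow> \<exists>v\<in>E m'. norm v = 1 \<and> norm (T' v - t *\<^sub>R v) \<le> \<xi> + r0 / Suc (Suc l)"
      using stage[OF T r r' \<xi>, folded \<delta>_def] by blast
    have "adj_pair T' T'" using st(2) by (simp add: model_def coloured_model_def)
    then obtain \<eta>0 where \<eta>0: "\<eta>0 > 0" "stable (1 / Suc (Suc l)) T' L' \<eta>0"
      using spectrum2_perturbation[of T' L' "1 / Suc (Suc l)"] st(6) unfolding stable_def by auto
    have "stable (1 / Suc (Suc l)) T' L' (min \<eta>0 (\<eta> / 2))"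
      unfolding stable_def
    proof (intro allI impI)
      fix T'' assume "adj_pair T'' T''" "\<forall>x\<in>L'. norm (T'' x - T' x) \<le> min \<eta>0 (\<eta> / 2) * norm x"
      moreover have "min \<eta>0 (\<eta> / 2) * norm x \<le> \<eta>0 * norm x" for x :: 'a by (intro mult_right_mono) auto
      ultimately show "(\<forall>\<mu>'\<in>spectrum2 T'' L'. \<exists>\<mu>\<in>spectrum2 T' L'. norm (\<mu>' - \<mu>) < 1 / Suc (Suc l)) \<and>
        (\<forall>\<mu>\<in>spectrum2 T' L'. \<exists>\<mu>'\<in>spectrum2 T'' L'. norm (\<mu> - \<mu>') < 1 / Suc (Suc l))"
        using \<eta>0(2) unfolding stable_def by (meson order.trans)
    qed
    then have "P (Suc l) (m', T', L', min \<eta>0 (\<eta> / 2))"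
      using st \<eta> \<eta>0(1) by (auto simp: P_def)
    moreover have "Q l s (m', T', L', min \<eta>0 (\<eta> / 2))"
    proof -
      have "norm (T' x - T x) \<le> \<eta> / 4 * norm x" if "x \<in> E m" for x
      proof -
        have "\<xi> * norm x \<le> \<eta> / 4 * norm x" by (intro mult_right_mono) (auto simp: \<xi>_def)
        then show ?thesis using st(7)[OF that] by linarith
      qed
      moreover have "\<exists>z\<in>F. norm (\<mu> - z) \<le> slack r0 l" if "\<mu> \<in> spectrum2 T' L'" for \<mu>
        using sp(1)[OF that] sl(1) order.trans by blast
      moreover have "\<exists>\<mu>\<in>spectrum2 T' L'. norm (z - \<mu>) \<le> slack r0 l" if "z \<in> F" for z
        using sp(2)[OF that] sl(1) order.trans by blast
      moreover have "\<exists>v\<in>E m'. norm v = 1 \<and> norm (T' v - t *\<^sub>R v) \<le> slack r0 l" if "j < n" "t \<in> {a j..b j}" for j t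
        using sp(3)[OF that] sl(2) order.trans by blast
      ultimately show ?thesis
        unfolding Q_def s using st(1,3) by auto
    qed
    ultimately show "\<exists>s'. P (Suc l) s' \<and> Q l s s'" by blast
  qed
  then obtain s where s: "\<And>l. P l (s l)" "\<And>l. Q l (s l) (s (Suc l))" by blast
  show ?thesis
    by (rule exI[of _ "\<lambda>l. fst (s l)"], rule exI[of _ "\<lambda>l. fst (snd (s l))"],
        rule exI[of _ "\<lambda>l. fst (snd (snd (s l)))"], rule exI[of _ "\<lambda>l. snd (snd (snd (s l)))"])
      (use s in \<open>simp add: P_def Q_def case_prod_beta\<close>)
qed

lemma slack_tendsto: "slack r0 \<longlonglongrightarrow> 0"
proof -
  have 1: "(\<lambda>l. c / real (Suc l)) \<longlonglongrightarrow> 0" for c :: real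
    using tendsto_mult_right_zero[OF LIMSEQ_inverse_real_of_nat, of c] by (simp add: divide_inverse)
  have 2: "(\<lambda>l. r0 / real (Suc (Suc l))) \<longlonglongrightarrow> 0" using LIMSEQ_Suc[OF 1[of r0]] by simp
  have "(\<lambda>l. 1 / real (Suc l) + (r0 / real (Suc (Suc l)) + sqrt (4 * B * (r0 / real (Suc (Suc l)))))) \<longlonglongrightarrow>
    0 + (0 + sqrt (4 * B * 0))"
    by (intro tendsto_intros 1 2)
  then show ?thesis by (simp add: slack_def[abs_def])
qed

theorem main_construction:
  "\<exists>T (L :: nat \<Rightarrow> 'a set). bounded_clinear T \<and> T = cadjoint T \<and> L \<in> \<PP> \<and>
    spectrum T = complex_of_real ` (\<Union>j<n. {a j..b j}) \<and>
    ((\<lambda>l. hausdorff_distance (spectrum2 T (L l)) F) \<longlonglongrightarrow> 0)"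
proof -
  obtain r where r: "r > 0" "\<And>j. j < n \<Longrightarrow> r < min (f j - a j) (b j - f j)"
    using positive_lower_bound[of n "\<lambda>j. min (f j - a j) (b j - f j)"] ab by auto
  have r': "\<forall>j<n. a j + r < f j \<and> f j < b j - r" using r(2) by fastforce
  obtain m T L \<eta> where S0: "\<forall>l::nat. model (r / Suc l) (m l) (T l) \<and> \<eta> l > 0 \<and> L l \<subseteq> E (m l) \<and> csubspace (L l) \<and>
      cfinite_dim (L l) \<and> stable (1 / Suc l) (T l) (L l) (\<eta> l) \<and>
      m l < m (Suc l) \<and> E (m l) \<subseteq> L (Suc l) \<and> \<eta> (Suc l) \<le> \<eta> l / 2 \<and> \<eta> l \<le> 1 \<and>
      (\<forall>x\<in>E (m l). norm (T (Suc l) x - T l x) \<le> \<eta> l / 4 * norm x) \<and>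
      (\<forall>\<mu>\<in>spectrum2 (T (Suc l)) (L (Suc l)). \<exists>z\<in>F. norm (\<mu> - z) \<le> slack r l) \<and>
      (\<forall>z\<in>F. \<exists>\<mu>\<in>spectrum2 (T (Suc l)) (L (Suc l)). norm (z - \<mu>) \<le> slack r l) \<and>
      (\<forall>j<n. \<forall>t\<in>{a j..b j}. \<exists>v\<in>E (m (Suc l)). norm v = 1 \<and> norm (T (Suc l) v - t *\<^sub>R v) \<le> slack r l)"
    using stages[OF r(1) r'] by (elim exE) (rule that)
  note S = spec[OF S0]
  have mod: "model (r / Suc l) (m l) (T l)" and \<eta>0: "\<eta> l > 0" and LE: "L l \<subseteq> E (m l)" and Lsub: "csubspace (L l)"
    and Lfin: "cfinite_dim (L l)" and stab: "stable (1 / Suc l) (T l) (L l) (\<eta> l)" and mS: "m l < m (Suc l)"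
    and EL: "E (m l) \<subseteq> L (Suc l)" and \<eta>S: "\<eta> (Suc l) \<le> \<eta> l / 2" and \<eta>1: "\<eta> l \<le> 1"
    and inc: "\<forall>x\<in>E (m l). norm (T (Suc l) x - T l x) \<le> \<eta> l / 4 * norm x"
    and sp1: "\<forall>\<mu>\<in>spectrum2 (T (Suc l)) (L (Suc l)). \<exists>z\<in>F. norm (\<mu> - z) \<le> slack r l"
    and sp2: "\<forall>z\<in>F. \<exists>\<mu>\<in>spectrum2 (T (Suc l)) (L (Suc l)). norm (z - \<mu>) \<le> slack r l" for l
    using S[of l] by simp_all
  note Tm = coloured_modelD[OF mod[unfolded model_def]]
  have m_mono: "m l \<le> m k" if "l \<le> k" for l k
    by (rule lift_Suc_mono_le[OF _ that]) (simp add: mS less_imp_le)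
  have "strict_mono m" using mS by (simp add: strict_mono_Suc_iff)
  then have pr_lim: "(\<lambda>l. pr (m l) x) \<longlonglongrightarrow> x" for x
    using LIMSEQ_subseq_LIMSEQ[OF pr_tendsto[of x]] by (simp add: o_def)
  have pr_lim0: "(\<lambda>l. norm (x - pr (m l) x)) \<longlonglongrightarrow> 0" for x
    using tendsto_norm[OF tendsto_diff[OF tendsto_const[of x] pr_lim[of x]]] by simp
  have E_le: "E (m l) \<subseteq> E (m k)" if "l \<le> k" for l k by (rule E_mono[OF m_mono[OF that]])
  have \<eta>_le: "\<eta> (l + k) \<le> \<eta> l * (1/2) ^ k" for l k
  proof (induction k)
    case (Suc k)
    then show ?case using \<eta>S[of "l + k"] by simp
  qed simp
  have nT: "norm (T l x) \<le> B * norm x" for l x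
  proof (rule norm_le_by_colours[OF Tm(1,2,3) _ B0])
    fix j x assume jx: "j < n" "col j x" "x \<in> E (m l)"
    have "r / Suc l \<ge> 0" using r(1) by simp
    then have "- B * (norm x)\<^sup>2 \<le> (a j + r / Suc l) * (norm x)\<^sup>2" "(b j - r / Suc l) * (norm x)\<^sup>2 \<le> B * (norm x)\<^sup>2"
      using bnd[OF jx(1)] by (intro mult_right_mono; simp add: abs_le_iff)+
    then show "\<bar>Re (cinner (T l x) x)\<bar> \<le> B * (norm x)\<^sup>2"
      using Tm(4)[OF jx] Tm(5)[OF jx] by (simp add: abs_le_iff)
  qed
  \<comment> \<open>A partial sum of the geometric series with first term
    \<open>\<eta> l / 4\<close> and ratio 1/2.\<close>
  have diff: "norm (T (l + k) x - T l x) \<le> \<eta> l / 2 * (1 - (1/2) ^ k) * norm x" if x: "x \<in> E (m l)" for l k x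
  proof (induction k)
    case (Suc k)
    have "x \<in> E (m (l + k))" using x E_le[of l "l + k"] by auto
    then have "norm (T (Suc (l + k)) x - T (l + k) x) \<le> \<eta> (l + k) / 4 * norm x" using inc by blast
    also have "\<dots> \<le> \<eta> l * (1/2) ^ k / 4 * norm x"
      using \<eta>_le[of l k] by (intro mult_right_mono divide_right_mono) auto
    finally have "norm (T (l + Suc k) x - T l x) \<le> \<eta> l * (1/2) ^ k / 4 * norm x + \<eta> l / 2 * (1 - (1/2) ^ k) * norm x"
      using Suc norm_triangle_ineq[of "T (Suc (l + k)) x - T (l + k) x" "T (l + k) x - T l x"] by simp
    also have "\<dots> = \<eta> l / 2 * (1 - (1/2) ^ Suc k) * norm x" by (simp add: field_simps)
    finally show ?case .
  qed simp
  have diff': "norm (T k x - T l x) \<le> \<eta> l / 2 * norm x" if x: "x \<in> E (m l)" and k: "l \<le> k" for l k x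
  proof -
    have "\<eta> l / 2 * (1 - (1/2) ^ (k - l)) * norm x \<le> \<eta> l / 2 * 1 * norm x"
      using \<eta>0[of l] by (intro mult_right_mono mult_left_mono) auto
    then show ?thesis using diff[OF x, of "k - l"] k by simp
  qed
  have "\<eta> \<longlonglongrightarrow> 0"
  proof (rule Lim_null_comparison)
    show "eventually (\<lambda>l. norm (\<eta> l) \<le> (1/2) ^ l) sequentially"
    proof (intro always_eventually allI)
      fix l
      have "norm (\<eta> l) = \<eta> l" using \<eta>0[of l] by simp
      also have "\<dots> \<le> \<eta> 0 * (1/2) ^ l" using \<eta>_le[of 0 l] by simp
      also have "\<dots> \<le> 1 * (1/2) ^ l" by (intro mult_right_mono \<eta>1) auto
      finally show "norm (\<eta> l) \<le> (1/2) ^ l" by simp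
    qed
  qed (rule LIMSEQ_power_zero, simp)
  have conv: "convergent (\<lambda>l. T l x)" for x
  proof -
    \<comment> \<open>A general \<open>x\<close> lies in no \<open>E (m l)\<close>. Its part outside
      is controlled by the common norm bound \<open>B\<close>, its projection by the
      increments.\<close>
    define c where "c l = 2 * B * norm (x - pr (m l) x) + \<eta> l / 2 * norm x" for l
    have Tc: "norm (T k x - T l x) \<le> c l" if "l \<le> k" for l k
    proof -
      define y where "y = pr (m l) x"
      have "T k x - T l x = T k (x - y) - T l (x - y) + (T k y - T l y)"
        by (simp add: clin_diff[OF adj_pair_clin[OF Tm(1)]])
      also have "norm \<dots> \<le> norm (T k (x - y)) + norm (T l (x - y)) + norm (T k y - T l y)"
        by (intro order.trans[OF norm_triangle_ineq] add_mono norm_triangle_ineq4 order.refl)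
      also have "\<dots> \<le> B * norm (x - y) + B * norm (x - y) + \<eta> l / 2 * norm y"
        using that by (intro add_mono nT diff') (auto simp: y_def pr_in_E)
      also have "\<dots> \<le> c l"
        using norm_pr_le[of "m l" x] \<eta>0[of l] by (simp add: c_def y_def mult_left_mono)
      finally show ?thesis .
    qed
    have "c \<longlonglongrightarrow> 2 * B * 0 + 0 / 2 * norm x"
      unfolding c_def[abs_def] by (intro tendsto_intros \<open>\<eta> \<longlonglongrightarrow> 0\<close> pr_lim0) auto
    then have c0: "c \<longlonglongrightarrow> 0" by simp
    have "Cauchy (\<lambda>l. T l x)"
      unfolding Cauchy_def dist_norm
    proof (intro allI impI)
      fix \<epsilon> :: real assume "\<epsilon> > 0"
      then have "eventually (\<lambda>l. c l < \<epsilon> / 2) sequentially" using c0 by (intro order_tendstoD(2)) auto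
      then obtain l where l: "c l < \<epsilon> / 2" by (auto simp: eventually_sequentially)
      have "norm (T i x - T k x) < \<epsilon>" if "l \<le> i" "l \<le> k" for i k
        using Tc[OF that(1)] Tc[OF that(2)] l norm_triangle_ineq4[of "T i x - T l x" "T k x - T l x"] by simp
      then show "\<exists>M. \<forall>i\<ge>M. \<forall>k\<ge>M. norm (T i x - T k x) < \<epsilon>" by blast
    qed
    then show ?thesis by (rule Cauchy_convergent)
  qed
  then obtain Ti where lim: "\<And>x. (\<lambda>l. T l x) \<longlonglongrightarrow> Ti x"
    unfolding convergent_def by metis
  have adj: "adj_pair Ti Ti" by (rule adj_pair_limit[OF lim Tm(1)])
  note lin = adj_pair_clin[OF adj]
  have nTi: "norm (Ti x) \<le> B * norm x" for x by (rule norm_bound_limit[OF lim nT])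
  have closeT: "norm (Ti x - T l x) \<le> \<eta> l / 2 * norm x" if "x \<in> E (m l)" for l x
  proof (rule norm_bound_limit)
    show "(\<lambda>k. T (k + l) x - T l x) \<longlonglongrightarrow> Ti x - T l x"
      by (intro tendsto_diff tendsto_const LIMSEQ_ignore_initial_segment lim)
    show "norm (T (k + l) x - T l x) \<le> \<eta> l / 2 * norm x" for k
      by (rule diff'[OF that]) simp
  qed
  have close: "norm (Ti x - T l x) \<le> \<eta> l * norm x" if "x \<in> E (m l)" for l x
  proof -
    have "\<eta> l / 2 * norm x \<le> \<eta> l * norm x" using \<eta>0[of l] by (intro mult_right_mono) auto
    then show ?thesis using closeT[OF that] by linarith
  qed
  have "bounded_clinear Ti" by (rule clin_bounded_clinear[OF lin nTi])
  moreover have "cadjoint Ti = Ti" by (rule cadjoint_eqI) (rule adj_pairD[OF adj])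
  moreover have "L \<in> \<PP>"
    unfolding proj_sequences_def
  proof (intro CollectI conjI allI Lsub Lfin)
    show "L l \<subseteq> L (Suc l)" for l using LE EL by blast
    fix x
    \<comment> \<open>\<open>L (Suc l)\<close> contains \<open>E (m l)\<close>, so its best
      approximation to \<open>x\<close> is at least as good as \<open>pr (m l) x\<close>.\<close>
    have "(\<lambda>l. x - cproj (L (Suc l)) x) \<longlonglongrightarrow> 0"
    proof (rule Lim_null_comparison)
      show "eventually (\<lambda>l. norm (x - cproj (L (Suc l)) x) \<le> norm (x - pr (m l) x)) sequentially"
        using EL pr_in_E by (intro always_eventually allI cproj_minimal Lfin) blast
      show "(\<lambda>l. norm (x - pr (m l) x)) \<longlonglongrightarrow> 0"
        by (rule pr_lim0)
    qed
    from tendsto_diff[OF tendsto_const[of x] this]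
    have "(\<lambda>l. cproj (L (Suc l)) x) \<longlonglongrightarrow> x" by simp
    then show "(\<lambda>l. cproj (L l) x) \<longlonglongrightarrow> x" by (rule LIMSEQ_imp_Suc)
  qed
  moreover have "spectrum Ti = complex_of_real ` (\<Union>j<n. {a j..b j})"
  proof (intro equalityI subsetI)
    fix \<mu> assume "\<mu> \<in> complex_of_real ` (\<Union>j<n. {a j..b j})"
    then obtain j t where jt: "j < n" "t \<in> {a j..b j}" "\<mu> = complex_of_real t" by auto
    show "\<mu> \<in> spectrum Ti"
    proof (rule approximate_eigenvalue_in_spectrum)
      fix \<epsilon> :: real assume \<epsilon>: "\<epsilon> > 0"
      have "(\<lambda>l. slack r l + \<eta> (Suc l)) \<longlonglongrightarrow> 0"
        using tendsto_add[OF slack_tendsto LIMSEQ_Suc[OF \<open>\<eta> \<longlonglongrightarrow> 0\<close>]] by simp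
      then have "eventually (\<lambda>l. slack r l + \<eta> (Suc l) < \<epsilon>) sequentially"
        using \<epsilon> by (rule order_tendstoD(2))
      then obtain l where l: "slack r l + \<eta> (Suc l) < \<epsilon>" by (auto simp: eventually_sequentially)
      obtain v where v: "v \<in> E (m (Suc l))" "norm v = 1" "norm (T (Suc l) v - t *\<^sub>R v) \<le> slack r l"
        using S[of l] jt by blast
      have "norm (Ti v - \<mu> *\<^sub>C v) \<le> norm (Ti v - T (Suc l) v) + norm (T (Suc l) v - t *\<^sub>R v)"
        using norm_triangle_ineq[of "Ti v - T (Suc l) v" "T (Suc l) v - t *\<^sub>R v"]
        by (simp add: jt(3) scaleR_scaleC)
      also have "\<dots> < \<epsilon>" using close[OF v(1)] v(2,3) l by simp
      finally show "\<exists>v. norm v = 1 \<and> norm (Ti v - \<mu> *\<^sub>C v) < \<epsilon>" using v(2) by blast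
    qed
  next
    fix \<mu> assume \<mu>: "\<mu> \<in> spectrum Ti"
    show "\<mu> \<in> complex_of_real ` (\<Union>j<n. {a j..b j})"
    proof (rule ccontr)
      assume no: "\<mu> \<notin> complex_of_real ` (\<Union>j<n. {a j..b j})"
      have "\<exists>\<delta>>0. \<forall>x. \<delta> * norm x \<le> norm (Ti x - \<mu> *\<^sub>C x)"
      proof (cases "Im \<mu> = 0")
        case False
        \<comment> \<open>The form of \<open>Ti\<close> is real, so subtracting \<mu> shifts its
          imaginary part by a multiple of \<open>Im \<mu>\<close>.\<close>
        have "\<bar>Im \<mu>\<bar> * norm x \<le> norm (Ti x - \<mu> *\<^sub>C x)" for x
        proof (cases "x = 0")
          case x: False
          have "Im (cinner (Ti x) x) = 0"
            using adj_pairD[OF adj, of x x] cinner_commute[of "Ti x" x] by (simp add: complex_eq_iff)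
          then have "\<bar>Im (cinner (Ti x - \<mu> *\<^sub>C x) x)\<bar> = \<bar>Im \<mu>\<bar> * (norm x)\<^sup>2"
            by (simp add: cinner_simps norm_sq_eq_cinner[symmetric] abs_mult del: of_real_power)
          then have "\<bar>Im \<mu>\<bar> * (norm x)\<^sup>2 \<le> norm (Ti x - \<mu> *\<^sub>C x) * norm x"
            using order.trans[OF abs_Im_le_cmod cinner_Cauchy_Schwarz, of "Ti x - \<mu> *\<^sub>C x" x] by simp
          then show ?thesis using x by (simp add: power2_eq_square)
        qed simp
        then show ?thesis using False by (intro exI[of _ "\<bar>Im \<mu>\<bar>"]) simp
      next
        case True
        define t where "t = Re \<mu>"
        have \<mu>t: "\<mu> = complex_of_real t" using True by (simp add: t_def complex_eq_iff)
        have "max (a j - t) (t - b j) > 0" if "j < n" for j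
        proof -
          have "t \<notin> {a j..b j}" using no that unfolding \<mu>t by blast
          then show ?thesis by (auto simp: less_max_iff_disj)
        qed
        then obtain \<delta> where \<delta>: "\<delta> > 0" "\<And>j. j < n \<Longrightarrow> \<delta> < max (a j - t) (t - b j)"
          using positive_lower_bound[of n "\<lambda>j. max (a j - t) (t - b j)"] by auto
        \<comment> \<open>Restricted to \<open>E (m l)\<close>, since \<open>T l\<close> is 0 on the
          complement and \<open>t\<close> may be 0. In each colour the form of T l - t keeps one
          sign and exceeds \<delta> in modulus on unit vectors.\<close>
        have fin: "\<delta> * norm x \<le> norm (T l x - t *\<^sub>R x)" if x: "x \<in> E (m l)" for l x
        proof -
          note linl = adj_pair_clin[OF Tm(1)[of l]]
          have one: "\<delta> * norm y \<le> norm (T l y - t *\<^sub>R y)" if y: "j < n" "col j y" "y \<in> E (m l)" for j y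
          proof (cases "y = 0")
            case False
            have "r / Suc l \<ge> 0" using r(1) by simp
            then have "a j * (norm y)\<^sup>2 \<le> (a j + r / Suc l) * (norm y)\<^sup>2" "(b j - r / Suc l) * (norm y)\<^sup>2 \<le> b j * (norm y)\<^sup>2"
              by (intro mult_right_mono; simp)+
            then have 1: "(a j - t) * (norm y)\<^sup>2 \<le> Re (cinner (T l y - t *\<^sub>R y) y)"
              "Re (cinner (T l y - t *\<^sub>R y) y) \<le> (b j - t) * (norm y)\<^sup>2"
              using Tm(4)[OF y] Tm(5)[OF y]
              by (simp_all add: cinner_simps scaleR_cinner_left norm_sq_eq_Re_cinner algebra_simps)
            have "\<delta> * (norm y)\<^sup>2 \<le> \<bar>Re (cinner (T l y - t *\<^sub>R y) y)\<bar>"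
            proof (cases "\<delta> < a j - t")
              case True
              then have "\<delta> * (norm y)\<^sup>2 \<le> (a j - t) * (norm y)\<^sup>2" by (intro mult_right_mono) auto
              then show ?thesis using 1 by linarith
            next
              case False
              then have "\<delta> < t - b j" using \<delta>(2)[OF y(1)] by (auto simp: less_max_iff_disj)
              then have "\<delta> * (norm y)\<^sup>2 \<le> (t - b j) * (norm y)\<^sup>2" by (intro mult_right_mono) auto
              also have "\<dots> = - ((b j - t) * (norm y)\<^sup>2)" by (simp add: algebra_simps)
              finally show ?thesis using 1 by linarith
            qed
            also have "\<dots> \<le> norm (T l y - t *\<^sub>R y) * norm y"
              by (rule order.trans[OF abs_Re_le_cmod cinner_Cauchy_Schwarz])
            finally show ?thesis using False by (simp add: power2_eq_square)
          qed simp
          define y where "y j = cp j (m l) x" for j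
          have y: "y j \<in> E (m l)" "col j (y j)" if "j < n" for j
            using that by (auto simp: y_def cp_in_E col_cp)
          have xy: "x = (\<Sum>j<n. y j)" using pr_id[OF x] by (simp add: y_def sum_cp)
          have "T l x - t *\<^sub>R x = (\<Sum>j<n. T l (y j) - t *\<^sub>R y j)"
            unfolding xy by (simp add: clin_sum[OF linl] sum_subtractf scaleR_sum_right)
          then have "(norm (T l x - t *\<^sub>R x))\<^sup>2 = (\<Sum>j<n. (norm (T l (y j) - t *\<^sub>R y j))\<^sup>2)"
            using norm_sum_col[of "\<lambda>j. T l (y j) - t *\<^sub>R y j" "m l"] y
            by (auto intro!: E_intros Tm(2) col_intros colpD[OF Tm(3)])
          also have "\<dots> \<ge> (\<Sum>j<n. (\<delta> * norm (y j))\<^sup>2)"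
            using \<delta>(1) y by (intro sum_mono power_mono one) auto
          also have "(\<Sum>j<n. (\<delta> * norm (y j))\<^sup>2) = \<delta>\<^sup>2 * (norm x)\<^sup>2"
            using norm_sum_col[of y "m l"] y by (simp add: xy power_mult_distrib sum_distrib_left)
          finally have "(\<delta> * norm x)\<^sup>2 \<le> (norm (T l x - t *\<^sub>R x))\<^sup>2" by (simp add: power_mult_distrib)
          then show ?thesis by (rule power2_le_imp_le) simp
        qed
        have "\<delta> * norm x \<le> norm (Ti x - \<mu> *\<^sub>C x)" for x
        proof -
          \<comment> \<open>The lower bound is available only for projected vectors, so
            \<open>x\<close> is replaced by \<open>pr (m l) x\<close> before passing to the
            limit.\<close>
          have "(\<lambda>l. T l (pr (m l) x - x)) \<longlonglongrightarrow> 0"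
          proof (rule Lim_null_comparison)
            show "eventually (\<lambda>l. norm (T l (pr (m l) x - x)) \<le> B * norm (pr (m l) x - x)) sequentially"
              using nT by simp
            show "(\<lambda>l. B * norm (pr (m l) x - x)) \<longlonglongrightarrow> 0"
              using pr_lim[of x] by (intro tendsto_mult_right_zero tendsto_norm_zero) (simp add: LIM_zero)
          qed
          from tendsto_add[OF this lim[of x]]
          have "(\<lambda>l. T l (pr (m l) x)) \<longlonglongrightarrow> Ti x"
            by (simp add: clin_diff[OF adj_pair_clin[OF Tm(1)]])
          then have "(\<lambda>l. norm (T l (pr (m l) x) - t *\<^sub>R pr (m l) x)) \<longlonglongrightarrow> norm (Ti x - t *\<^sub>R x)"
            by (intro tendsto_intros pr_lim)
          moreover have "(\<lambda>l. \<delta> * norm (pr (m l) x)) \<longlonglongrightarrow> \<delta> * norm x"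
            by (intro tendsto_intros pr_lim)
          ultimately have "\<delta> * norm x \<le> norm (Ti x - t *\<^sub>R x)"
            using fin[OF pr_in_E] by (intro LIMSEQ_le) auto
          then show ?thesis by (simp add: \<mu>t scaleR_scaleC)
        qed
        then show ?thesis using \<delta>(1) by blast
      qed
      then show False using bounded_below_invertible[OF adj nTi] \<mu> by blast
    qed
  qed
  moreover have "(\<lambda>l. hausdorff_distance (spectrum2 Ti (L l)) F) \<longlonglongrightarrow> 0"
  proof -
    \<comment> \<open>The error of stage \<open>Suc l\<close> plus the tolerance of
      \<open>stable\<close> at that stage.\<close>
    define \<kappa> where "\<kappa> l = slack r l + 1 / Suc (Suc l)" for l
    have hd: "hausdorff_distance (spectrum2 Ti (L (Suc l))) F \<le> ennreal (\<kappa> l)" for l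
    proof (rule hausdorff_distance_le)
      have "\<forall>x\<in>L (Suc l). norm (Ti x - T (Suc l) x) \<le> \<eta> (Suc l) * norm x"
        using close[of _ "Suc l"] LE[of "Suc l"] by blast
      note st = mp[OF mp[OF spec[OF stab[of "Suc l", unfolded stable_def], of Ti] adj] this]
      have 1: "\<forall>\<mu>'\<in>spectrum2 Ti (L (Suc l)). \<exists>\<mu>\<in>spectrum2 (T (Suc l)) (L (Suc l)). norm (\<mu>' - \<mu>) < 1 / Suc (Suc l)"
        "\<forall>\<mu>\<in>spectrum2 (T (Suc l)) (L (Suc l)). \<exists>\<mu>'\<in>spectrum2 Ti (L (Suc l)). norm (\<mu> - \<mu>') < 1 / Suc (Suc l)"
        by (rule conjunct1[OF st], rule conjunct2[OF st])
      show "\<exists>z\<in>F. norm (\<mu>' - z) \<le> \<kappa> l" if h: "\<mu>' \<in> spectrum2 Ti (L (Suc l))" for \<mu>'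
      proof -
        obtain \<mu> where \<mu>: "\<mu> \<in> spectrum2 (T (Suc l)) (L (Suc l))" "norm (\<mu>' - \<mu>) < 1 / Suc (Suc l)"
          using bspec[OF 1(1) h] by blast
        obtain z where "z \<in> F" "norm (\<mu> - z) \<le> slack r l" using bspec[OF sp1 \<mu>(1)] by blast
        then show ?thesis
          using \<mu>(2) norm_triangle_ineq[of "\<mu>' - \<mu>" "\<mu> - z"] by (intro bexI[of _ z]) (auto simp: \<kappa>_def)
      qed
      show "\<exists>\<mu>'\<in>spectrum2 Ti (L (Suc l)). norm (z - \<mu>') \<le> \<kappa> l" if h: "z \<in> F" for z
      proof -
        obtain \<mu> where \<mu>: "\<mu> \<in> spectrum2 (T (Suc l)) (L (Suc l))" "norm (z - \<mu>) \<le> slack r l"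
          using bspec[OF sp2 h] by blast
        obtain \<mu>' where "\<mu>' \<in> spectrum2 Ti (L (Suc l))" "norm (\<mu> - \<mu>') < 1 / Suc (Suc l)"
          using bspec[OF 1(2) \<mu>(1)] by blast
        then show ?thesis
          using \<mu>(2) norm_triangle_ineq[of "z - \<mu>" "\<mu> - \<mu>'"] by (intro bexI[of _ \<mu>']) (auto simp: \<kappa>_def)
      qed
    qed
    have k0: "(\<lambda>l. ennreal (\<kappa> l)) \<longlonglongrightarrow> 0"
    proof -
      have "(\<lambda>l. 1 / real (Suc (Suc l))) \<longlonglongrightarrow> 0"
        using LIMSEQ_Suc[OF LIMSEQ_inverse_real_of_nat] by (simp add: divide_inverse)
      from tendsto_add[OF slack_tendsto[of r] this] have "\<kappa> \<longlonglongrightarrow> 0" by (simp add: \<kappa>_def[abs_def])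
      from tendsto_ennrealI[OF this] show ?thesis by simp
    qed
    have "(\<lambda>l. hausdorff_distance (spectrum2 Ti (L (Suc l))) F) \<longlonglongrightarrow> 0"
    proof (rule tendsto_sandwich[OF _ _ tendsto_const k0])
      show "\<forall>\<^sub>F l in sequentially. 0 \<le> hausdorff_distance (spectrum2 Ti (L (Suc l))) F" by simp
      show "\<forall>\<^sub>F l in sequentially. hausdorff_distance (spectrum2 Ti (L (Suc l))) F \<le> ennreal (\<kappa> l)"
        by (rule always_eventually, rule allI, rule hd)
    qed
    then show ?thesis by (rule LIMSEQ_imp_Suc)
  qed
  ultimately show ?thesis by (intro exI[of _ Ti] exI[of _ L]) simp
qed

end

section \<open>Finite unions of intervals\<close>

lemma two_atoms:
  fixes p q \<alpha> :: real
  assumes "p \<le> \<alpha>" "\<alpha> \<le> q"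
  shows "\<exists>u v. 0 \<le> u \<and> 0 \<le> v \<and> u + v = 1 \<and> u * p + v * q = \<alpha> \<and>
    u * p\<^sup>2 + v * q\<^sup>2 = \<alpha>\<^sup>2 + (\<alpha> - p) * (q - \<alpha>)"
proof (cases "p = q")
  case True
  then show ?thesis using assms by (intro exI[of _ 1] exI[of _ 0]) simp
next
  case False
  then have d: "q - p > 0" using assms by simp
  define v where "v = (\<alpha> - p) / (q - p)"
  have v: "v * (q - p) = \<alpha> - p" "0 \<le> v" "v \<le> 1" using d assms by (auto simp: v_def)
  have 1: "(1 - v) * p + v * q = \<alpha>" using v(1) by (simp add: algebra_simps)
  have "(1 - v) * p\<^sup>2 + v * q\<^sup>2 = p\<^sup>2 + v * (q - p) * (q + p)" by (simp add: algebra_simps power2_eq_square)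
  also have "\<dots> = \<alpha>\<^sup>2 + (\<alpha> - p) * (q - \<alpha>)" unfolding v(1) by (simp add: algebra_simps power2_eq_square)
  finally show ?thesis using 1 v(2,3) by (intro exI[of _ "1 - v"] exI[of _ v]) simp
qed

text \<open>The two-point laws on \<open>p\<close>, \<open>q\<close> and on \<open>p'\<close>,
  \<open>q'\<close> have the same mean \<alpha>, the first with too much variance and the second
  with too little. First and second moments are affine under mixing, so some mixture has variance
  \<beta>^2.\<close>

lemma four_atoms:
  fixes p q p' q' \<alpha> \<beta> :: real
  assumes "p \<le> \<alpha>" "\<alpha> \<le> q" "p' \<le> \<alpha>" "\<alpha> \<le> q'"
    and v: "(\<alpha> - p') * (q' - \<alpha>) \<le> \<beta>\<^sup>2" "\<beta>\<^sup>2 \<le> (\<alpha> - p) * (q - \<alpha>)"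
  shows "\<exists>w. (\<forall>s<4. (0::real) \<le> w s) \<and> (\<Sum>s<4. w s) = 1 \<and> (\<Sum>s<4::nat. w s * ([p, q, p', q'] ! s)) = \<alpha> \<and>
    (\<Sum>s<4. w s * ([p, q, p', q'] ! s)\<^sup>2) = \<alpha>\<^sup>2 + \<beta>\<^sup>2"
proof -
  define V where "V = (\<alpha> - p) * (q - \<alpha>)"
  define V' where "V' = (\<alpha> - p') * (q' - \<alpha>)"
  obtain g h where gh: "0 \<le> g" "0 \<le> h" "g + h = 1" "g * p + h * q = \<alpha>" "g * p\<^sup>2 + h * q\<^sup>2 = \<alpha>\<^sup>2 + V"
    using two_atoms[OF assms(1,2)] unfolding V_def by blast
  obtain g' h' where gh': "0 \<le> g'" "0 \<le> h'" "g' + h' = 1" "g' * p' + h' * q' = \<alpha>" "g' * p'\<^sup>2 + h' * q'\<^sup>2 = \<alpha>\<^sup>2 + V'"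
    using two_atoms[OF assms(3,4)] unfolding V'_def by blast
  obtain t where t: "0 \<le> t" "t \<le> 1" "V' + t * (V - V') = \<beta>\<^sup>2"
  proof (cases "V = V'")
    case True
    then show ?thesis using v that[of 0] by (simp add: V_def V'_def)
  next
    case False
    then show ?thesis using v that[of "(\<beta>\<^sup>2 - V') / (V - V')"] by (simp add: V_def V'_def)
  qed
  define w where "w s = [t * g, t * h, (1 - t) * g', (1 - t) * h'] ! s" for s
  have "t * g + (t * h + ((1 - t) * g' + (1 - t) * h')) = t * (g + h) + (1 - t) * (g' + h')"
    by (simp add: algebra_simps)
  then have 1: "(\<Sum>s<4. w s) = 1" by (simp add: w_def numeral_eq_Suc gh(3) gh'(3) add.assoc)
  have "t * g * p + (t * h * q + ((1 - t) * g' * p' + (1 - t) * h' * q'))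
      = t * (g * p + h * q) + (1 - t) * (g' * p' + h' * q')"
    by (simp add: algebra_simps)
  also have "\<dots> = \<alpha>" unfolding gh(4) gh'(4) by (simp add: algebra_simps)
  finally have 2: "(\<Sum>s<4. w s * ([p, q, p', q'] ! s)) = \<alpha>" by (simp add: w_def numeral_eq_Suc add.assoc)
  have "t * g * p\<^sup>2 + (t * h * q\<^sup>2 + ((1 - t) * g' * p'\<^sup>2 + (1 - t) * h' * q'\<^sup>2))
      = t * (g * p\<^sup>2 + h * q\<^sup>2) + (1 - t) * (g' * p'\<^sup>2 + h' * q'\<^sup>2)"
    by (simp add: algebra_simps)
  also have "\<dots> = \<alpha>\<^sup>2 + \<beta>\<^sup>2" unfolding gh(5) gh'(5) t(3)[symmetric] by (simp add: algebra_simps)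
  finally have 3: "(\<Sum>s<4. w s * ([p, q, p', q'] ! s)\<^sup>2) = \<alpha>\<^sup>2 + \<beta>\<^sup>2"
    by (simp add: w_def eval_nat_numeral add.assoc)
  have "\<forall>s<4. 0 \<le> w s"
    using gh(1,2) gh'(1,2) t(1,2) by (simp add: w_def numeral_eq_Suc All_less_Suc)
  then show ?thesis using 1 2 3 by blast
qed

text \<open>The power of a point with respect to the circle on diameter [c, d]. It turns disk
  membership into a comparison of (Im z)^2 with (Re z - c) (d - Re z), the variance of the two-point
  law on \<open>c\<close>, \<open>d\<close> with mean Re z.\<close>

lemma cmod_diff_of_real_sq:
  "(cmod (of_real ((c + d) / 2) - z))\<^sup>2 = ((d - c) / 2)\<^sup>2 + (Im z)\<^sup>2 - (Re z - c) * (d - Re z)"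
  unfolding cmod_power2 by (simp add: power2_eq_square field_simps)

lemma closed_diskD:
  assumes "z \<in> closed_disk c d" "c \<le> d"
  shows "(Im z)\<^sup>2 \<le> (Re z - c) * (d - Re z)" "c \<le> Re z" "Re z \<le> d"
proof -
  have "cmod (of_real ((c + d) / 2) - z) \<le> (d - c) / 2" using assms(1) by (simp add: closed_disk_def dist_norm)
  then have "(cmod (of_real ((c + d) / 2) - z))\<^sup>2 \<le> ((d - c) / 2)\<^sup>2" by (rule power_mono) simp
  then show 1: "(Im z)\<^sup>2 \<le> (Re z - c) * (d - Re z)" unfolding cmod_diff_of_real_sq by simp
  have 2: "0 \<le> (Re z - c) * (d - Re z)" using 1 zero_le_power2[of "Im z"] by linarith
  show "c \<le> Re z"
  proof (rule ccontr)
    assume "\<not> c \<le> Re z"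
    then have "(Re z - c) * (d - Re z) < 0" using assms(2) by (intro mult_neg_pos) auto
    then show False using 2 by simp
  qed
  show "Re z \<le> d"
  proof (rule ccontr)
    assume "\<not> Re z \<le> d"
    then have "(Re z - c) * (d - Re z) < 0" using assms(2) by (intro mult_pos_neg) auto
    then show False using 2 by simp
  qed
qed

lemma not_open_diskD:
  assumes "z \<notin> open_disk c d" "c \<le> d"
  shows "(Re z - c) * (d - Re z) \<le> (Im z)\<^sup>2"
proof -
  have "(d - c) / 2 \<le> cmod (of_real ((c + d) / 2) - z)" using assms(1) by (simp add: open_disk_def dist_norm)
  then have "((d - c) / 2)\<^sup>2 \<le> (cmod (of_real ((c + d) / 2) - z))\<^sup>2" using assms(2) by (intro power_mono) auto
  then show ?thesis unfolding cmod_diff_of_real_sq by simp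
qed

lemma separated_intervals:
  fixes a b :: "nat \<Rightarrow> real"
  assumes lt: "\<forall>j\<le>N. a j < b j" and gap: "\<forall>j<N. b j < a (Suc j)"
  shows separated_intervals_less: "i < j \<Longrightarrow> j \<le> N \<Longrightarrow> b i < a j"
    and separated_intervals_mono: "i \<le> j \<Longrightarrow> j \<le> N \<Longrightarrow> a i \<le> a j \<and> b i \<le> b j"
    and separated_intervals_cover: "a 0 \<le> \<alpha> \<Longrightarrow> \<alpha> \<le> b N \<Longrightarrow>
      (\<exists>j\<le>N. \<alpha> \<in> {a j..b j}) \<or> (\<exists>j<N. \<alpha> \<in> {b j<..<a (Suc j)})"
proof -
  show less: "b i < a j" if "i < j" "j \<le> N" for i j
    using that
  proof (induction j)
    case (Suc j)
    then show ?case using lt[rule_format, of j] gap[rule_format, of j] by (cases "i = j") auto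
  qed simp
  show "a i \<le> a j \<and> b i \<le> b j" if "i \<le> j" "j \<le> N"
    using less[of i j] lt[rule_format, of i] lt[rule_format, of j] that by (cases "i = j") auto
  have "(\<exists>j\<le>k. \<alpha> \<in> {a j..b j}) \<or> (\<exists>j<k. \<alpha> \<in> {b j<..<a (Suc j)})" if "a 0 \<le> \<alpha>" "\<alpha> \<le> b k" for k
    using that(2)
  proof (induction k)
    case 0
    then show ?case using that(1) by auto
  next
    case (Suc k)
    consider "\<alpha> \<le> b k" | "b k < \<alpha>" "\<alpha> < a (Suc k)" | "a (Suc k) \<le> \<alpha>" by linarith
    then show ?case
    proof cases
      case 1
      then show ?thesis using Suc.IH by (meson le_Suc_eq less_Suc_eq)
    next
      case 2
      then show ?thesis by auto
    next
      case 3
      then show ?thesis using Suc.prems by auto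
    qed
  qed
  then show "a 0 \<le> \<alpha> \<Longrightarrow> \<alpha> \<le> b N \<Longrightarrow> (\<exists>j\<le>N. \<alpha> \<in> {a j..b j}) \<or> (\<exists>j<N. \<alpha> \<in> {b j<..<a (Suc j)})" by blast
qed

lemma disk_region_separated_intervals:
  fixes a b :: "nat \<Rightarrow> real"
  assumes lt: "\<forall>j\<le>N. a j < b j" and gap: "\<forall>j<N. b j < a (Suc j)"
  shows "\<Q> (\<Union>j\<le>N. {a j..b j}) = closed_disk (a 0) (b N) - (\<Union>j<N. open_disk (b j) (a (Suc j)))"
proof -
  let ?S = "\<Union>j\<le>N. {a j..b j}"
  note less = separated_intervals_less[OF lt gap]
    and mono = separated_intervals_mono[OF lt gap]
    and cover = separated_intervals_cover[OF lt gap]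
  have bounds: "a 0 \<le> x \<and> x \<le> b N" if x: "x \<in> ?S" for x
  proof -
    obtain j where "j \<le> N" "x \<in> {a j..b j}" using x by blast
    then show ?thesis using mono[of 0 j] mono[of j N] by auto
  qed
  have mem: "a 0 \<in> ?S" "b N \<in> ?S"
    by (rule UN_I[of 0]; use lt in \<open>auto intro: less_imp_le\<close>) (rule UN_I[of N]; use lt in \<open>auto intro: less_imp_le\<close>)
  have Inf: "Inf ?S = a 0" using mem(1) bounds by (intro cInf_eq_minimum) blast+
  have Sup: "Sup ?S = b N" using mem(2) bounds by (intro cSup_eq_maximum) blast+
  have "{a 0..b N} - ?S = (\<Union>j<N. {b j<..<a (Suc j)})"
  proof (intro equalityI subsetI)
    fix x assume "x \<in> {a 0..b N} - ?S"
    then show "x \<in> (\<Union>j<N. {b j<..<a (Suc j)})" using cover[of x] by auto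
  next
    fix x assume "x \<in> (\<Union>j<N. {b j<..<a (Suc j)})"
    then obtain j where j: "j < N" "b j < x" "x < a (Suc j)" by auto
    have "x \<notin> {a i..b i}" if "i \<le> N" for i
    proof (cases "i \<le> j")
      case True
      then show ?thesis using mono[of i j] j by auto
    next
      case False
      then show ?thesis using mono[of "Suc j" i] j that by auto
    qed
    moreover have "a 0 \<le> x" "x \<le> b N"
      using mono[of 0 j] mono[of "Suc j" N] lt[rule_format, of j] lt[rule_format, of "Suc j"] j by auto
    ultimately show "x \<in> {a 0..b N} - ?S" by auto
  qed
  moreover have "disjoint_family_on (\<lambda>j. {b j<..<a (Suc j)}) {..<N}"
  proof -
    have "{b i<..<a (Suc i)} \<inter> {b j<..<a (Suc j)} = {}" if "i < j" "j < N" for i j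
      using mono[of "Suc i" j] lt[rule_format, of j] that by auto
    then show ?thesis unfolding disjoint_family_on_def by (metis Int_commute lessThan_iff linorder_neqE_nat)
  qed
  ultimately show ?thesis
    using disk_region_eq[of "{..<N}" b "\<lambda>j. a (Suc j)" ?S] gap unfolding Inf Sup by auto
qed

text \<open>The outer disk provides the pair of large variance, the extreme endpoints
  \<open>a 0\<close> and \<open>b N\<close>; the removed disks provide the pair of small
  variance.\<close>

lemma disk_region_atoms:
  fixes a b :: "nat \<Rightarrow> real"
  assumes lt: "\<forall>j\<le>N. a j < b j" and gap: "\<forall>j<N. b j < a (Suc j)"
    and z: "z \<in> \<Q> (\<Union>j\<le>N. {a j..b j})"
  shows "\<exists>w y c. (\<forall>s<4. (0::real) \<le> w s \<and> c s < Suc N \<and> a (c s) \<le> y s \<and> y s \<le> b (c s)) \<and>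
      (\<Sum>s<4. w s) = 1 \<and> (\<Sum>s<4::nat. w s * y s) = Re z \<and> (\<Sum>s<4. w s * (y s)\<^sup>2) = (Re z)\<^sup>2 + (Im z)\<^sup>2"
proof -
  have zin: "z \<in> closed_disk (a 0) (b N)" and zout: "\<And>j. j < N \<Longrightarrow> z \<notin> open_disk (b j) (a (Suc j))"
    using z disk_region_separated_intervals[OF lt gap] by auto
  have "a 0 \<le> b N" using separated_intervals_mono[OF lt gap, of 0 N] lt[rule_format, of N] by simp
  note out = closed_diskD[OF zin this]
  \<comment> \<open>If Re z lies in an interval, both atoms are Re z itself, with variance 0.
    Otherwise they are the ends of the gap around Re z, whose open disk does not contain
    \<open>z\<close>.\<close>
  have "\<exists>p q i k. i \<le> N \<and> k \<le> N \<and> p \<in> {a i..b i} \<and> q \<in> {a k..b k} \<and> p \<le> Re z \<and> Re z \<le> q \<and>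
    (Re z - p) * (q - Re z) \<le> (Im z)\<^sup>2"
    using separated_intervals_cover[OF lt gap out(2,3)]
  proof (elim disjE exE conjE)
    fix j assume "j \<le> N" "Re z \<in> {a j..b j}"
    then show ?thesis by (intro exI[of _ "Re z"] exI[of _ j]) simp
  next
    fix j assume j: "j < N" and "Re z \<in> {b j<..<a (Suc j)}"
    then show ?thesis
      using not_open_diskD[OF zout[OF j]] lt[rule_format, of j] lt[rule_format, of "Suc j"] gap[rule_format, OF j]
      by (intro exI[of _ "b j"] exI[of _ "a (Suc j)"] exI[of _ j] exI[of _ "Suc j"]) simp
  qed
  then obtain p q i k where pq: "i \<le> N" "k \<le> N" "p \<in> {a i..b i}" "q \<in> {a k..b k}" "p \<le> Re z" "Re z \<le> q"
    "(Re z - p) * (q - Re z) \<le> (Im z)\<^sup>2" by blast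
  obtain w where w: "\<forall>s<4. (0::real) \<le> w s" "(\<Sum>s<4. w s) = 1"
    "(\<Sum>s<4::nat. w s * ([a 0, b N, p, q] ! s)) = Re z"
    "(\<Sum>s<4. w s * ([a 0, b N, p, q] ! s)\<^sup>2) = (Re z)\<^sup>2 + (Im z)\<^sup>2"
    using four_atoms[OF out(2,3) pq(5,6,7) out(1)] by blast
  have "\<forall>s<4. [0, N, i, k] ! s < Suc N \<and> a ([0, N, i, k] ! s) \<le> [a 0, b N, p, q] ! s \<and>
    [a 0, b N, p, q] ! s \<le> b ([0, N, i, k] ! s)"
    using pq(1-4) lt[rule_format, of 0] lt[rule_format, of N] by (simp add: numeral_eq_Suc All_less_Suc)
  then show ?thesis
    using w by (intro exI[of _ w] exI[of _ "\<lambda>s. [a 0, b N, p, q] ! s"] exI[of _ "\<lambda>s. [0, N, i, k] ! s"]) simp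
qed

theorem theorem1p1:
  fixes n :: nat
    and \<rho>m \<rho>p :: "nat \<Rightarrow> real"
    and F :: "complex set"
  assumes separable: "separable_space (euclidean :: 'h::complex_hilbert topology)"
    and infinite_dim: "\<not> cfinite_dim (UNIV :: 'h set)"
    and n: "n \<ge> 1"
    and intervals: "\<And>j. j \<in> {1..n} \<Longrightarrow> \<rho>m j < \<rho>p j"
    and gaps: "\<And>j. j \<in> {1..<n} \<Longrightarrow> \<rho>p j < \<rho>m (Suc j)"
    and region: "F \<subseteq> \<Q> (\<Union>j\<in>{1..n}. {\<rho>m j..\<rho>p j})"
    and compact: "compact F"
    and symmetric: "\<And>z. z \<in> F \<longleftrightarrow> cnj z \<in> F"
    and meets: "\<And>j. j \<in> {1..n} \<Longrightarrow> F \<inter> complex_of_real ` {\<rho>m j<..<\<rho>p j} \<noteq> {}"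
  shows "\<exists>(T :: 'h \<Rightarrow> 'h) (L :: nat \<Rightarrow> 'h set).
    bounded_clinear T \<and> T = cadjoint T \<and> L \<in> \<PP> \<and>
    spectrum T = complex_of_real ` (\<Union>j\<in>{1..n}. {\<rho>m j..\<rho>p j}) \<and>
    ((\<lambda>l. hausdorff_distance (spectrum2 T (L l)) F) \<longlonglongrightarrow> 0)"
proof -
  obtain N where N: "n = Suc N" using n by (cases n) auto
  \<comment> \<open>The intervals are renumbered from 0.\<close>
  define a b where "a j = \<rho>m (Suc j)" and "b j = \<rho>p (Suc j)" for j
  have lt: "\<forall>j\<le>N. a j < b j" using intervals by (simp add: a_def b_def N)
  have gap: "\<forall>j<N. b j < a (Suc j)" using gaps by (simp add: a_def b_def N)
  have un: "(\<Union>j\<in>{1..n}. {\<rho>m j..\<rho>p j}) = (\<Union>j\<le>N. {a j..b j})"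
  proof -
    have "{1..n} = Suc ` {..N}" by (simp add: N image_Suc_atMost)
    then show ?thesis unfolding a_def b_def by (simp only: image_image)
  qed
  have "\<exists>x. complex_of_real x \<in> F \<and> a j < x \<and> x < b j" if "j \<le> N" for j
    using meets[of "Suc j"] that by (auto simp: a_def b_def N)
  then obtain f where f: "\<And>j. j \<le> N \<Longrightarrow> complex_of_real (f j) \<in> F \<and> a j < f j \<and> f j < b j"
    by metis
  obtain e :: "nat \<times> nat \<Rightarrow> 'h" where e: "coloured_basis e (Suc N)"
    using exists_coloured_basis[OF separable infinite_dim, of "Suc N"] by auto
  \<comment> \<open>The bound \<open>B\<close> comes from the extreme endpoints, between which all
    others lie.\<close>
  have "construction e (Suc N) a b f F (\<bar>a 0\<bar> + \<bar>b N\<bar>)"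
  proof (intro construction.intro e construction_axioms.intro)
    show "\<bar>a j\<bar> \<le> \<bar>a 0\<bar> + \<bar>b N\<bar> \<and> \<bar>b j\<bar> \<le> \<bar>a 0\<bar> + \<bar>b N\<bar>" if "j < Suc N" for j
      using separated_intervals_mono[OF lt gap, of 0 j] separated_intervals_mono[OF lt gap, of j N]
        lt[rule_format, of j] that by linarith
    show "\<exists>w y c. (\<forall>s<4. (0::real) \<le> w s \<and> c s < Suc N \<and> a (c s) \<le> y s \<and> y s \<le> b (c s)) \<and>
      (\<Sum>s<4. w s) = 1 \<and> (\<Sum>s<4::nat. w s * y s) = Re z \<and> (\<Sum>s<4. w s * (y s)\<^sup>2) = (Re z)\<^sup>2 + (Im z)\<^sup>2"
      if "z \<in> F" for z
      by (rule disk_region_atoms[OF lt gap]) (rule subsetD[OF region[unfolded un] that])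
    show "cnj z \<in> F" if "z \<in> F" for z using symmetric that by blast
  qed (use f compact in \<open>auto simp: less_Suc_eq_le\<close>)
  then show ?thesis
    unfolding un lessThan_Suc_atMost[symmetric] by (rule construction.main_construction)
qed

end
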